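(* Let $\mathbf{GP}^+$ be the Hopf monoid of extended generalized permutahedra and let $\mathbf{ie}\subseteq\mathbf{GP}^+$ be the inclusion-exclusion subspecies. Then: (1) $\mathbf{ie}$ is a Hopf ideal of $\mathbf{GP}^+$; (2) the quotient species $\mathbb I(\mathbf{GP}^+)=\mathbf{GP}^+/\mathbf{ie}$ (whose component $\mathbb I(\mathbf{GP}^+)[I]$ is identified with the span of the indicator functions $\mathbb 1_P$, $P$ an extended generalized permutahedron in $\mathbb R^I$, via $P\mapsto\mathbb 1_P$) inherits the structure of a Hopf monoid, so that $P\mapsto\mathbb 1_P$ is a surjective morphism of Hopf monoids; (3) the Hopf monoid $\mathbb I(\mathbf{GP}^+)$ is isomorphic to the Hopf monoid $\mathbf{w\Sigma}^*$ of weighted ordered set partitions; (4) for any Hopf submonoid $\mathbf H\subseteq\mathbf{GP}^+$ spanned by a family of extended generalized permutahedra, the subspecies $\mathbb I(\mathbf H)\subseteq\mathbb I(\mathbf{GP}^+)$ is a Hopf submonoid of $\mathbb I(\mathbf{GP}^+)$ and the map $P\mapsto \mathbb 1_P$ is a surjective Hopf morphism $\mathbf H\to\mathbb I(\mathbf H)$; i.e. $\mathbb I(\mathbf H)$ is a Hopf quotient of $\mathbf H$.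
   Context: A (connected linear) species $\mathbf F$ assigns to each finite set $I$ a real vector space $\mathbf F[I]$ and to each bijection $I\to J$ a linear isomorphism $\mathbf F[I]\to\mathbf F[J]$, functorially, with $\dim \mathbf F[\emptyset]=1$. A Hopf monoid (Aguiar–Mahajan) is a species with linear products $m_{S,T}:\mathbf H[S]\otimes\mathbf H[T]\to\mathbf H[I]$ and coproducts $\Delta_{S,T}:\mathbf H[I]\to\mathbf H[S]\otimes\mathbf H[T]$ for every decomposition $I=S\sqcup T$ (parts possibly empty), natural under bijections, associative, coassociative, unital, counital, and satisfying the standard compatibility axiom between product and coproduct. Iterated coproducts $\Delta_{S_1,\dots,S_k}$ for set decompositions $I=S_1\sqcup\dots\sqcup S_k$ are defined via coassociativity. A Hopf morphism is a family of linear maps commuting with bijections, products and coproducts. A Hopf ideal of $\mathbf H$ is a subspecies $\mathbf g$ with $m_{S,T}(\mathbf g[S]\otimes\mathbf H[T])+m_{S,T}(\mathbf H[S]\otimes\mathbf g[T])\subseteq\mathbf g[I]$ and $\Delta_{S,T}(\mathbf g[I])\subseteq\mathbf H[S]\otimes\mathbf g[T]+\mathbf g[S]\otimes\mathbf H[T]$. For a finite set $I$, an extended generalized permutahedron in $\mathbb R^I$ is a polyhedron $P=\{x\in\mathbb R^I:\sum_{i\in I}x_i=z(I),\ \sum_{i\in A}x_i\le z(A)\ \forall A\subseteq I\}$ for a function $z:2^I\to\mathbb R\cup\{\infty\}$ with $z(I)$ finite and $z(A)+z(B)\ge z(A\cup B)+z(A\cap B)$ whenever $z(A),z(B)$ are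 finite (equivalently: a polyhedron whose normal fan coarsens a subfan of the braid fan). Bounded ones are called generalized permutahedra. For $I=S\sqcup T$ let $e_{S,T}(x)=\sum_{i\in S}x_i$. If $e_{S,T}$ is bounded above on $P$, the face of $P$ where it is maximized factors as $P|_S\times P/_S$ with $P|_S\subseteq\mathbb R^S$, $P/_S\subseteq\mathbb R^T$ extended generalized permutahedra. $\mathbf{GP}^+[I]$ is the real vector space with basis the extended generalized permutahedra in $\mathbb R^I$; it is a Hopf monoid with product $m_{S,T}(P,Q)=P\times Q$ and coproduct $\Delta_{S,T}(P)=P|_S\otimes P/_S$ if $e_{S,T}$ is bounded above on $P$, and $0$ otherwise. $\mathbb 1_P:\mathbb R^I\to\mathbb R$ denotes the indicator function of $P$. The inclusion-exclusion subspecies is $\mathbf{ie}[I]=\ker\big(\mathbf{GP}^+[I]\to\{\text{functions }\mathbb R^I\to\mathbb R\},\ P\mapsto\mathbb 1_P\big)$; equivalently it is spanned by the relations $P-\sum_i(-1)^{\dim P-\dim P_i}P_i$ coming from polyhedral subdivisions of $P$ into extended generalized permutahedra (sum over the cells $P_i$ of the subdivision not contained in the boundary of $P$). For a subspecies $\mathbf H\subseteq \mathbf{GP}^+$ spanned by a family of polyhedra, $\mathbb I(\mathbf H)[I]$ is the span of the $\mathbb 1_P$ for $P$ in the family in $\mathbb R^I$. An ordered set partition of $I$ is a sequence $F=F_1|\cdots|F_k$ of nonempty pairwise disjoint sets with union $I$; a weighted ordered set partition $(w,F)$ additionally has a weight $w(F_a)\in\mathbb R$ for each block. For $S\subseteq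 I$, $F|_S$ is obtained from $(F_1\cap S)|\cdots|(F_k\cap S)$ by deleting empty blocks. For $(u,F)$ on $S$ and $(v,G)$ on $T$, a quasi-shuffle is a weighted ordered set partition $(w,H)$ of $S\sqcup T$ with $H|_S=F$, $H|_T=G$, and $w(H_i)$ equal to $u(F_a)$, $v(G_b)$ or $u(F_a)+v(G_b)$ according as $H_i=F_a$, $H_i=G_b$, or $H_i=F_a\sqcup G_b$. $\mathbf{w\Sigma}^*[I]$ is the real vector space with basis the weighted ordered set partitions of $I$, with product $(u,F)\cdot(v,G)=\sum(w,H)$ over all quasi-shuffles, and coproduct $\Delta_{S,T}(w,F_1|\cdots|F_k)=(w|,F_1|\cdots|F_j)\otimes(w|,F_{j+1}|\cdots|F_k)$ if $S=F_1\sqcup\cdots\sqcup F_j$ for some $0\le j\le k$ (weights restricted), and $0$ otherwise. *)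

theory Defs
  imports Complex_Main "HOL-Library.Extended_Real"
begin

text \<open>Every vector space in this development is a space of real-valued functions
on some point type; elements of tensor products V \<otimes> W are modelled as functions on
pairs, the pure tensor f \<otimes> g being (x,y) \<mapsto> f x * g y (this embedding of the algebraic
tensor product of function spaces is injective).\<close>

definition fsubspace :: "('x \<Rightarrow> real) set \<Rightarrow> bool" where
  "fsubspace V \<longleftrightarrow> (\<lambda>_. 0) \<in> V \<and> (\<forall>f\<in>V. \<forall>g\<in>V. (\<lambda>x. f x + g x) \<in> V)
     \<and> (\<forall>c. \<forall>f\<in>V. (\<lambda>x. c * f x) \<in> V)"

definition lspan :: "('x \<Rightarrow> real) set \<Rightarrow> ('x \<Rightarrow> real) set" where
  "lspan A = {(\<lambda>x. \<Sum>i<n. c i * f i x) | (n::nat) c f. \<forall>i<n. f i \<in> A}"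

definition linear_on :: "('x \<Rightarrow> real) set \<Rightarrow> (('x \<Rightarrow> real) \<Rightarrow> ('y \<Rightarrow> real)) \<Rightarrow> bool" where
  "linear_on V \<phi> \<longleftrightarrow> (\<forall>f\<in>V. \<forall>g\<in>V. \<forall>c d.
      \<phi> (\<lambda>x. c * f x + d * g x) = (\<lambda>y. c * \<phi> f y + d * \<phi> g y))"

definition bilinear_on :: "('x \<Rightarrow> real) set \<Rightarrow> ('y \<Rightarrow> real) set
     \<Rightarrow> (('x \<Rightarrow> real) \<Rightarrow> ('y \<Rightarrow> real) \<Rightarrow> ('z \<Rightarrow> real)) \<Rightarrow> bool" where
  "bilinear_on V W \<beta> \<longleftrightarrow> (\<forall>g\<in>W. linear_on V (\<lambda>f. \<beta> f g)) \<and> (\<forall>f\<in>V. linear_on W (\<lambda>g. \<beta> f g))"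

definition tens :: "('x \<Rightarrow> real) \<Rightarrow> ('y \<Rightarrow> real) \<Rightarrow> ('x \<times> 'y \<Rightarrow> real)" where
  "tens f g = (\<lambda>(x, y). f x * g y)"

definition tspace :: "('x \<Rightarrow> real) set \<Rightarrow> ('y \<Rightarrow> real) set \<Rightarrow> ('x \<times> 'y \<Rightarrow> real) set" where
  "tspace V W = lspan {tens f g | f g. f \<in> V \<and> g \<in> W}"

definition ssum :: "('x \<Rightarrow> real) set \<Rightarrow> ('x \<Rightarrow> real) set \<Rightarrow> ('x \<Rightarrow> real) set" where
  "ssum A B = {(\<lambda>p. u p + v p) | u v. u \<in> A \<and> v \<in> B}"

definition trep :: "('x \<Rightarrow> real) set \<Rightarrow> ('y \<Rightarrow> real) set \<Rightarrow> ('x \<times> 'y \<Rightarrow> real)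
     \<Rightarrow> (('x \<Rightarrow> real) \<times> ('y \<Rightarrow> real)) list \<Rightarrow> bool" where
  "trep V W u L \<longleftrightarrow> set L \<subseteq> V \<times> W \<and> u = (\<lambda>p. sum_list (map (\<lambda>(a, b). tens a b p) L))"

record ('a, 'x) hstruct =
  hcomp  :: "'a set \<Rightarrow> ('x \<Rightarrow> real) set"
  hrel   :: "('a \<Rightarrow> 'a) \<Rightarrow> 'a set \<Rightarrow> ('x \<Rightarrow> real) \<Rightarrow> ('x \<Rightarrow> real)"
  hmu    :: "'a set \<Rightarrow> 'a set \<Rightarrow> ('x \<Rightarrow> real) \<Rightarrow> ('x \<Rightarrow> real) \<Rightarrow> ('x \<Rightarrow> real)"
  hdelta :: "'a set \<Rightarrow> 'a set \<Rightarrow> ('x \<Rightarrow> real) \<Rightarrow> ('x \<times> 'x \<Rightarrow> real)"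
  hone   :: "'x \<Rightarrow> real"

definition hopf_monoid :: "('a, 'x, 'z) hstruct_scheme \<Rightarrow> bool" where
  "hopf_monoid H \<longleftrightarrow>
    \<comment> \<open>species\<close>
    (\<forall>I. finite I \<longrightarrow> fsubspace (hcomp H I)) \<and>
    (\<forall>I \<sigma>. finite I \<and> inj_on \<sigma> I \<longrightarrow>
        linear_on (hcomp H I) (hrel H \<sigma> I) \<and> hrel H \<sigma> I ` hcomp H I \<subseteq> hcomp H (\<sigma> ` I)) \<and>
    (\<forall>I \<sigma> \<tau>. finite I \<and> (\<forall>i\<in>I. \<sigma> i = \<tau> i) \<longrightarrow> (\<forall>f\<in>hcomp H I. hrel H \<sigma> I f = hrel H \<tau> I f)) \<and>
    (\<forall>I. finite I \<longrightarrow> (\<forall>f\<in>hcomp H I. hrel H id I f = f)) \<and>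
    (\<forall>I \<sigma> \<tau>. finite I \<and> inj_on \<sigma> I \<and> inj_on \<tau> (\<sigma> ` I) \<longrightarrow>
        (\<forall>f\<in>hcomp H I. hrel H (\<tau> \<circ> \<sigma>) I f = hrel H \<tau> (\<sigma> ` I) (hrel H \<sigma> I f))) \<and>
    \<comment> \<open>connected, with unit\<close>
    hone H \<in> hcomp H {} \<and> hone H \<noteq> (\<lambda>_. 0) \<and> (\<forall>v\<in>hcomp H {}. \<exists>c. v = (\<lambda>x. c * hone H x)) \<and>
    \<comment> \<open>product\<close>
    (\<forall>S T. finite S \<and> finite T \<and> S \<inter> T = {} \<longrightarrow>
        bilinear_on (hcomp H S) (hcomp H T) (hmu H S T) \<and>
        (\<forall>f\<in>hcomp H S. \<forall>g\<in>hcomp H T. hmu H S T f g \<in> hcomp H (S \<union> T))) \<and>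
    (\<forall>S T \<sigma>. finite S \<and> finite T \<and> S \<inter> T = {} \<and> inj_on \<sigma> (S \<union> T) \<longrightarrow>
        (\<forall>f\<in>hcomp H S. \<forall>g\<in>hcomp H T.
           hrel H \<sigma> (S \<union> T) (hmu H S T f g) = hmu H (\<sigma> ` S) (\<sigma> ` T) (hrel H \<sigma> S f) (hrel H \<sigma> T g))) \<and>
    (\<forall>R S T. finite R \<and> finite S \<and> finite T \<and> R \<inter> S = {} \<and> R \<inter> T = {} \<and> S \<inter> T = {} \<longrightarrow>
        (\<forall>f\<in>hcomp H R. \<forall>g\<in>hcomp H S. \<forall>h\<in>hcomp H T.
           hmu H (R \<union> S) T (hmu H R S f g) h = hmu H R (S \<union> T) f (hmu H S T g h))) \<and>
    (\<forall>I. finite I \<longrightarrow> (\<forall>f\<in>hcomp H I. hmu H {} I (hone H) f = f \<and> hmu H I {} f (hone H) = f)) \<and>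
    \<comment> \<open>coproduct\<close>
    (\<forall>S T. finite S \<and> finite T \<and> S \<inter> T = {} \<longrightarrow>
        linear_on (hcomp H (S \<union> T)) (hdelta H S T) \<and>
        (\<forall>h\<in>hcomp H (S \<union> T). hdelta H S T h \<in> tspace (hcomp H S) (hcomp H T))) \<and>
    (\<forall>S T \<sigma>. finite S \<and> finite T \<and> S \<inter> T = {} \<and> inj_on \<sigma> (S \<union> T) \<longrightarrow>
        (\<forall>h\<in>hcomp H (S \<union> T). \<forall>L. trep (hcomp H S) (hcomp H T) (hdelta H S T h) L \<longrightarrow>
           hdelta H (\<sigma> ` S) (\<sigma> ` T) (hrel H \<sigma> (S \<union> T) h)
             = (\<lambda>p. sum_list (map (\<lambda>(a, b). tens (hrel H \<sigma> S a) (hrel H \<sigma> T b) p) L)))) \<and>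
    (\<forall>R S T. finite R \<and> finite S \<and> finite T \<and> R \<inter> S = {} \<and> R \<inter> T = {} \<and> S \<inter> T = {} \<longrightarrow>
        (\<forall>h\<in>hcomp H (R \<union> S \<union> T). \<forall>L M.
           trep (hcomp H (R \<union> S)) (hcomp H T) (hdelta H (R \<union> S) T h) L \<and>
           trep (hcomp H R) (hcomp H (S \<union> T)) (hdelta H R (S \<union> T) h) M \<longrightarrow>
           (\<forall>x y z. sum_list (map (\<lambda>(a, b). hdelta H R S a (x, y) * b z) L)
                  = sum_list (map (\<lambda>(a, b). a x * hdelta H S T b (y, z)) M)))) \<and>
    \<comment> \<open>counit (connected form: \<Delta>_{{},I} h = 1 \<otimes> h and \<Delta>_{I,{}} h = h \<otimes> 1)\<close>
    (\<forall>I. finite I \<longrightarrow> (\<forall>h\<in>hcomp H I.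
        hdelta H {} I h = tens (hone H) h \<and> hdelta H I {} h = tens h (hone H))) \<and>
    \<comment> \<open>compatibility of product and coproduct\<close>
    (\<forall>S1 S2 T1 T2. finite S1 \<and> finite S2 \<and> finite T1 \<and> finite T2 \<and> S1 \<inter> S2 = {} \<and>
        T1 \<inter> T2 = {} \<and> S1 \<union> S2 = T1 \<union> T2 \<longrightarrow>
       (\<forall>f\<in>hcomp H S1. \<forall>g\<in>hcomp H S2. \<forall>L M.
          trep (hcomp H (S1 \<inter> T1)) (hcomp H (S1 \<inter> T2)) (hdelta H (S1 \<inter> T1) (S1 \<inter> T2) f) L \<and>
          trep (hcomp H (S2 \<inter> T1)) (hcomp H (S2 \<inter> T2)) (hdelta H (S2 \<inter> T1) (S2 \<inter> T2) g) M \<longrightarrow>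
          hdelta H T1 T2 (hmu H S1 S2 f g)
            = (\<lambda>(p, q). sum_list (map (\<lambda>(a, b). sum_list (map (\<lambda>(c, d).
                  hmu H (S1 \<inter> T1) (S2 \<inter> T1) a c p * hmu H (S1 \<inter> T2) (S2 \<inter> T2) b d q) M)) L))))"

definition hopf_morphism :: "('a set \<Rightarrow> ('x \<Rightarrow> real) \<Rightarrow> ('y \<Rightarrow> real))
    \<Rightarrow> ('a, 'x, 'z1) hstruct_scheme \<Rightarrow> ('a, 'y, 'z2) hstruct_scheme \<Rightarrow> bool" where
  "hopf_morphism \<phi> H K \<longleftrightarrow>
    (\<forall>I. finite I \<longrightarrow> linear_on (hcomp H I) (\<phi> I) \<and> \<phi> I ` hcomp H I \<subseteq> hcomp K I) \<and>
    (\<forall>I \<sigma>. finite I \<and> inj_on \<sigma> I \<longrightarrow>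
        (\<forall>f\<in>hcomp H I. \<phi> (\<sigma> ` I) (hrel H \<sigma> I f) = hrel K \<sigma> I (\<phi> I f))) \<and>
    (\<forall>S T. finite S \<and> finite T \<and> S \<inter> T = {} \<longrightarrow>
        (\<forall>f\<in>hcomp H S. \<forall>g\<in>hcomp H T.
           \<phi> (S \<union> T) (hmu H S T f g) = hmu K S T (\<phi> S f) (\<phi> T g)) \<and>
        (\<forall>h\<in>hcomp H (S \<union> T). \<forall>L. trep (hcomp H S) (hcomp H T) (hdelta H S T h) L \<longrightarrow>
           hdelta K S T (\<phi> (S \<union> T) h) = (\<lambda>p. sum_list (map (\<lambda>(a, b). tens (\<phi> S a) (\<phi> T b) p) L)))) \<and>
    \<phi> {} (hone H) = hone K"

definition hopf_surj :: "('a set \<Rightarrow> ('x \<Rightarrow> real) \<Rightarrow> ('y \<Rightarrow> real))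
    \<Rightarrow> ('a, 'x, 'z1) hstruct_scheme \<Rightarrow> ('a, 'y, 'z2) hstruct_scheme \<Rightarrow> bool" where
  "hopf_surj \<phi> H K \<longleftrightarrow> (\<forall>I. finite I \<longrightarrow> \<phi> I ` hcomp H I = hcomp K I)"

definition hopf_iso :: "('a set \<Rightarrow> ('x \<Rightarrow> real) \<Rightarrow> ('y \<Rightarrow> real))
    \<Rightarrow> ('a, 'x, 'z1) hstruct_scheme \<Rightarrow> ('a, 'y, 'z2) hstruct_scheme \<Rightarrow> bool" where
  "hopf_iso \<phi> H K \<longleftrightarrow> hopf_morphism \<phi> H K \<and> (\<forall>I. finite I \<longrightarrow> bij_betw (\<phi> I) (hcomp H I) (hcomp K I))"

definition hopf_ideal :: "('a, 'x, 'z) hstruct_scheme \<Rightarrow> ('a set \<Rightarrow> ('x \<Rightarrow> real) set) \<Rightarrow> bool" where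
  "hopf_ideal H g \<longleftrightarrow>
    (\<forall>I. finite I \<longrightarrow> fsubspace (g I) \<and> g I \<subseteq> hcomp H I) \<and>
    (\<forall>I \<sigma>. finite I \<and> inj_on \<sigma> I \<longrightarrow> hrel H \<sigma> I ` g I \<subseteq> g (\<sigma> ` I)) \<and>
    (\<forall>S T. finite S \<and> finite T \<and> S \<inter> T = {} \<longrightarrow>
       (\<forall>f\<in>g S. \<forall>h\<in>hcomp H T. hmu H S T f h \<in> g (S \<union> T)) \<and>
       (\<forall>f\<in>hcomp H S. \<forall>h\<in>g T. hmu H S T f h \<in> g (S \<union> T)) \<and>
       (\<forall>h\<in>g (S \<union> T). hdelta H S T h \<in> ssum (tspace (hcomp H S) (g T)) (tspace (g S) (hcomp H T))))"

definition hopf_submonoid :: "('a, 'x, 'z) hstruct_scheme \<Rightarrow> ('a set \<Rightarrow> ('x \<Rightarrow> real) set) \<Rightarrow> bool" where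
  "hopf_submonoid H C \<longleftrightarrow>
    (\<forall>I. finite I \<longrightarrow> fsubspace (C I) \<and> C I \<subseteq> hcomp H I) \<and>
    (\<forall>I \<sigma>. finite I \<and> inj_on \<sigma> I \<longrightarrow> hrel H \<sigma> I ` C I \<subseteq> C (\<sigma> ` I)) \<and>
    hone H \<in> C {} \<and>
    (\<forall>S T. finite S \<and> finite T \<and> S \<inter> T = {} \<longrightarrow>
       (\<forall>f\<in>C S. \<forall>h\<in>C T. hmu H S T f h \<in> C (S \<union> T)) \<and>
       (\<forall>h\<in>C (S \<union> T). hdelta H S T h \<in> tspace (C S) (C T)))"

text \<open>R^I is realised as the functions 'a \<Rightarrow> real vanishing outside I.\<close>
definition RI :: "'a set \<Rightarrow> ('a \<Rightarrow> real) set" where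
  "RI I = {x. \<forall>i. i \<notin> I \<longrightarrow> x i = 0}"

definition restr :: "'a set \<Rightarrow> ('a \<Rightarrow> real) \<Rightarrow> ('a \<Rightarrow> real)" where
  "restr S x = (\<lambda>i. if i \<in> S then x i else 0)"

definition egp :: "'a set \<Rightarrow> ('a \<Rightarrow> real) set \<Rightarrow> bool" where
  "egp I P \<longleftrightarrow> finite I \<and> P \<noteq> {} \<and>
     (\<exists>z :: 'a set \<Rightarrow> ereal.
        z I \<noteq> \<infinity> \<and> (\<forall>A\<subseteq>I. z A \<noteq> -\<infinity>) \<and>
        (\<forall>A B. A \<subseteq> I \<and> B \<subseteq> I \<and> z A \<noteq> \<infinity> \<and> z B \<noteq> \<infinity> \<longrightarrow> z (A \<union> B) + z (A \<inter> B) \<le> z A + z B) \<and>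
        P = {x \<in> RI I. ereal (sum x I) = z I \<and> (\<forall>A\<subseteq>I. ereal (sum x A) \<le> z A)})"

definition pprod :: "'a set \<Rightarrow> 'a set \<Rightarrow> ('a \<Rightarrow> real) set \<Rightarrow> ('a \<Rightarrow> real) set \<Rightarrow> ('a \<Rightarrow> real) set" where
  "pprod S T P Q = {x \<in> RI (S \<union> T). restr S x \<in> P \<and> restr T x \<in> Q}"

definition ebounded :: "'a set \<Rightarrow> ('a \<Rightarrow> real) set \<Rightarrow> bool" where
  "ebounded S P \<longleftrightarrow> bdd_above ((\<lambda>x. sum x S) ` P)"

definition eface :: "'a set \<Rightarrow> ('a \<Rightarrow> real) set \<Rightarrow> ('a \<Rightarrow> real) set" where
  "eface S P = {x \<in> P. \<forall>y\<in>P. sum y S \<le> sum x S}"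

text \<open>P|_S and P/_S (the factors of the face)\<close>
definition pres :: "'a set \<Rightarrow> ('a \<Rightarrow> real) set \<Rightarrow> ('a \<Rightarrow> real) set" where
  "pres S P = restr S ` eface S P"
definition pcon :: "'a set \<Rightarrow> 'a set \<Rightarrow> ('a \<Rightarrow> real) set \<Rightarrow> ('a \<Rightarrow> real) set" where
  "pcon S T P = restr T ` eface S P"

definition ppush :: "('a \<Rightarrow> 'a) \<Rightarrow> 'a set \<Rightarrow> ('a \<Rightarrow> real) set \<Rightarrow> ('a \<Rightarrow> real) set" where
  "ppush \<sigma> I P = {y \<in> RI (\<sigma> ` I). (\<lambda>i. if i \<in> I then y (\<sigma> i) else 0) \<in> P}"

text \<open>GP+[I]: finitely supported coefficient functions on the basis of EGPs in R^I\<close>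
definition gp_comp :: "'a set \<Rightarrow> (('a \<Rightarrow> real) set \<Rightarrow> real) set" where
  "gp_comp I = {f. finite {P. f P \<noteq> 0} \<and> (\<forall>P. f P \<noteq> 0 \<longrightarrow> egp I P)}"

definition basisv :: "'b \<Rightarrow> ('b \<Rightarrow> real)" where
  "basisv P = (\<lambda>Q. if Q = P then 1 else 0)"

definition GPplus :: "('a, ('a \<Rightarrow> real) set) hstruct" where
  "GPplus = \<lparr>
     hcomp = gp_comp,
     hrel = (\<lambda>\<sigma> I f. (\<lambda>Q. \<Sum>P\<in>{P. f P \<noteq> 0 \<and> ppush \<sigma> I P = Q}. f P)),
     hmu = (\<lambda>S T f g. (\<lambda>R. \<Sum>(P, Q)\<in>{(P, Q). f P \<noteq> 0 \<and> g Q \<noteq> 0 \<and> pprod S T P Q = R}. f P * g Q)),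
     hdelta = (\<lambda>S T h. (\<lambda>(P1, P2). \<Sum>R\<in>{R. h R \<noteq> 0 \<and> ebounded S R \<and> pres S R = P1 \<and> pcon S T R = P2}. h R)),
     hone = basisv (RI {}) \<rparr>"

definition indf :: "'a set \<Rightarrow> (('a \<Rightarrow> real) set \<Rightarrow> real) \<Rightarrow> (('a \<Rightarrow> real) \<Rightarrow> real)" where
  "indf I f = (\<lambda>x. \<Sum>P\<in>{P. f P \<noteq> 0}. f P * (if x \<in> P then 1 else 0))"

definition indic :: "('a \<Rightarrow> real) set \<Rightarrow> (('a \<Rightarrow> real) \<Rightarrow> real)" where
  "indic P = (\<lambda>x. if x \<in> P then 1 else 0)"

definition ie :: "'a set \<Rightarrow> (('a \<Rightarrow> real) set \<Rightarrow> real) set" where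
  "ie I = {f \<in> gp_comp I. indf I f = (\<lambda>_. 0)}"

definition wosp :: "'a set \<Rightarrow> ('a set \<times> real) list \<Rightarrow> bool" where
  "wosp I F \<longleftrightarrow> finite I \<and> (\<forall>p\<in>set F. fst p \<noteq> {}) \<and>
     (\<forall>i<length F. \<forall>j<length F. i \<noteq> j \<longrightarrow> fst (F ! i) \<inter> fst (F ! j) = {}) \<and>
     \<Union> (fst ` set F) = I"

definition ores :: "'a set \<Rightarrow> 'a set list \<Rightarrow> 'a set list" where
  "ores S F = filter (\<lambda>B. B \<noteq> {}) (map (\<lambda>B. B \<inter> S) F)"

text \<open>weight of block B in F (0 if B is not a block)\<close>
definition wt :: "('a set \<times> real) list \<Rightarrow> 'a set \<Rightarrow> real" where
  "wt F B = sum_list (map (\<lambda>(C, w). if C = B then w else 0) F)"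

definition qshuffle :: "'a set \<Rightarrow> 'a set \<Rightarrow> ('a set \<times> real) list \<Rightarrow> ('a set \<times> real) list
    \<Rightarrow> ('a set \<times> real) list \<Rightarrow> bool" where
  "qshuffle S T F G H \<longleftrightarrow> wosp (S \<union> T) H \<and> ores S (map fst H) = map fst F \<and>
     ores T (map fst H) = map fst G \<and> (\<forall>(B, w)\<in>set H. w = wt F (B \<inter> S) + wt G (B \<inter> T))"

definition w_comp :: "'a set \<Rightarrow> (('a set \<times> real) list \<Rightarrow> real) set" where
  "w_comp I = {f. finite {F. f F \<noteq> 0} \<and> (\<forall>F. f F \<noteq> 0 \<longrightarrow> wosp I F)}"

definition WSigma :: "('a, ('a set \<times> real) list) hstruct" where
  "WSigma = \<lparr>
     hcomp = w_comp,
     hrel = (\<lambda>\<sigma> I f. (\<lambda>G. \<Sum>F\<in>{F. f F \<noteq> 0 \<and> map (\<lambda>(B, w). (\<sigma> ` B, w)) F = G}. f F)),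
     hmu = (\<lambda>S T f g. (\<lambda>H. \<Sum>(F, G)\<in>{(F, G). f F \<noteq> 0 \<and> g G \<noteq> 0 \<and> qshuffle S T F G H}. f F * g G)),
     hdelta = (\<lambda>S T h. (\<lambda>(F1, F2). if \<Union> (fst ` set F1) = S then h (F1 @ F2) else 0)),
     hone = basisv [] \<rparr>"

end

theory Submission
  imports "HOL-Analysis.Function_Topology" Defs
begin

text \<open>
An extended generalized permutahedron \<open>P\<close> in \<open>R^I\<close> is determined by its support function \<open>h\<close> on
subsets of \<open>I\<close>, a submodular function that is finite on a sublattice of subsets. Send \<open>P\<close> to the sum
of all weighted ordered set partitions \<open>(w, F)\<close> such that \<open>h\<close> is finite on every union \<open>U\<close> of an
initial segment of blocks of \<open>F\<close> and \<open>h(U)\<close> is the total weight of that segment. On support functions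
products, restrictions and contractions are given by explicit formulas, which show that this map is
compatible with all operations; it is onto, because on the cones \<open>x(U) \<le> c(U)\<close>, with \<open>U\<close> in a chain,
it is unitriangular. Its kernel is \<open>ie\<close>:

\<^item> The map determines the indicator function. If \<open>x(I) = h(I)\<close> and \<open>x\<close> is not in \<open>P\<close>, let \<open>N\<close> be the set
  of all \<open>U\<close> with \<open>h(U) < x(U)\<close> and \<open>U0\<close> a minimizer of \<open>h - x\<close>. By submodularity \<open>N\<close> is closed under
  union with \<open>U0\<close>, so its order complex has Euler characteristic \<open>1\<close>. Hence the indicator function at
  \<open>x\<close> is a signed count of chains in \<open>N\<close>, which is linear in the image of \<open>P\<close>.

\<^item> The indicator function determines the image. By the greedy algorithm \<open>P\<close> meets the halfspaces
  \<open>x(U) \<ge> b(U)\<close>, \<open>U\<close> in a chain, if and only if \<open>b(U) \<le> h(U)\<close> for all these \<open>U\<close>, and being nonempty is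
  a valuation on compact convex sets. Alternating over \<open>b(U) \<in> {c(U), c(U) + e}\<close> detects the
  condition \<open>h(U) = c(U)\<close>.

The structure of the quotient is then transported along this map.
\<close>

section \<open>Spaces of real-valued functions\<close>

text \<open>The coproduct is the obstacle. Relabellings and products of indicator functions have
  pointwise formulas, but \<open>P|_S\<close> and \<open>P/_S\<close> depend on whether and where a
  linear form attains its maximum on \<open>P\<close>, so it is not evident that a linear relation
  among indicator functions survives. Ordered set partitions are coordinates in which the coproduct
  merely cuts a list. Once the kernel of the map to them is known to be \<open>ie\<close>, the
  coideal property is linear algebra: the kernel of a tensor product of maps comes from the kernels
  of its factors. Unboundedness shapes the other half of the kernel computation. The valuation
  property is proved by slicing compact sets, so polyhedra are first cut by a box that is large
  enough not to change which of them meet the halfspaces. Where \<open>h(U)\<close> is infinite,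
  both thresholds \<open>c(U)\<close> and \<open>c(U) + e\<close> can be met, and the two
  contributions cancel. The Hopf axioms are verified directly on indicator functions: on generators
  the transported coproduct is again restriction tensor contraction, so each coproduct axiom becomes
  an identity between faces, checked on support functions.\<close>

lemma fsubspaceD:
  assumes "fsubspace V"
  shows fsubspace_zero: "(\<lambda>_. 0) \<in> V"
    and fsubspace_add: "f \<in> V \<Longrightarrow> g \<in> V \<Longrightarrow> (\<lambda>x. f x + g x) \<in> V"
    and fsubspace_scale: "f \<in> V \<Longrightarrow> (\<lambda>x. c * f x) \<in> V"
  using assms by (auto simp: fsubspace_def)

lemma fsubspace_lincomb:
  "fsubspace V \<Longrightarrow> f \<in> V \<Longrightarrow> g \<in> V \<Longrightarrow> (\<lambda>x. c * f x + d * g x) \<in> V"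
  using fsubspace_add[OF _ fsubspace_scale fsubspace_scale] by blast

lemma fsubspace_sum:
  assumes "fsubspace V" "\<And>i. i \<in> A \<Longrightarrow> f i \<in> V"
  shows "(\<lambda>x. \<Sum>i\<in>A. c i * f i x) \<in> V"
  using assms(2)
proof (induction A rule: infinite_finite_induct)
  case (insert i A)
  then show ?case
    using fsubspace_add[OF assms(1) fsubspace_scale[OF assms(1), of "f i" "c i"]] by auto
qed (auto simp: fsubspace_zero[OF assms(1)])

lemma lspanI: "(\<And>i. i < n \<Longrightarrow> f i \<in> A) \<Longrightarrow> (\<lambda>x. \<Sum>i<(n::nat). c i * f i x) \<in> lspan A"
  unfolding lspan_def by blast

lemma lspanE:
  assumes "g \<in> lspan A"
  obtains n :: nat and c f where "g = (\<lambda>x. \<Sum>i<n. c i * f i x)" "\<And>i. i < n \<Longrightarrow> f i \<in> A"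
  using assms unfolding lspan_def by blast

lemma fsubspace_lspan: "fsubspace (lspan A)"
  unfolding fsubspace_def
proof (intro conjI ballI allI)
  show "(\<lambda>_. 0) \<in> lspan A"
    unfolding lspan_def by (auto intro!: exI[of _ "0::nat"])
next
  fix f g assume fg: "f \<in> lspan A" "g \<in> lspan A"
  obtain n c F where f: "f = (\<lambda>x. \<Sum>i<(n::nat). c i * F i x)" "\<And>i. i < n \<Longrightarrow> F i \<in> A"
    by (rule lspanE[OF fg(1)]) blast
  obtain m d G where g: "g = (\<lambda>x. \<Sum>i<(m::nat). d i * G i x)" "\<And>i. i < m \<Longrightarrow> G i \<in> A"
    by (rule lspanE[OF fg(2)]) blast
  let ?c = "\<lambda>i. if i < n then c i else d (i - n)" and ?F = "\<lambda>i. if i < n then F i else G (i - n)"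
  have split: "(\<Sum>i<n + m. h i) = (\<Sum>i<n. h i) + (\<Sum>i<m. h (n + i))" for h :: "nat \<Rightarrow> real"
    by (induction m) auto
  have "(\<lambda>x. f x + g x) = (\<lambda>x. \<Sum>i<n + m. ?c i * ?F i x)"
    unfolding split by (simp add: f(1) g(1))
  moreover have "(\<lambda>x. \<Sum>i<n + m. ?c i * ?F i x) \<in> lspan A"
    by (rule lspanI) (use f(2) g(2) in auto)
  ultimately show "(\<lambda>x. f x + g x) \<in> lspan A" by simp
next
  fix e f assume fA: "f \<in> lspan A"
  obtain n c F where f: "f = (\<lambda>x. \<Sum>i<(n::nat). c i * F i x)" "\<And>i. i < n \<Longrightarrow> F i \<in> A"
    by (rule lspanE[OF fA]) blast
  have "(\<lambda>x. e * f x) = (\<lambda>x. \<Sum>i<n. (e * c i) * F i x)"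
    by (simp add: f(1) sum_distrib_left mult.assoc)
  then show "(\<lambda>x. e * f x) \<in> lspan A"
    using lspanI[OF f(2), of n] by simp
qed

lemma lspan_superset: "f \<in> A \<Longrightarrow> f \<in> lspan A"
  unfolding lspan_def by (auto intro!: exI[of _ "1::nat"] exI[of _ "\<lambda>_. 1"] exI[of _ "\<lambda>_. f"])

lemma lspan_minimal:
  assumes "fsubspace V" "A \<subseteq> V" shows "lspan A \<subseteq> V"
proof
  fix g assume gA: "g \<in> lspan A"
  obtain n c f where g: "g = (\<lambda>x. \<Sum>i<(n::nat). c i * f i x)" "\<And>i. i < n \<Longrightarrow> f i \<in> A"
    by (rule lspanE[OF gA]) blast
  show "g \<in> V" unfolding g(1)
    by (rule fsubspace_sum[OF assms(1)]) (use g(2) assms(2) in auto)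
qed

lemma lspan_mono: "A \<subseteq> B \<Longrightarrow> lspan A \<subseteq> lspan B"
  by (meson fsubspace_lspan lspan_minimal lspan_superset subset_iff)

lemma linear_onD:
  "linear_on V \<phi> \<Longrightarrow> f \<in> V \<Longrightarrow> g \<in> V \<Longrightarrow>
    \<phi> (\<lambda>x. c * f x + d * g x) = (\<lambda>y. c * \<phi> f y + d * \<phi> g y)"
  by (simp add: linear_on_def)

lemma linear_on_subset: "linear_on V \<phi> \<Longrightarrow> W \<subseteq> V \<Longrightarrow> linear_on W \<phi>"
  unfolding linear_on_def by blast

lemma linear_on_zero:
  assumes "linear_on V \<phi>" "fsubspace V" shows "\<phi> (\<lambda>_. 0) = (\<lambda>_. 0)"
  using linear_onD[OF assms(1) fsubspace_zero[OF assms(2)] fsubspace_zero[OF assms(2)], of 0 0] by simp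

lemma linear_on_scale:
  assumes "linear_on V \<phi>" "f \<in> V" shows "\<phi> (\<lambda>x. c * f x) = (\<lambda>y. c * \<phi> f y)"
  using linear_onD[OF assms assms(2), of c 0] by simp

lemma linear_on_id: "linear_on V (\<lambda>f. f)"
  by (simp add: linear_on_def)

lemma linear_on_comp:
  assumes "linear_on V \<phi>" "linear_on W \<psi>" "\<And>f. f \<in> V \<Longrightarrow> \<phi> f \<in> W"
  shows "linear_on V (\<lambda>f. \<psi> (\<phi> f))"
  using assms unfolding linear_on_def by simp

lemma linear_on_sum_list:
  assumes "linear_on V \<phi>" "fsubspace V" "\<And>a. a \<in> set L \<Longrightarrow> F a \<in> V"
  shows "(\<lambda>x. \<Sum>a\<leftarrow>L. c a * F a x) \<in> V \<and>
     \<phi> (\<lambda>x. \<Sum>a\<leftarrow>L. c a * F a x) = (\<lambda>y. \<Sum>a\<leftarrow>L. c a * \<phi> (F a) y)"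
  using assms(3)
proof (induction L)
  case (Cons a L)
  then have "(\<lambda>x. \<Sum>a\<leftarrow>L. c a * F a x) \<in> V" "F a \<in> V"
     "\<phi> (\<lambda>x. \<Sum>a\<leftarrow>L. c a * F a x) = (\<lambda>y. \<Sum>a\<leftarrow>L. c a * \<phi> (F a) y)" by auto
  then show ?case
    using linear_onD[OF assms(1), of "F a" "\<lambda>x. \<Sum>a\<leftarrow>L. c a * F a x" "c a" 1]
      fsubspace_lincomb[OF assms(2), of "F a" "\<lambda>x. \<Sum>a\<leftarrow>L. c a * F a x" "c a" 1] by simp
qed (simp_all add: linear_on_zero[OF assms(1,2)] fsubspace_zero[OF assms(2)])

lemma linear_on_lspan_eq:
  assumes "linear_on (lspan A) \<phi>" "linear_on (lspan A) \<psi>" "\<And>f. f \<in> A \<Longrightarrow> \<phi> f = \<psi> f" "f \<in> lspan A"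
  shows "\<phi> f = \<psi> f"
proof -
  let ?E = "{f \<in> lspan A. \<phi> f = \<psi> f}"
  have "fsubspace ?E"
    unfolding fsubspace_def
    using linear_on_zero[OF assms(1) fsubspace_lspan] linear_on_zero[OF assms(2) fsubspace_lspan]
      fsubspaceD[OF fsubspace_lspan[of A]] linear_on_scale[OF assms(1)] linear_on_scale[OF assms(2)]
      linear_onD[OF assms(1), of _ _ 1 1] linear_onD[OF assms(2), of _ _ 1 1]
    by auto
  then have "lspan A \<subseteq> ?E"
    by (rule lspan_minimal) (use assms(3) lspan_superset in blast)
  then show ?thesis using assms(4) by blast
qed

lemma linear_on_image_subset:
  assumes "linear_on (lspan A) \<phi>" "fsubspace W" "\<And>f. f \<in> A \<Longrightarrow> \<phi> f \<in> W"
  shows "\<phi> ` lspan A \<subseteq> W"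
proof -
  let ?E = "{f \<in> lspan A. \<phi> f \<in> W}"
  have "fsubspace ?E"
    unfolding fsubspace_def
    using linear_on_zero[OF assms(1) fsubspace_lspan] fsubspaceD[OF assms(2)]
      fsubspaceD[OF fsubspace_lspan[of A]] linear_on_scale[OF assms(1)]
      linear_onD[OF assms(1), of _ _ 1 1]
    by auto
  then have "lspan A \<subseteq> ?E"
    by (rule lspan_minimal) (use assms(3) lspan_superset in blast)
  then show ?thesis by blast
qed

lemma fsubspace_image:
  assumes "linear_on V \<phi>" "fsubspace V" shows "fsubspace (\<phi> ` V)"
  unfolding fsubspace_def
proof (intro conjI ballI allI)
  show "(\<lambda>_. 0) \<in> \<phi> ` V"
    using linear_on_zero[OF assms] fsubspace_zero[OF assms(2)] by (metis image_eqI)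
next
  fix f g assume "f \<in> \<phi> ` V" "g \<in> \<phi> ` V"
  then obtain a b where ab: "a \<in> V" "b \<in> V" "f = \<phi> a" "g = \<phi> b" by blast
  then show "(\<lambda>x. f x + g x) \<in> \<phi> ` V"
    using linear_onD[OF assms(1) ab(1,2), of 1 1] fsubspace_add[OF assms(2) ab(1,2)]
    by (auto intro!: image_eqI[of _ \<phi> "\<lambda>x. a x + b x"])
next
  fix c f assume "f \<in> \<phi> ` V"
  then obtain a where "a \<in> V" "f = \<phi> a" by blast
  then show "(\<lambda>x. c * f x) \<in> \<phi> ` V"
    using linear_on_scale[OF assms(1)] fsubspace_scale[OF assms(2)]
    by (auto intro!: image_eqI[of _ \<phi> "\<lambda>x. c * a x"])
qed

lemma linear_on_image_lspan:
  assumes "linear_on (lspan A) \<phi>" shows "\<phi> ` lspan A = lspan (\<phi> ` A)"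
proof
  show "\<phi> ` lspan A \<subseteq> lspan (\<phi> ` A)"
    by (rule linear_on_image_subset[OF assms fsubspace_lspan]) (simp add: lspan_superset)
  show "lspan (\<phi> ` A) \<subseteq> \<phi> ` lspan A"
    by (rule lspan_minimal[OF fsubspace_image[OF assms fsubspace_lspan]]) (auto intro: lspan_superset)
qed

section \<open>Tensor products\<close>

lemma fsubspace_tspace: "fsubspace (tspace V W)"
  by (simp add: tspace_def fsubspace_lspan)

lemma tens_in_tspace: "f \<in> V \<Longrightarrow> g \<in> W \<Longrightarrow> tens f g \<in> tspace V W"
  unfolding tspace_def by (rule lspan_superset) blast

lemma trep_tens: "f \<in> V \<Longrightarrow> g \<in> W \<Longrightarrow> trep V W (tens f g) [(f, g)]"
  by (simp add: trep_def)

lemma trepD: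
  assumes "trep V W u L"
  shows trep_subset: "set L \<subseteq> V \<times> W"
    and trep_eval: "(\<Sum>(a, b)\<leftarrow>L. a x * b y) = u (x, y)"
  using assms by (auto simp: trep_def tens_def)

lemma trep_mono: "trep V W u L \<Longrightarrow> V \<subseteq> V' \<Longrightarrow> W \<subseteq> W' \<Longrightarrow> trep V' W' u L"
  unfolding trep_def by blast

lemma trep_in_tspace:
  assumes "trep V W u L" shows "u \<in> tspace V W"
proof -
  have "set L \<subseteq> V \<times> W \<Longrightarrow> (\<lambda>p. \<Sum>(a, b)\<leftarrow>L. tens a b p) \<in> tspace V W" for L
  proof (induction L)
    case Nil then show ?case by (simp add: fsubspace_zero[OF fsubspace_tspace])
  next
    case (Cons ab L)
    then have "tens (fst ab) (snd ab) \<in> tspace V W" by (auto intro: tens_in_tspace)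
    then show ?case using Cons fsubspace_add[OF fsubspace_tspace]
      by (auto simp: case_prod_unfold)
  qed
  then show ?thesis using assms by (simp add: trep_def)
qed

text \<open>Scalars can be absorbed into the left factors, so plain lists of pairs represent all
  linear combinations of pure tensors.\<close>

lemma trep_exists:
  assumes "u \<in> tspace V W" "fsubspace V" shows "\<exists>L. trep V W u L"
proof -
  let ?E = "{u. \<exists>L. trep V W u L}"
  have sc: "trep V W (\<lambda>p. c * u p) (map (\<lambda>(a, b). (\<lambda>x. c * a x, b)) L)" if "trep V W u L" for c u L
    using that fsubspace_scale[OF assms(2)] unfolding trep_def
    by (auto simp: tens_def comp_def case_prod_unfold fun_eq_iff sum_list_const_mult mult.assoc)
  have ad: "trep V W (\<lambda>p. u p + v p) (L @ M)" if "trep V W u L" "trep V W v M" for u v L M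
    using that unfolding trep_def by auto
  have "fsubspace ?E" unfolding fsubspace_def
  proof (safe)
    show "\<exists>L. trep V W (\<lambda>_. 0) L" by (auto simp: trep_def intro!: exI[of _ "[]"])
  qed (use sc ad in blast)+
  then have "tspace V W \<subseteq> ?E" unfolding tspace_def
    by (rule lspan_minimal) (use trep_tens in blast)
  then show ?thesis using assms(1) by blast
qed

text \<open>Tensors are functions on pairs, so a linear map is applied to one tensor factor by
freezing the argument of the other factor.\<close>

lemma trep_zero_map:
  assumes "linear_on V \<phi>" "linear_on W \<psi>" "fsubspace V" "fsubspace W" "set L \<subseteq> V \<times> W"
    and z: "\<And>x y. (\<Sum>(a, b)\<leftarrow>L. a x * b y) = 0"
  shows "(\<Sum>(a, b)\<leftarrow>L. \<phi> a p * \<psi> b q) = 0"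
proof -
  have 1: "(\<Sum>(a, b)\<leftarrow>L. a x * \<psi> b q) = 0" for x
  proof -
    have "(\<lambda>y. \<Sum>ab\<leftarrow>L. fst ab x * snd ab y) = (\<lambda>_. 0)"
      using z by (simp add: case_prod_unfold)
    moreover have "\<psi> (\<lambda>y. \<Sum>ab\<leftarrow>L. fst ab x * snd ab y) = (\<lambda>y. \<Sum>ab\<leftarrow>L. fst ab x * \<psi> (snd ab) y)"
      by (rule conjunct2[OF linear_on_sum_list[OF assms(2,4)]]) (use assms(5) in auto)
    ultimately have "(\<lambda>y. \<Sum>ab\<leftarrow>L. fst ab x * \<psi> (snd ab) y) = (\<lambda>_. 0)"
      using linear_on_zero[OF assms(2,4)] by simp
    from fun_cong[OF this, of q] show ?thesis by (simp add: case_prod_unfold)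
  qed
  have "(\<lambda>x. \<Sum>ab\<leftarrow>L. \<psi> (snd ab) q * fst ab x) = (\<lambda>_. 0)"
    using 1 by (simp add: case_prod_unfold mult.commute)
  moreover have "\<phi> (\<lambda>x. \<Sum>ab\<leftarrow>L. \<psi> (snd ab) q * fst ab x) = (\<lambda>y. \<Sum>ab\<leftarrow>L. \<psi> (snd ab) q * \<phi> (fst ab) y)"
    by (rule conjunct2[OF linear_on_sum_list[OF assms(1,3)]]) (use assms(5) in auto)
  ultimately have "(\<lambda>y. \<Sum>ab\<leftarrow>L. \<psi> (snd ab) q * \<phi> (fst ab) y) = (\<lambda>_. 0)"
    using linear_on_zero[OF assms(1,3)] by simp
  from fun_cong[OF this, of p] show ?thesis
    by (simp add: case_prod_unfold mult.commute)
qed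

text \<open>The difference of two representations represents the zero tensor, to which
  \<open>trep_zero_map\<close> applies. This makes the tensor product of two linear maps well
  defined.\<close>

lemma trep_map_unique:
  assumes "linear_on V \<phi>" "linear_on W \<psi>" "fsubspace V" "fsubspace W" "trep V W u L" "trep V W u M"
  shows "(\<Sum>(a, b)\<leftarrow>L. \<phi> a p * \<psi> b q) = (\<Sum>(a, b)\<leftarrow>M. \<phi> a p * \<psi> b q)"
proof -
  let ?N = "map (\<lambda>(a, b). (\<lambda>x. (-1) * a x, b)) M"
  have "set (L @ ?N) \<subseteq> V \<times> W"
    using assms(5,6) fsubspace_scale[OF assms(3), of _ "-1"] by (auto simp: trep_def)
  moreover have "(\<Sum>(a, b)\<leftarrow>L @ ?N. a x * b y) = 0" for x y
    using trep_eval[OF assms(5), of x y] trep_eval[OF assms(6), of x y]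
      uminus_sum_list_map[of "\<lambda>ab. fst ab x * snd ab y" M]
    by (simp add: comp_def case_prod_unfold)
  ultimately have "(\<Sum>(a, b)\<leftarrow>L @ ?N. \<phi> a p * \<psi> b q) = 0"
    by (rule trep_zero_map[OF assms(1-4)])
  moreover have "(\<Sum>(a, b)\<leftarrow>?N. \<phi> a p * \<psi> b q) = - (\<Sum>(a, b)\<leftarrow>M. \<phi> a p * \<psi> b q)"
  proof -
    have "map (\<lambda>(a, b). \<phi> (\<lambda>x. (-1) * a x) p * \<psi> b q) M = map (\<lambda>(a, b). - (\<phi> a p * \<psi> b q)) M"
      using assms(6) linear_on_scale[OF assms(1), of _ "-1"] by (fastforce simp: trep_def)
    moreover have "(\<Sum>(a, b)\<leftarrow>M. - (\<phi> a p * \<psi> b q)) = - (\<Sum>(a, b)\<leftarrow>M. \<phi> a p * \<psi> b q)"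
      by (simp add: case_prod_unfold uminus_sum_list_map comp_def)
    ultimately show ?thesis by (simp add: comp_def case_prod_unfold del: map_eq_conv)
  qed
  ultimately show ?thesis by simp
qed

text \<open>The tensor product of \<open>\<phi>\<close> and \<open>\<psi>\<close>. The arbitrary
  choice of a representing list is harmless by \<open>trep_map_unique\<close>.\<close>

definition tmap :: "('x \<Rightarrow> real) set \<Rightarrow> ('y \<Rightarrow> real) set \<Rightarrow> (('x \<Rightarrow> real) \<Rightarrow> 'p \<Rightarrow> real)
    \<Rightarrow> (('y \<Rightarrow> real) \<Rightarrow> 'q \<Rightarrow> real) \<Rightarrow> ('x \<times> 'y \<Rightarrow> real) \<Rightarrow> ('p \<times> 'q \<Rightarrow> real)" where
  "tmap V W \<phi> \<psi> u = (\<lambda>(p, q). \<Sum>(a, b)\<leftarrow>(SOME L. trep V W u L). \<phi> a p * \<psi> b q)"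

locale tensor_maps =
  fixes V :: "('x \<Rightarrow> real) set" and W :: "('y \<Rightarrow> real) set"
    and \<phi> :: "('x \<Rightarrow> real) \<Rightarrow> 'p \<Rightarrow> real" and \<psi> :: "('y \<Rightarrow> real) \<Rightarrow> 'q \<Rightarrow> real"
  assumes lin: "linear_on V \<phi>" "linear_on W \<psi>" and sub: "fsubspace V" "fsubspace W"
begin

lemma tmap_trep:
  assumes "trep V W u L"
  shows "tmap V W \<phi> \<psi> u (p, q) = (\<Sum>(a, b)\<leftarrow>L. \<phi> a p * \<psi> b q)"
  unfolding tmap_def
  using trep_map_unique[OF lin sub someI[of "trep V W u", OF assms] assms] by simp

lemma tmap_trep':
  assumes "trep V W u L"
  shows "tmap V W \<phi> \<psi> u = (\<lambda>p. \<Sum>(a, b)\<leftarrow>L. tens (\<phi> a) (\<psi> b) p)"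
  using tmap_trep[OF assms] by (auto simp: fun_eq_iff tens_def case_prod_unfold)

lemma tmap_tens:
  "f \<in> V \<Longrightarrow> g \<in> W \<Longrightarrow> tmap V W \<phi> \<psi> (tens f g) = tens (\<phi> f) (\<psi> g)"
  using tmap_trep'[OF trep_tens] by fastforce

lemma linear_on_tmap: "linear_on (tspace V W) (tmap V W \<phi> \<psi>)"
  unfolding linear_on_def
proof (intro ballI allI ext)
  fix u v c d and pq :: "'p \<times> 'q"
  assume "u \<in> tspace V W" "v \<in> tspace V W"
  then obtain L M where L: "trep V W u L" and M: "trep V W v M"
    using trep_exists[OF _ sub(1)] by metis
  obtain p q where pq: "pq = (p, q)" by fastforce
  let ?s = "\<lambda>c. map (\<lambda>(a, b). (\<lambda>x. c * a x, b))"
  have "trep V W (\<lambda>x. c * u x + d * v x) (?s c L @ ?s d M)"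
    using L M fsubspace_scale[OF sub(1)] unfolding trep_def
    by (auto simp: tens_def comp_def case_prod_unfold fun_eq_iff sum_list_const_mult mult.assoc)
  moreover have "(\<Sum>(a, b)\<leftarrow>?s c L. \<phi> a p * \<psi> b q) = c * (\<Sum>(a, b)\<leftarrow>L. \<phi> a p * \<psi> b q)"
    if "trep V W u L" for c u L
  proof -
    have "map (\<lambda>(a, b). \<phi> (\<lambda>x. c * a x) p * \<psi> b q) L = map (\<lambda>(a, b). c * (\<phi> a p * \<psi> b q)) L"
      using that linear_on_scale[OF lin(1), of _ c] by (fastforce simp: trep_def)
    then show ?thesis
      by (simp add: comp_def case_prod_unfold sum_list_const_mult del: map_eq_conv)
  qed
  ultimately show "tmap V W \<phi> \<psi> (\<lambda>x. c * u x + d * v x) pq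
      = c * tmap V W \<phi> \<psi> u pq + d * tmap V W \<phi> \<psi> v pq"
    using L M by (simp add: pq tmap_trep)
qed

lemma tmap_in_tspace:
  assumes "u \<in> tspace V W" "\<And>a. a \<in> V \<Longrightarrow> \<phi> a \<in> V'" "\<And>b. b \<in> W \<Longrightarrow> \<psi> b \<in> W'"
  shows "tmap V W \<phi> \<psi> u \<in> tspace V' W'"
proof -
  obtain L where L: "trep V W u L" using trep_exists[OF assms(1) sub(1)] ..
  then have "trep V' W' (tmap V W \<phi> \<psi> u) (map (\<lambda>(a, b). (\<phi> a, \<psi> b)) L)"
    using assms(2,3) tmap_trep'[OF L] unfolding trep_def
    by (auto simp: comp_def case_prod_unfold)
  then show ?thesis by (rule trep_in_tspace)
qed

end

section \<open>Finitely supported functions\<close>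

definition fsupp :: "'b set \<Rightarrow> ('b \<Rightarrow> real) set" where
  "fsupp X = {f. finite {P. f P \<noteq> 0} \<and> (\<forall>P. f P \<noteq> 0 \<longrightarrow> P \<in> X)}"

text \<open>The linear extension of \<open>k\<close> from basis elements to formal combinations,
  evaluated at \<open>f\<close>. Maps out of spaces of formal combinations are brought to this form
  so that their linearity comes from \<open>linear_on_fsum\<close>.\<close>

definition fsum :: "('b \<Rightarrow> real) \<Rightarrow> ('b \<Rightarrow> real) \<Rightarrow> real" where
  "fsum f k = (\<Sum>P\<in>{P. f P \<noteq> 0}. f P * k P)"

lemma fsum_superset:
  assumes "finite A" "{P. f P \<noteq> 0} \<subseteq> A" shows "fsum f k = (\<Sum>P\<in>A. f P * k P)"
  unfolding fsum_def using assms by (intro sum.mono_neutral_left) auto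

lemma fsum_basisv [simp]: "fsum (basisv P) k = k P"
proof -
  have "{Q. basisv P Q \<noteq> 0} = {P}" by (auto simp: basisv_def)
  then show ?thesis by (simp add: fsum_def basisv_def)
qed

lemma fsum_zero [simp]: "fsum f (\<lambda>_. 0) = 0"
  by (simp add: fsum_def)

lemma fsum_cong: "(\<And>P. f P \<noteq> 0 \<Longrightarrow> k P = l P) \<Longrightarrow> fsum f k = fsum f l"
  unfolding fsum_def by (rule sum.cong) auto

lemma fsum_lincomb:
  assumes "finite {P. f P \<noteq> 0}" "finite {P. g P \<noteq> 0}"
  shows "fsum (\<lambda>P. c * f P + d * g P) k = c * fsum f k + d * fsum g k"
proof -
  let ?A = "{P. f P \<noteq> 0} \<union> {P. g P \<noteq> 0}"
  have A: "finite ?A" using assms by simp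
  have "fsum (\<lambda>P. c * f P + d * g P) k = (\<Sum>P\<in>?A. (c * f P + d * g P) * k P)"
    by (rule fsum_superset[OF A]) auto
  also have "\<dots> = c * (\<Sum>P\<in>?A. f P * k P) + d * (\<Sum>P\<in>?A. g P * k P)"
    by (simp add: algebra_simps sum.distrib sum_distrib_left)
  finally show ?thesis
    using fsum_superset[OF A, of f k] fsum_superset[OF A, of g k] by auto
qed

lemma fsum_lincomb_right: "fsum f (\<lambda>P. c * k P + d * l P) = c * fsum f k + d * fsum f l"
  by (simp add: fsum_def sum.distrib sum_distrib_left algebra_simps)

lemma linear_on_fsum: "linear_on (fsupp X) (\<lambda>f y. fsum f (\<lambda>P. k P y))"
  unfolding linear_on_def fsupp_def by (auto simp: fsum_lincomb)

lemma basisv_in_fsupp: "P \<in> X \<Longrightarrow> basisv P \<in> fsupp X"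
  by (auto simp: fsupp_def basisv_def)

lemma fsubspace_fsupp: "fsubspace (fsupp X)"
  unfolding fsubspace_def fsupp_def
proof (safe)
  fix f g :: "'a \<Rightarrow> real"
  assume "finite {P. f P \<noteq> 0}" "finite {P. g P \<noteq> 0}"
  then show "finite {P. f P + g P \<noteq> 0}"
    by (auto intro: finite_subset[of _ "{P. f P \<noteq> 0} \<union> {P. g P \<noteq> 0}"])
next
  fix c and f :: "'a \<Rightarrow> real"
  assume "finite {P. f P \<noteq> 0}"
  then show "finite {P. c * f P \<noteq> 0}"
    by (auto intro: finite_subset[of _ "{P. f P \<noteq> 0}"])
qed (auto, force)

lemma fsupp_eq_lspan: "fsupp X = lspan (basisv ` X)"
proof
  show "lspan (basisv ` X) \<subseteq> fsupp X"
    by (rule lspan_minimal[OF fsubspace_fsupp]) (auto intro: basisv_in_fsupp)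
  show "fsupp X \<subseteq> lspan (basisv ` X)"
  proof
    fix f assume f: "f \<in> fsupp X"
    have "f x = (\<Sum>P\<in>{P. f P \<noteq> 0}. f P * basisv P x)" for x
      using f by (auto simp: fsupp_def basisv_def if_distrib sum.delta cong: if_cong)
    then have "f = (\<lambda>x. \<Sum>P\<in>{P. f P \<noteq> 0}. f P * basisv P x)" by blast
    moreover have "(\<lambda>x. \<Sum>P\<in>{P. f P \<noteq> 0}. f P * basisv P x) \<in> lspan (basisv ` X)"
      by (rule fsubspace_sum[OF fsubspace_lspan]) (use f in \<open>auto simp: fsupp_def intro: lspan_superset\<close>)
    ultimately show "f \<in> lspan (basisv ` X)" by simp
  qed
qed

lemma gp_comp_eq: "gp_comp I = fsupp {P. egp I P}"
  by (simp add: gp_comp_def fsupp_def)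

lemma w_comp_eq: "w_comp I = fsupp {F. wosp I F}"
  by (simp add: w_comp_def fsupp_def)

text \<open>Brings the sums over fibres by which the structure maps are defined into the form
  \<open>fsum\<close>.\<close>

lemma sum_indicator_eq_fsum:
  assumes "finite {P. f P \<noteq> 0}"
  shows "(\<Sum>P\<in>{P. f P \<noteq> 0 \<and> R P}. f P) = fsum f (\<lambda>P. if R P then 1 else 0)"
proof -
  have "{P. f P \<noteq> 0 \<and> R P} = {P \<in> {P. f P \<noteq> 0}. R P}" by blast
  then show ?thesis
    using assms sum.inter_filter[of "{P. f P \<noteq> 0}" f R]
    unfolding fsum_def by (simp add: if_distrib cong: if_cong)
qed

lemma sum_indicator2_eq_fsum:
  assumes "finite {P. f P \<noteq> 0}" "finite {P. g P \<noteq> 0}"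
  shows "(\<Sum>(P, Q)\<in>{(P, Q). f P \<noteq> 0 \<and> g Q \<noteq> 0 \<and> R P Q}. f P * g Q)
     = fsum f (\<lambda>P. fsum g (\<lambda>Q. if R P Q then 1 else 0))"
proof -
  let ?A = "{P. f P \<noteq> 0}" and ?B = "{P. g P \<noteq> 0}"
  have "{(P, Q). f P \<noteq> 0 \<and> g Q \<noteq> 0 \<and> R P Q} = {pq \<in> ?A \<times> ?B. R (fst pq) (snd pq)}" by auto
  then have "(\<Sum>(P, Q)\<in>{(P, Q). f P \<noteq> 0 \<and> g Q \<noteq> 0 \<and> R P Q}. f P * g Q)
      = (\<Sum>(P, Q)\<in>?A \<times> ?B. if R P Q then f P * g Q else 0)"
    using assms by (simp add: sum.inter_filter case_prod_unfold)
  also have "\<dots> = (\<Sum>P\<in>?A. \<Sum>Q\<in>?B. if R P Q then f P * g Q else 0)"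
    by (rule sum.cartesian_product[symmetric])
  also have "\<dots> = fsum f (\<lambda>P. fsum g (\<lambda>Q. if R P Q then 1 else 0))"
    unfolding fsum_def
    by (intro sum.cong refl) (simp add: sum_distrib_left if_distrib cong: if_cong)
  finally show ?thesis .
qed

section \<open>Extended generalized permutahedra as base polyhedra\<close>

text \<open>A submodular function with values in the extended reals is represented by the lattice
\<^term>\<open>D\<close> of sets where it is finite and its real values on \<^term>\<open>D\<close>.\<close>

definition submod :: "'a set \<Rightarrow> 'a set set \<Rightarrow> ('a set \<Rightarrow> real) \<Rightarrow> bool" where
  "submod I D z \<longleftrightarrow> finite I \<and> D \<subseteq> Pow I \<and> {} \<in> D \<and> I \<in> D \<and> z {} = 0 \<and>
     (\<forall>A\<in>D. \<forall>B\<in>D. A \<union> B \<in> D \<and> A \<inter> B \<in> D \<and> z (A \<union> B) + z (A \<inter> B) \<le> z A + z B)"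

definition bpoly :: "'a set \<Rightarrow> 'a set set \<Rightarrow> ('a set \<Rightarrow> real) \<Rightarrow> ('a \<Rightarrow> real) set" where
  "bpoly I D z = {x \<in> RI I. sum x I = z I \<and> (\<forall>A\<in>D. sum x A \<le> z A)}"

lemma submodD:
  assumes "submod I D z"
  shows "finite I" "D \<subseteq> Pow I" "{} \<in> D" "I \<in> D" "z {} = 0" "finite D"
    and "\<And>A. A \<in> D \<Longrightarrow> A \<subseteq> I"
    and "\<And>A B. A \<in> D \<Longrightarrow> B \<in> D \<Longrightarrow> A \<union> B \<in> D"
    and "\<And>A B. A \<in> D \<Longrightarrow> B \<in> D \<Longrightarrow> A \<inter> B \<in> D"
    and "\<And>A B. A \<in> D \<Longrightarrow> B \<in> D \<Longrightarrow> z (A \<union> B) + z (A \<inter> B) \<le> z A + z B"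
  using assms unfolding submod_def by (auto intro: finite_subset[of D "Pow I"])

text \<open>The finite values form a lattice because the submodular inequality has a finite right
  side and no value is \<open>-\<infinity>\<close>. The only defect is at the empty set, where
  \<open>z\<close> may be positive or infinite. Since \<open>P\<close> is nonempty,
  \<open>z {} \<ge> 0\<close>, so resetting it to 0 changes neither the polyhedron nor
  submodularity.\<close>

lemma egp_imp_bpoly:
  assumes "egp I P" shows "\<exists>D z. submod I D z \<and> P = bpoly I D z"
proof -
  obtain z :: "'a set \<Rightarrow> ereal" where fin: "finite I" and ne: "P \<noteq> {}"
    and zI: "z I \<noteq> \<infinity>" and zm': "\<forall>A\<subseteq>I. z A \<noteq> -\<infinity>"
    and sm': "\<forall>A B. A \<subseteq> I \<and> B \<subseteq> I \<and> z A \<noteq> \<infinity> \<and> z B \<noteq> \<infinity> \<longrightarrow> z (A \<union> B) + z (A \<inter> B) \<le> z A + z B"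
    and P: "P = {x \<in> RI I. ereal (sum x I) = z I \<and> (\<forall>A\<subseteq>I. ereal (sum x A) \<le> z A)}"
    using assms unfolding egp_def by blast
  have zm: "z A \<noteq> -\<infinity>" if "A \<subseteq> I" for A using zm' that by blast
  have sm: "z (A \<union> B) + z (A \<inter> B) \<le> z A + z B"
    if "A \<subseteq> I" "B \<subseteq> I" "z A \<noteq> \<infinity>" "z B \<noteq> \<infinity>" for A B using sm' that by blast
  let ?F = "{A. A \<subseteq> I \<and> z A \<noteq> \<infinity>}"
  define D where "D = insert {} ?F"
  define r where "r A = (if A = {} then 0 else real_of_ereal (z A))" for A
  obtain x0 where "x0 \<in> P" using ne by blast
  then have z0: "0 \<le> z {}" using P by (force simp: zero_ereal_def)
  have r: "ereal (r A) = z A" if "A \<in> ?F" "A \<noteq> {}" for A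
    using that zm[of A] by (auto simp: r_def ereal_real)
  have r0: "ereal (r A) \<le> z A" if "A \<in> ?F" for A
    using that z0 r[OF that] by (cases "A = {}") (auto simp: r_def zero_ereal_def)
  have smF: "A \<union> B \<in> ?F \<and> A \<inter> B \<in> ?F" if "A \<in> ?F" "B \<in> ?F" for A B
  proof -
    have "z (A \<union> B) + z (A \<inter> B) \<le> z A + z B" "z (A \<union> B) \<noteq> -\<infinity>" "z (A \<inter> B) \<noteq> -\<infinity>"
      using that by (auto intro!: sm zm)
    moreover have "z A + z B \<noteq> \<infinity>" using that by auto
    ultimately have "z (A \<union> B) \<noteq> \<infinity>" "z (A \<inter> B) \<noteq> \<infinity>" by auto
    then show ?thesis using that by auto
  qed
  have smr: "r (A \<union> B) + r (A \<inter> B) \<le> r A + r B" if "A \<in> ?F" "B \<in> ?F" "A \<noteq> {}" "B \<noteq> {}" for A B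
  proof -
    have "ereal (r (A \<union> B) + r (A \<inter> B)) = ereal (r (A \<union> B)) + ereal (r (A \<inter> B))" by simp
    also have "\<dots> \<le> z (A \<union> B) + z (A \<inter> B)"
      using smF[OF that(1,2)] by (intro add_mono r0) auto
    also have "\<dots> \<le> z A + z B" using that by (intro sm) auto
    also have "\<dots> = ereal (r A + r B)" using r that by (metis plus_ereal.simps(1))
    finally show ?thesis by simp
  qed
  have "submod I D r"
    unfolding submod_def
  proof (intro conjI ballI)
    fix A B assume "A \<in> D" "B \<in> D"
    then show "A \<union> B \<in> D" "A \<inter> B \<in> D" using smF[of A B] by (auto simp: D_def)
    show "r (A \<union> B) + r (A \<inter> B) \<le> r A + r B"
    proof (cases "A = {} \<or> B = {}")
      case True then show ?thesis by (auto simp: r_def)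
    next
      case False then show ?thesis using smr \<open>A \<in> D\<close> \<open>B \<in> D\<close> by (auto simp: D_def)
    qed
  qed (use fin zI in \<open>auto simp: D_def r_def\<close>)
  moreover have "P = bpoly I D r"
  proof (rule set_eqI)
    fix x :: "'a \<Rightarrow> real"
    have I: "ereal (sum x I) = z I \<longleftrightarrow> sum x I = r I"
    proof (cases "I = {}")
      case True
      have "z {} = 0" using \<open>x0 \<in> P\<close> P True by (auto simp: zero_ereal_def)
      then show ?thesis using True by (simp add: r_def zero_ereal_def)
    next
      case False
      then have "z I = ereal (r I)" using r[of I] zI by simp
      then show ?thesis by simp
    qed
    have "(\<forall>A\<subseteq>I. ereal (sum x A) \<le> z A) \<longleftrightarrow> (\<forall>A\<in>D. sum x A \<le> r A)"
    proof
      assume h: "\<forall>A\<subseteq>I. ereal (sum x A) \<le> z A"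
      show "\<forall>A\<in>D. sum x A \<le> r A"
      proof
        fix A assume "A \<in> D"
        show "sum x A \<le> r A"
        proof (cases "A = {}")
          case False
          then have "ereal (sum x A) \<le> ereal (r A)" using h \<open>A \<in> D\<close> r[of A] by (auto simp: D_def)
          then show ?thesis by simp
        qed (simp add: r_def)
      qed
    next
      assume h: "\<forall>A\<in>D. sum x A \<le> r A"
      show "\<forall>A\<subseteq>I. ereal (sum x A) \<le> z A"
      proof (intro allI impI)
        fix A assume "A \<subseteq> I"
        show "ereal (sum x A) \<le> z A"
        proof (cases "z A = \<infinity>")
          case False
          then have "ereal (sum x A) \<le> ereal (r A)" "ereal (r A) \<le> z A"
            using h \<open>A \<subseteq> I\<close> r0[of A] by (auto simp: D_def)
          then show ?thesis by (rule order_trans)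
        qed simp
      qed
    qed
    then show "x \<in> P \<longleftrightarrow> x \<in> bpoly I D r"
      using I by (simp add: P bpoly_def)
  qed
  ultimately show ?thesis by blast
qed

text \<open>Edmonds' greedy algorithm: each new coordinate is the increase of \<open>z\<close> along
  the list. For a set \<open>A\<close> containing the new element \<open>i\<close>, submodularity at
  \<open>A\<close> and the earlier prefix bounds this increase by \<open>z A - z (A - {i})\<close>,
  which reduces the constraint at \<open>A\<close> to the one at \<open>A - {i}\<close>.\<close>

lemma greedy_point:
  fixes z :: "'a set \<Rightarrow> real"
  assumes "distinct xs" "z {} = 0"
    and "\<And>A B. A \<subseteq> set xs \<Longrightarrow> B \<subseteq> set xs \<Longrightarrow> z (A \<union> B) + z (A \<inter> B) \<le> z A + z B"
  shows "\<exists>x. x \<in> RI (set xs) \<and> (\<forall>A\<subseteq>set xs. sum x A \<le> z A) \<and>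
            (\<forall>j. sum x (set (take j xs)) = z (set (take j xs)))"
  using assms
proof (induction xs rule: rev_induct)
  case Nil
  then show ?case by (auto intro!: exI[of _ "\<lambda>_. 0"] simp: RI_def)
next
  case (snoc i xs)
  let ?S = "set xs"
  obtain x where x: "x \<in> RI ?S" "\<And>A. A \<subseteq> ?S \<Longrightarrow> sum x A \<le> z A"
    "\<And>j. sum x (set (take j xs)) = z (set (take j xs))"
  proof -
    have "\<exists>x. x \<in> RI ?S \<and> (\<forall>A\<subseteq>?S. sum x A \<le> z A) \<and> (\<forall>j. sum x (set (take j xs)) = z (set (take j xs)))"
    proof (rule snoc.IH)
      fix A B assume "A \<subseteq> ?S" "B \<subseteq> ?S"
      then show "z (A \<union> B) + z (A \<inter> B) \<le> z A + z B" by (intro snoc.prems(3)) auto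
    qed (use snoc.prems in auto)
    then show thesis using that by blast
  qed
  define y where "y = x(i := z (insert i ?S) - z ?S)"
  have i: "i \<notin> ?S" using snoc.prems by simp
  have yx: "sum y A = sum x A" if "i \<notin> A" for A
    by (rule sum.cong) (use that in \<open>auto simp: y_def\<close>)
  have xS: "sum x ?S = z ?S" using x(3)[of "length xs"] by simp
  have "sum y A \<le> z A" if "A \<subseteq> insert i ?S" for A
  proof (cases "i \<in> A")
    case False
    then show ?thesis using that x(2)[of A] yx[OF False] by auto
  next
    case True
    then have A: "A \<union> ?S = insert i ?S" "A \<inter> ?S = A - {i}" using that i by auto
    have "finite A" using that by (rule finite_subset) simp
    then have "sum y A = y i + sum y (A - {i})" using True by (simp add: sum.remove)
    also have "\<dots> \<le> z (insert i ?S) - z ?S + z (A - {i})"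
      using x(2)[of "A - {i}"] yx[of "A - {i}"] that by (auto simp: y_def)
    also have "\<dots> \<le> z A"
      using snoc.prems(3)[of A ?S] that A by (auto simp: subset_insertI)
    finally show ?thesis .
  qed
  moreover have "sum y (set (take j (xs @ [i]))) = z (set (take j (xs @ [i])))" for j
  proof (cases "j \<le> length xs")
    case True
    then have "i \<notin> set (take j xs)" using i in_set_takeD by fastforce
    then show ?thesis using True yx x(3) by simp
  next
    case False
    have "sum y (insert i ?S) = y i + sum y ?S" using i by simp
    then show ?thesis using False xS yx[OF i] by (simp add: y_def)
  qed
  moreover have "y \<in> RI (insert i ?S)" using x(1) by (auto simp: RI_def y_def)
  ultimately show ?case by (intro exI[of _ y]) simp
qed

text \<open>Adding the constraints \<open>x i \<le> N\<close> replaces the function by its convolution with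
\<open>A \<mapsto> N * card A\<close>, which is finite on all sets; for large \<open>N\<close> it is unchanged on
\<^term>\<open>D\<close> and large elsewhere.\<close>

lemma truncation:
  assumes sm: "submod I D z"
  shows "\<exists>zN. (\<forall>A\<subseteq>I. \<forall>B\<subseteq>I. zN (A \<union> B) + zN (A \<inter> B) \<le> zN A + zN B) \<and>
    (\<forall>A\<in>D. zN A = z A) \<and> (\<forall>A. A \<subseteq> I \<longrightarrow> A \<notin> D \<longrightarrow> zN A \<ge> (M::real))"
proof -
  note D = submodD[OF sm]
  define C where "C = Max ((\<lambda>A. \<bar>z A\<bar>) ` D)"
  have C: "\<bar>z A\<bar> \<le> C" if "A \<in> D" for A unfolding C_def using that D by auto
  \<comment> \<open>With this choice \<open>N - C\<close> is at least \<open>C\<close> and at least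
    \<open>M\<close>. Hence a set of \<open>D\<close> never gains by being replaced by a proper
    subset, and every set outside \<open>D\<close> gets a value of at least
    \<open>M\<close>.\<close>
  define N where "N = 2 * C + \<bar>M\<bar>"
  have C0: "C \<ge> 0" using C[OF D(3)] D(5) by simp
  have N0: "N \<ge> 0" using C0 by (simp add: N_def)
  define V where "V A = (\<lambda>B. z B + N * real (card (A - B))) ` {B \<in> D. B \<subseteq> A}" for A
  have fV: "finite (V A)" "V A \<noteq> {}" for A unfolding V_def using D by auto
  define zN where "zN A = Min (V A)" for A
  have le: "zN A \<le> z B + N * real (card (A - B))" if "B \<in> D" "B \<subseteq> A" for A B
    unfolding zN_def using that fV[of A] by (auto intro!: Min_le simp: V_def)
  have att: "\<exists>B. B \<in> D \<and> B \<subseteq> A \<and> zN A = z B + N * real (card (A - B))" for A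
    using Min_in[OF fV, of A] unfolding zN_def V_def by blast
  have big: "z B + N * real (card (A - B)) \<ge> N - C" if "B \<in> D" "B \<subset> A" "A \<subseteq> I" for A B
  proof -
    have "finite (A - B)" using that(3) D(1) finite_subset by blast
    moreover have "A - B \<noteq> {}" using that by blast
    ultimately have "card (A - B) \<ge> 1" by (simp add: Suc_leI card_gt_0_iff)
    then have "N * 1 \<le> N * real (card (A - B))" using N0 by (intro mult_left_mono) auto
    then show ?thesis using C[OF that(1)] by linarith
  qed
  have "zN (A \<union> B) + zN (A \<inter> B) \<le> zN A + zN B" if AB: "A \<subseteq> I" "B \<subseteq> I" for A B
  proof -
    obtain A' B' where A': "A' \<in> D" "A' \<subseteq> A" "zN A = z A' + N * real (card (A - A'))"
      and B': "B' \<in> D" "B' \<subseteq> B" "zN B = z B' + N * real (card (B - B'))"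
      using att by metis
    have f: "finite A" "finite B" "finite A'" "finite B'"
      using AB D(1) A'(2) B'(2) finite_subset by (metis order_trans)+
    \<comment> \<open>The penalty term is modular for nested pairs, so the inequality for
      \<open>zN\<close> reduces to the one for \<open>z\<close> at the minimizers \<open>A'\<close>
      and \<open>B'\<close>.\<close>
    have "real (card (A \<union> B - (A' \<union> B'))) + real (card (A \<inter> B - A' \<inter> B'))
        = real (card (A - A')) + real (card (B - B'))"
    proof -
      have c: "real (card (X - Y)) = real (card X) - real (card Y)" if "finite X" "Y \<subseteq> X" for X Y :: "'a set"
        using that by (simp add: card_Diff_subset card_mono finite_subset of_nat_diff)
      have m: "real (card (X \<union> Y)) + real (card (X \<inter> Y)) = real (card X) + real (card Y)"
        if "finite X" "finite Y" for X Y :: "'a set"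
        using card_Un_Int[OF that] by linarith
      have "A' \<union> B' \<subseteq> A \<union> B" "A' \<inter> B' \<subseteq> A \<inter> B" using A'(2) B'(2) by blast+
      then have "real (card (A \<union> B - (A' \<union> B'))) = real (card (A \<union> B)) - real (card (A' \<union> B'))"
        "real (card (A \<inter> B - A' \<inter> B')) = real (card (A \<inter> B)) - real (card (A' \<inter> B'))"
        using f by (auto intro!: c)
      moreover have "real (card (A - A')) = real (card A) - real (card A')"
        "real (card (B - B')) = real (card B) - real (card B')"
        using f A'(2) B'(2) by (auto intro!: c)
      ultimately show ?thesis using m[OF f(1,2)] m[OF f(3,4)] by linarith
    qed
    then have e: "N * real (card (A \<union> B - (A' \<union> B'))) + N * real (card (A \<inter> B - A' \<inter> B'))
        = N * real (card (A - A')) + N * real (card (B - B'))"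
      by (metis distrib_left)
    have "zN (A \<union> B) \<le> z (A' \<union> B') + N * real (card (A \<union> B - (A' \<union> B')))"
      "zN (A \<inter> B) \<le> z (A' \<inter> B') + N * real (card (A \<inter> B - A' \<inter> B'))"
      using A' B' D by (auto intro!: le)
    then show ?thesis using e A'(3) B'(3) D(10)[OF A'(1) B'(1)] by linarith
  qed
  moreover have "zN A = z A" if "A \<in> D" for A
  proof -
    have "zN A \<le> z A" using le[of A A] that by simp
    moreover obtain B where B: "B \<in> D" "B \<subseteq> A" "zN A = z B + N * real (card (A - B))"
      using att by blast
    have "z A \<le> zN A"
    proof (cases "B = A")
      case False
      then have "zN A \<ge> N - C" using big[of B A] B that D(7) by auto
      then show ?thesis using C[OF that] by (simp add: N_def)
    qed (use B in simp)
    ultimately show ?thesis by simp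
  qed
  moreover have "zN A \<ge> M" if "A \<subseteq> I" "A \<notin> D" for A
  proof -
    obtain B where B: "B \<in> D" "B \<subseteq> A" "zN A = z B + N * real (card (A - B))"
      using att by blast
    then have "zN A \<ge> N - C" using big[of B A] that by auto
    then show ?thesis using C0 by (simp add: N_def)
  qed
  ultimately show ?thesis by blast
qed

text \<open>The greedy point of the truncated function. One point serves all prefixes of
  \<open>xs\<close> at once; this is what makes conditions along a chain independent of each
  other.\<close>

lemma bpoly_chain_point:
  assumes sm: "submod I D z" and xs: "distinct xs" "set xs = I"
  shows "\<exists>x\<in>bpoly I D z. \<forall>j. let U = set (take j xs) in
           (U \<in> D \<longrightarrow> sum x U = z U) \<and> (U \<notin> D \<longrightarrow> sum x U \<ge> (M::real))"
proof -
  note D = submodD[OF sm]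
  obtain zN where z1: "\<And>A B. A \<subseteq> I \<Longrightarrow> B \<subseteq> I \<Longrightarrow> zN (A \<union> B) + zN (A \<inter> B) \<le> zN A + zN B"
    and z2: "\<And>A. A \<in> D \<Longrightarrow> zN A = z A" and z3: "\<And>A. A \<subseteq> I \<Longrightarrow> A \<notin> D \<Longrightarrow> zN A \<ge> M"
    using truncation[OF sm, of M] by (elim exE conjE) blast
  obtain x where x: "x \<in> RI I" "\<And>A. A \<subseteq> I \<Longrightarrow> sum x A \<le> zN A"
    "\<And>j. sum x (set (take j xs)) = zN (set (take j xs))"
    using greedy_point[OF xs(1), of zN] z1 z2 D(3,5) xs(2) by metis
  have "x \<in> bpoly I D z"
  proof -
    have "sum x I = z I" using x(3)[of "length xs"] xs(2) z2[OF D(4)] by simp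
    moreover have "sum x A \<le> z A" if "A \<in> D" for A using x(2)[OF D(7)[OF that]] z2[OF that] by simp
    ultimately show ?thesis using x(1) by (simp add: bpoly_def)
  qed
  moreover have "set (take j xs) \<subseteq> I" for j using xs(2) set_take_subset by metis
  ultimately show ?thesis
    using x(3) z2 z3 by (intro bexI[of _ x]) (auto simp: Let_def)
qed

section \<open>Recovering the submodular function from its polyhedron\<close>

lemma finite_distinct_list2:
  assumes "finite I" "A \<subseteq> B" "B \<subseteq> I"
  shows "\<exists>xs. distinct xs \<and> set xs = I \<and> (\<exists>j. set (take j xs) = A) \<and> (\<exists>j. set (take j xs) = B)"
proof -
  have "finite B" using assms(1,3) by (rule rev_finite_subset)
  then have "finite A" "finite (B - A)" "finite (I - B)" using assms by (auto intro: finite_subset)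
  then obtain a b c where "set a = A" "distinct a" "set b = B - A" "distinct b" "set c = I - B" "distinct c"
    by (metis finite_distinct_list)
  moreover have "set (take (length a) (a @ b @ c)) = set a"
    "set (take (length a + length b) (a @ b @ c)) = set a \<union> set b" by auto
  ultimately have "distinct (a @ b @ c)" "set (a @ b @ c) = I" "set (take (length a) (a @ b @ c)) = A"
    "set (take (length a + length b) (a @ b @ c)) = B" using assms by auto
  then show ?thesis by blast
qed

text \<open>The support function; a junk value unless \<^term>\<open>ebounded A P\<close>.\<close>

definition hv :: "('a \<Rightarrow> real) set \<Rightarrow> 'a set \<Rightarrow> real" where
  "hv P A = (SUP x\<in>P. sum x A)"

lemma bpoly_point2:
  assumes sm: "submod I D z" and "A \<subseteq> B" "B \<subseteq> I"
  shows "\<exists>x\<in>bpoly I D z. (A \<in> D \<longrightarrow> sum x A = z A) \<and> (A \<notin> D \<longrightarrow> sum x A \<ge> (M::real)) \<and>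
           (B \<in> D \<longrightarrow> sum x B = z B)"
proof -
  obtain xs where xs: "distinct xs" "set xs = I" and ex: "\<exists>j. set (take j xs) = A" "\<exists>j. set (take j xs) = B"
    using finite_distinct_list2[OF submodD(1)[OF sm] assms(2,3)] by blast
  obtain x where "x \<in> bpoly I D z" and x: "\<And>j. let U = set (take j xs) in
           (U \<in> D \<longrightarrow> sum x U = z U) \<and> (U \<notin> D \<longrightarrow> sum x U \<ge> M)"
    using bpoly_chain_point[OF sm xs, of M] by blast
  then show ?thesis using ex by (metis (lifting))
qed

lemma bpoly_nonempty: "submod I D z \<Longrightarrow> bpoly I D z \<noteq> {}"
  using bpoly_point2[of I D z I I] by blast

text \<open>Outside \<open>D\<close> the point of \<open>bpoly_point2\<close> can be taken with an
  arbitrarily large sum. Together with \<open>hv_bpoly\<close> this recovers \<open>D\<close> and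
  \<open>z\<close> from the set of points.\<close>

lemma ebounded_bpoly:
  assumes sm: "submod I D z" and "A \<subseteq> I"
  shows "ebounded A (bpoly I D z) \<longleftrightarrow> A \<in> D"
proof
  assume "A \<in> D"
  then show "ebounded A (bpoly I D z)"
    unfolding ebounded_def bdd_above_def bpoly_def by auto
next
  assume "ebounded A (bpoly I D z)"
  then obtain M where M: "\<And>x. x \<in> bpoly I D z \<Longrightarrow> sum x A \<le> M"
    unfolding ebounded_def bdd_above_def by auto
  show "A \<in> D"
  proof (rule ccontr)
    assume "A \<notin> D"
    then obtain x where "x \<in> bpoly I D z" "sum x A \<ge> M + 1"
      using bpoly_point2[OF sm order_refl assms(2), of "M + 1"] by blast
    then show False using M[of x] by simp
  qed
qed

lemma hv_bpoly:
  assumes sm: "submod I D z" and "A \<in> D"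
  shows "hv (bpoly I D z) A = z A"
proof -
  obtain x where x: "x \<in> bpoly I D z" "sum x A = z A"
    using bpoly_point2[OF sm order_refl, of A] assms submodD(7)[OF sm] by blast
  show ?thesis unfolding hv_def
  proof (rule cSup_eq_maximum)
    show "z A \<in> (\<lambda>x. sum x A) ` bpoly I D z" using x by force
  qed (use assms(2) in \<open>auto simp: bpoly_def\<close>)
qed

lemma bpoly_cong:
  assumes "\<And>A. A \<in> D \<Longrightarrow> z A = z' A" "I \<in> D"
  shows "bpoly I D z = bpoly I D z'"
  using assms unfolding bpoly_def by auto

lemma submod_cong:
  assumes "submod I D z" "\<And>A. A \<in> D \<Longrightarrow> z A = z' A"
  shows "submod I D z'"
  using assms unfolding submod_def by (smt (verit, best))

definition pdom :: "'a set \<Rightarrow> ('a \<Rightarrow> real) set \<Rightarrow> 'a set set" where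
  "pdom I P = {A. A \<subseteq> I \<and> ebounded A P}"

lemma pdom_bpoly: "submod I D z \<Longrightarrow> pdom I (bpoly I D z) = D"
  using ebounded_bpoly[of I D z] submodD(7)[of I D z] unfolding pdom_def by blast

lemma egp_submod:
  assumes "egp I P"
  shows "submod I (pdom I P) (hv P)" "P = bpoly I (pdom I P) (hv P)"
proof -
  obtain D z where D: "submod I D z" "P = bpoly I D z" using egp_imp_bpoly[OF assms] by blast
  have d: "pdom I P = D" using D pdom_bpoly by blast
  have h: "z A = hv P A" if "A \<in> D" for A using that D hv_bpoly by metis
  show "submod I (pdom I P) (hv P)" unfolding d by (rule submod_cong[OF D(1) h])
  show "P = bpoly I (pdom I P) (hv P)"
  proof -
    have "bpoly I D z = bpoly I D (hv P)" by (rule bpoly_cong[OF h submodD(4)[OF D(1)]])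
    then show ?thesis using D(2) d by metis
  qed
qed

lemma egp_bpoly:
  assumes sm: "submod I D z" shows "egp I (bpoly I D z)"
proof -
  note D = submodD[OF sm]
  define r where "r A = (if A \<in> D then ereal (z A) else \<infinity>)" for A
  have "bpoly I D z = {x \<in> RI I. ereal (sum x I) = r I \<and> (\<forall>A\<subseteq>I. ereal (sum x A) \<le> r A)}"
    using D unfolding bpoly_def r_def by auto
  moreover have "r I \<noteq> \<infinity> \<and> (\<forall>A\<subseteq>I. r A \<noteq> -\<infinity>)" using D by (simp add: r_def)
  moreover have "r (A \<union> B) + r (A \<inter> B) \<le> r A + r B" if "r A \<noteq> \<infinity>" "r B \<noteq> \<infinity>" for A B
  proof -
    have AB: "A \<in> D" "B \<in> D" using that by (auto simp: r_def split: if_splits)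
    then have "A \<union> B \<in> D" "A \<inter> B \<in> D" using D by auto
    then show ?thesis using AB D(10)[OF AB] by (simp add: r_def)
  qed
  ultimately show ?thesis
    unfolding egp_def using D(1) bpoly_nonempty[OF sm] by (intro conjI exI[of _ r]) auto
qed

lemma egp_finite: "egp I P \<Longrightarrow> finite I" by (simp add: egp_def)

lemma egp_RI: "egp I P \<Longrightarrow> P \<subseteq> RI I" by (auto simp: egp_def)

text \<open>All later identities between faces of products, of relabelled polyhedra and of faces are
  checked through this criterion, never pointwise.\<close>

lemma egp_eqI:
  assumes "egp I P" "egp I Q"
    and eb: "\<And>A. A \<subseteq> I \<Longrightarrow> ebounded A P \<longleftrightarrow> ebounded A Q"
    and h: "\<And>A. A \<subseteq> I \<Longrightarrow> ebounded A P \<Longrightarrow> ebounded A Q \<Longrightarrow> hv P A = hv Q A"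
  shows "P = Q"
proof -
  have "pdom I P = pdom I Q" using eb unfolding pdom_def by blast
  moreover have "bpoly I (pdom I P) (hv P) = bpoly I (pdom I P) (hv Q)"
    by (rule bpoly_cong) (use h eb submodD(4)[OF egp_submod(1)[OF assms(1)]] in \<open>auto simp: pdom_def\<close>)
  ultimately show ?thesis using egp_submod(2)[OF assms(1)] egp_submod(2)[OF assms(2)] by metis
qed

lemma egp_hv:
  assumes "egp I P"
  shows "ebounded {} P" "ebounded I P" "hv P {} = 0"
    "\<And>x A. x \<in> P \<Longrightarrow> A \<subseteq> I \<Longrightarrow> ebounded A P \<Longrightarrow> sum x A \<le> hv P A"
    "\<And>x. x \<in> P \<Longrightarrow> sum x I = hv P I"
proof -
  note D = submodD[OF egp_submod(1)[OF assms]]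
  show "ebounded {} P" "ebounded I P" "hv P {} = 0" using D(3,4,5) by (auto simp: pdom_def)
  show "\<And>x A. x \<in> P \<Longrightarrow> A \<subseteq> I \<Longrightarrow> ebounded A P \<Longrightarrow> sum x A \<le> hv P A"
    "\<And>x. x \<in> P \<Longrightarrow> sum x I = hv P I"
    using egp_submod(2)[OF assms] unfolding bpoly_def by (auto simp: pdom_def)
qed

lemma egp_memI:
  assumes "egp I P" "x \<in> RI I" "sum x I = hv P I"
    "\<And>A. A \<subseteq> I \<Longrightarrow> ebounded A P \<Longrightarrow> sum x A \<le> hv P A"
  shows "x \<in> P"
  using assms(2-4) by (subst egp_submod(2)[OF assms(1)]) (simp add: bpoly_def pdom_def)

lemma egp_mem_iff:
  assumes "egp I P"
  shows "x \<in> P \<longleftrightarrow> x \<in> RI I \<and> sum x I = hv P I \<and> (\<forall>A. A \<subseteq> I \<longrightarrow> ebounded A P \<longrightarrow> sum x A \<le> hv P A)"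
  using egp_memI[OF assms] egp_hv[OF assms] egp_RI[OF assms] by blast

section \<open>Products, faces and relabellings\<close>

lemma sum_restr: "finite A \<Longrightarrow> sum (restr S x) A = sum x (A \<inter> S)"
  unfolding restr_def by (simp add: sum.inter_restrict)

lemma restr_RI: "restr S x \<in> RI S"
  by (simp add: restr_def RI_def)

lemma restr_id: "x \<in> RI S \<Longrightarrow> restr S x = x"
  by (auto simp: restr_def RI_def fun_eq_iff)

lemma pprod_bpoly:
  assumes sm: "submod S D z" "submod T E y" and disj: "S \<inter> T = {}"
  defines "G \<equiv> {A. A \<subseteq> S \<union> T \<and> A \<inter> S \<in> D \<and> A \<inter> T \<in> E}"
    and "w \<equiv> \<lambda>A. z (A \<inter> S) + y (A \<inter> T)"
  shows "submod (S \<union> T) G w" "pprod S T (bpoly S D z) (bpoly T E y) = bpoly (S \<union> T) G w"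
proof -
  note D = submodD[OF sm(1)] and E = submodD[OF sm(2)]
  have ST: "(S \<union> T) \<inter> S = S" "(S \<union> T) \<inter> T = T" by auto
  show "submod (S \<union> T) G w"
    unfolding submod_def
  proof (intro conjI ballI)
    fix A B assume AB: "A \<in> G" "B \<in> G"
    have dist: "(A \<union> B) \<inter> S = (A \<inter> S) \<union> (B \<inter> S)" "A \<inter> B \<inter> S = (A \<inter> S) \<inter> (B \<inter> S)"
      "(A \<union> B) \<inter> T = (A \<inter> T) \<union> (B \<inter> T)" "A \<inter> B \<inter> T = (A \<inter> T) \<inter> (B \<inter> T)" by auto
    have AB': "A \<subseteq> S \<union> T" "A \<inter> S \<in> D" "A \<inter> T \<in> E" "B \<subseteq> S \<union> T" "B \<inter> S \<in> D" "B \<inter> T \<in> E"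
      using AB by (auto simp: G_def)
    have "(A \<union> B) \<inter> S \<in> D" "A \<inter> B \<inter> S \<in> D" "(A \<union> B) \<inter> T \<in> E" "A \<inter> B \<inter> T \<in> E"
      using D(8,9)[OF AB'(2,5)] E(8,9)[OF AB'(3,6)] dist by metis+
    then show "A \<union> B \<in> G" "A \<inter> B \<in> G"
      using AB' unfolding G_def by blast+
    have "w (A \<union> B) = z ((A \<inter> S) \<union> (B \<inter> S)) + y ((A \<inter> T) \<union> (B \<inter> T))"
      "w (A \<inter> B) = z ((A \<inter> S) \<inter> (B \<inter> S)) + y ((A \<inter> T) \<inter> (B \<inter> T))"
      using dist by (simp_all only: w_def)
    then show "w (A \<union> B) + w (A \<inter> B) \<le> w A + w B"
      unfolding w_def
      using D(10)[of "A \<inter> S" "B \<inter> S"] E(10)[of "A \<inter> T" "B \<inter> T"] AB by (simp add: G_def)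
  qed (use D E in \<open>auto simp: G_def w_def ST\<close>)
  show "pprod S T (bpoly S D z) (bpoly T E y) = bpoly (S \<union> T) G w"
  proof (rule set_eqI)
    fix x :: "'a \<Rightarrow> real"
    have dec: "sum x A = sum x (A \<inter> S) + sum x (A \<inter> T)" if "A \<subseteq> S \<union> T" for A
    proof -
      have "A = (A \<inter> S) \<union> (A \<inter> T)" "(A \<inter> S) \<inter> (A \<inter> T) = {}" using that disj by auto
      then show ?thesis using D(1) E(1) by (metis finite_Int sum.union_disjoint)
    qed
    have DG: "A \<in> G \<and> w A = z A" if "A \<in> D" for A
    proof -
      have "A \<inter> S = A" "A \<inter> T = {}" "A \<subseteq> S \<union> T" using D(7)[OF that] disj by auto
      then show ?thesis using that E by (simp add: G_def w_def)
    qed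
    have EG: "A \<in> G \<and> w A = y A" if "A \<in> E" for A
    proof -
      have "A \<inter> T = A" "A \<inter> S = {}" "A \<subseteq> S \<union> T" using E(7)[OF that] disj by auto
      then show ?thesis using that D by (simp add: G_def w_def)
    qed
    have restr: "sum (restr S x) A = sum x A" if "A \<subseteq> S" for A
      using that D(1) finite_subset[OF that] by (subst sum_restr) (auto simp: Int_absorb2)
    have restrT: "sum (restr T x) A = sum x A" if "A \<subseteq> T" for A
      using that E(1) finite_subset[OF that] by (subst sum_restr) (auto simp: Int_absorb2)
    have "x \<in> pprod S T (bpoly S D z) (bpoly T E y) \<longleftrightarrow> x \<in> RI (S \<union> T) \<and>
        sum x S = z S \<and> (\<forall>A\<in>D. sum x A \<le> z A) \<and> sum x T = y T \<and> (\<forall>A\<in>E. sum x A \<le> y A)"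
      unfolding pprod_def bpoly_def using restr restrT D(7) E(7) by (auto simp: restr_RI)
    also have "\<dots> \<longleftrightarrow> x \<in> bpoly (S \<union> T) G w"
    proof safe
      assume x: "x \<in> RI (S \<union> T)" "sum x S = z S" "\<forall>A\<in>D. sum x A \<le> z A" "sum x T = y T" "\<forall>A\<in>E. sum x A \<le> y A"
      have "sum x A \<le> w A" if "A \<in> G" for A
        using that x dec[of A] by (force simp: G_def w_def intro!: add_mono)
      then show "x \<in> bpoly (S \<union> T) G w"
        using x dec[of "S \<union> T"] unfolding bpoly_def by (simp add: ST w_def)
    next
      assume x: "x \<in> bpoly (S \<union> T) G w"
      then have 1: "x \<in> RI (S \<union> T)" "sum x (S \<union> T) = z S + y T" "\<And>A. A \<in> G \<Longrightarrow> sum x A \<le> w A"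
        by (auto simp: bpoly_def w_def ST)
      show "x \<in> RI (S \<union> T)" by fact
      show 2: "sum x A \<le> z A" if "A \<in> D" for A using 1(3) DG[OF that] by metis
      show 3: "sum x A \<le> y A" if "A \<in> E" for A using 1(3) EG[OF that] by metis
      have "sum x (S \<union> T) = sum x S + sum x T" using dec[of "S \<union> T"] by (simp add: ST)
      \<comment> \<open>Two upper bounds whose sum is the prescribed total must both be
        attained.\<close>
      then show "sum x S = z S" "sum x T = y T" using 2[OF D(4)] 3[OF E(4)] 1(2) by linarith+
    qed
    finally show "x \<in> pprod S T (bpoly S D z) (bpoly T E y) \<longleftrightarrow> x \<in> bpoly (S \<union> T) G w" .
  qed
qed

lemma restr_image_pprod:
  assumes "P \<subseteq> RI S" "Q \<subseteq> RI T" "S \<inter> T = {}" "P \<noteq> {}" "Q \<noteq> {}"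
  shows "restr S ` pprod S T P Q = P" "restr T ` pprod S T P Q = Q"
proof -
  have glue: "(\<lambda>i. a i + b i) \<in> pprod S T P Q \<and> restr S (\<lambda>i. a i + b i) = a \<and> restr T (\<lambda>i. a i + b i) = b"
    if "a \<in> P" "b \<in> Q" for a b
  proof -
    have ab: "a \<in> RI S" "b \<in> RI T" using that assms by auto
    have "restr S (\<lambda>i. a i + b i) = a" "restr T (\<lambda>i. a i + b i) = b"
      using ab assms(3) by (auto simp: restr_def RI_def fun_eq_iff)
    moreover have "(\<lambda>i. a i + b i) \<in> RI (S \<union> T)" using ab by (simp add: RI_def)
    ultimately show ?thesis using that by (simp add: pprod_def)
  qed
  obtain a0 b0 where "a0 \<in> P" "b0 \<in> Q" using assms by blast
  then show "restr S ` pprod S T P Q = P" "restr T ` pprod S T P Q = Q"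
    using glue by (auto simp: pprod_def image_iff) metis+
qed

text \<open>The face is the product of the base polyhedra of the restriction of \<open>z\<close> to
  \<open>S\<close> and of its contraction by \<open>S\<close>. A general constraint at
  \<open>A\<close> follows from those at \<open>A \<inter> S\<close> and
  \<open>A \<union> S\<close>, by submodularity at \<open>A\<close> and \<open>S\<close> and because
  the sum over \<open>S\<close> is exactly \<open>z S\<close> on the face.\<close>

lemma face_bpoly:
  assumes sm: "submod (S \<union> T) D z" and disj: "S \<inter> T = {}" and SD: "S \<in> D"
  defines "D1 \<equiv> {A \<in> D. A \<subseteq> S}" and "E \<equiv> {A. A \<subseteq> T \<and> S \<union> A \<in> D}"
    and "y \<equiv> \<lambda>A. z (S \<union> A) - z S"
  shows "submod S D1 z" "submod T E y"
    "pres S (bpoly (S \<union> T) D z) = bpoly S D1 z" "pcon S T (bpoly (S \<union> T) D z) = bpoly T E y"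
proof -
  note D = submodD[OF sm]
  show s1: "submod S D1 z"
    unfolding submod_def using D SD by (auto simp: D1_def)
  show s2: "submod T E y"
    unfolding submod_def
  proof (intro conjI ballI)
    fix A B assume AB: "A \<in> E" "B \<in> E"
    have "S \<union> (A \<union> B) = (S \<union> A) \<union> (S \<union> B)" "S \<union> (A \<inter> B) = (S \<union> A) \<inter> (S \<union> B)" by auto
    then show "A \<union> B \<in> E" "A \<inter> B \<in> E" "y (A \<union> B) + y (A \<inter> B) \<le> y A + y B"
      using AB D(8-10)[of "S \<union> A" "S \<union> B"] unfolding E_def y_def by auto
  qed (use D SD in \<open>auto simp: E_def y_def\<close>)
  let ?P = "bpoly (S \<union> T) D z"
  have f: "finite S" "finite T" using D(1) by auto
  obtain x0 where x0: "x0 \<in> ?P" "sum x0 S = z S"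
    using bpoly_point2[OF sm order_refl, of S] SD by auto
  have "eface S ?P = {x \<in> ?P. sum x S = z S}"
  proof -
    have "sum x S \<le> z S" if "x \<in> ?P" for x using that SD by (simp add: bpoly_def)
    then show ?thesis unfolding eface_def using x0 by force
  qed
  moreover have "{x \<in> ?P. sum x S = z S} = pprod S T (bpoly S D1 z) (bpoly T E y)"
  proof (rule set_eqI)
    fix x :: "'a \<Rightarrow> real"
    have restr: "sum (restr S x) A = sum x A" if "A \<subseteq> S" for A
      using that f finite_subset[OF that] by (subst sum_restr) (auto simp: Int_absorb2)
    have restrT: "sum (restr T x) A = sum x A" if "A \<subseteq> T" for A
      using that f finite_subset[OF that] by (subst sum_restr) (auto simp: Int_absorb2)
    have SA: "sum x (S \<union> A) = sum x S + sum x A" if "A \<subseteq> T" for A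
      using that f disj finite_subset[OF that] by (intro sum.union_disjoint) auto
    have "x \<in> pprod S T (bpoly S D1 z) (bpoly T E y) \<longleftrightarrow> x \<in> RI (S \<union> T) \<and>
        sum x S = z S \<and> (\<forall>A\<in>D1. sum x A \<le> z A) \<and> sum x T = y T \<and> (\<forall>A\<in>E. sum x A \<le> y A)"
      unfolding pprod_def bpoly_def using restr restrT by (auto simp: restr_RI D1_def E_def)
    also have "\<dots> \<longleftrightarrow> x \<in> ?P \<and> sum x S = z S"
    proof safe
      assume x: "x \<in> RI (S \<union> T)" "sum x S = z S" "\<forall>A\<in>D1. sum x A \<le> z A" "sum x T = y T" "\<forall>A\<in>E. sum x A \<le> y A"
      have "sum x A \<le> z A" if A: "A \<in> D" for A
      proof -
        have AST: "A \<subseteq> S \<union> T" using D(7)[OF A] .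
        have "A = (A \<inter> S) \<union> (A \<inter> T)" "(A \<inter> S) \<inter> (A \<inter> T) = {}" using AST disj by auto
        then have "sum x A = sum x (A \<inter> S) + sum x (A \<inter> T)"
          using f by (metis finite_Int sum.union_disjoint)
        moreover have "sum x (A \<inter> S) \<le> z (A \<inter> S)" using x(3) D(9)[OF A SD] by (simp add: D1_def)
        moreover have "S \<union> (A \<inter> T) = A \<union> S" using AST by auto
        then have "A \<inter> T \<in> E" "y (A \<inter> T) = z (A \<union> S) - z S"
          using D(8)[OF A SD] by (simp_all add: E_def y_def)
        then have "sum x (A \<inter> T) \<le> z (A \<union> S) - z S" using x(5) by metis
        ultimately show ?thesis using D(10)[OF A SD] by simp
      qed
      moreover have "sum x (S \<union> T) = z (S \<union> T)" using SA[of T] x by (simp add: y_def)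
      ultimately show "x \<in> ?P" using x by (simp add: bpoly_def)
    next
      assume x: "x \<in> ?P" and xS: "sum x S = z S"
      then show "x \<in> RI (S \<union> T)" by (simp add: bpoly_def)
      show "sum x A \<le> z A" if "A \<in> D1" for A using x that by (simp add: bpoly_def D1_def)
      show "sum x T = y T" using x xS SA[of T] by (simp add: bpoly_def y_def)
      show "sum x A \<le> y A" if "A \<in> E" for A
      proof -
        have "A \<subseteq> T" "S \<union> A \<in> D" using that by (auto simp: E_def)
        then have "sum x S + sum x A \<le> z (S \<union> A)" using x SA by (auto simp: bpoly_def)
        then show ?thesis using xS by (simp add: y_def)
      qed
    qed
    finally show "x \<in> {x \<in> ?P. sum x S = z S} \<longleftrightarrow> x \<in> pprod S T (bpoly S D1 z) (bpoly T E y)" by simp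
  qed
  ultimately have ef: "eface S ?P = pprod S T (bpoly S D1 z) (bpoly T E y)" by simp
  have sub: "bpoly S D1 z \<subseteq> RI S" "bpoly T E y \<subseteq> RI T" by (auto simp: bpoly_def)
  show "pres S ?P = bpoly S D1 z" "pcon S T ?P = bpoly T E y"
    unfolding pres_def pcon_def ef
    using restr_image_pprod[OF sub disj bpoly_nonempty[OF s1] bpoly_nonempty[OF s2]] by auto
qed

lemma ppush_bpoly:
  assumes sm: "submod I D z" and inj: "inj_on \<sigma> I"
  defines "w \<equiv> \<lambda>A. z ({i \<in> I. \<sigma> i \<in> A})"
  shows "submod (\<sigma> ` I) ((`) \<sigma> ` D) w" "ppush \<sigma> I (bpoly I D z) = bpoly (\<sigma> ` I) ((`) \<sigma> ` D) w"
proof -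
  note D = submodD[OF sm]
  have pre: "{i \<in> I. \<sigma> i \<in> \<sigma> ` A} = A" if "A \<subseteq> I" for A
    using that inj by (auto dest: inj_onD)
  have w: "w (\<sigma> ` A) = z A" if "A \<subseteq> I" for A by (simp add: w_def pre[OF that])
  have im: "\<sigma> ` A \<inter> \<sigma> ` B = \<sigma> ` (A \<inter> B)" if "A \<subseteq> I" "B \<subseteq> I" for A B
    using inj_on_image_Int[OF inj that] by simp
  show "submod (\<sigma> ` I) ((`) \<sigma> ` D) w"
    unfolding submod_def
  proof (intro conjI ballI)
    fix A' B' assume "A' \<in> (`) \<sigma> ` D" "B' \<in> (`) \<sigma> ` D"
    then obtain A B where AB: "A \<in> D" "B \<in> D" "A' = \<sigma> ` A" "B' = \<sigma> ` B" by blast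
    then have sub: "A \<subseteq> I" "B \<subseteq> I" "A \<union> B \<subseteq> I" "A \<inter> B \<subseteq> I" using D(7) by auto
    show "A' \<union> B' \<in> (`) \<sigma> ` D" using AB D(8) by (auto simp: image_Un[symmetric])
    show "A' \<inter> B' \<in> (`) \<sigma> ` D" using AB D(9) sub by (auto simp: im)
    show "w (A' \<union> B') + w (A' \<inter> B') \<le> w A' + w B'"
      using D(10)[OF AB(1,2)] sub by (simp add: AB im w image_Un[symmetric])
  qed (use D w[of "{}"] in auto)
  show "ppush \<sigma> I (bpoly I D z) = bpoly (\<sigma> ` I) ((`) \<sigma> ` D) w"
  proof (rule set_eqI)
    fix y :: "'a \<Rightarrow> real"
    let ?x = "\<lambda>i. if i \<in> I then y (\<sigma> i) else 0"
    have s: "sum ?x A = sum y (\<sigma> ` A)" if "A \<subseteq> I" for A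
    proof -
      have "sum ?x A = sum (y \<circ> \<sigma>) A" by (rule sum.cong) (use that in auto)
      also have "\<dots> = sum y (\<sigma> ` A)" using inj_on_subset[OF inj that] by (simp add: sum.reindex)
      finally show ?thesis .
    qed
    have "?x \<in> RI I" by (simp add: RI_def)
    moreover have "sum y (\<sigma> ` I) = (\<Sum>i\<in>I. y (\<sigma> i))" using inj by (simp add: sum.reindex)
    ultimately show "y \<in> ppush \<sigma> I (bpoly I D z) \<longleftrightarrow> y \<in> bpoly (\<sigma> ` I) ((`) \<sigma> ` D) w"
      unfolding ppush_def bpoly_def using s w D(7) by auto
  qed
qed

section \<open>Boundedness and support functions of products, faces and relabellings\<close>

lemma
  assumes P: "egp S P" and Q: "egp T Q" and disj: "S \<inter> T = {}"
  shows egp_pprod: "egp (S \<union> T) (pprod S T P Q)"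
    and ebounded_pprod: "\<And>A. A \<subseteq> S \<union> T \<Longrightarrow> ebounded A (pprod S T P Q) \<longleftrightarrow> ebounded (A \<inter> S) P \<and> ebounded (A \<inter> T) Q"
    and hv_pprod: "\<And>A. A \<subseteq> S \<union> T \<Longrightarrow> ebounded (A \<inter> S) P \<Longrightarrow> ebounded (A \<inter> T) Q \<Longrightarrow>
          hv (pprod S T P Q) A = hv P (A \<inter> S) + hv Q (A \<inter> T)"
proof -
  note b = pprod_bpoly[OF egp_submod(1)[OF P] egp_submod(1)[OF Q] disj,
    folded egp_submod(2)[OF P] egp_submod(2)[OF Q]]
  show "egp (S \<union> T) (pprod S T P Q)" unfolding b(2) by (rule egp_bpoly[OF b(1)])
  show "ebounded A (pprod S T P Q) \<longleftrightarrow> ebounded (A \<inter> S) P \<and> ebounded (A \<inter> T) Q" if "A \<subseteq> S \<union> T" for A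
    unfolding b(2) ebounded_bpoly[OF b(1) that] using that by (simp add: pdom_def)
  show "hv (pprod S T P Q) A = hv P (A \<inter> S) + hv Q (A \<inter> T)"
    if "A \<subseteq> S \<union> T" "ebounded (A \<inter> S) P" "ebounded (A \<inter> T) Q" for A
    unfolding b(2) by (subst hv_bpoly[OF b(1)]) (use that in \<open>auto simp: pdom_def\<close>)
qed

lemma
  assumes P: "egp (S \<union> T) P" and disj: "S \<inter> T = {}" and S: "ebounded S P"
  shows egp_pres: "egp S (pres S P)" and egp_pcon: "egp T (pcon S T P)"
    and ebounded_pres: "\<And>A. A \<subseteq> S \<Longrightarrow> ebounded A (pres S P) \<longleftrightarrow> ebounded A P"
    and ebounded_pcon: "\<And>A. A \<subseteq> T \<Longrightarrow> ebounded A (pcon S T P) \<longleftrightarrow> ebounded (S \<union> A) P"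
    and hv_pres: "\<And>A. A \<subseteq> S \<Longrightarrow> ebounded A P \<Longrightarrow> hv (pres S P) A = hv P A"
    and hv_pcon: "\<And>A. A \<subseteq> T \<Longrightarrow> ebounded (S \<union> A) P \<Longrightarrow> hv (pcon S T P) A = hv P (S \<union> A) - hv P S"
proof -
  have "S \<in> pdom (S \<union> T) P" using S by (simp add: pdom_def)
  note b = face_bpoly[OF egp_submod(1)[OF P] disj this, folded egp_submod(2)[OF P]]
  show "egp S (pres S P)" unfolding b(3) by (rule egp_bpoly[OF b(1)])
  show "egp T (pcon S T P)" unfolding b(4) by (rule egp_bpoly[OF b(2)])
  show "ebounded A (pres S P) \<longleftrightarrow> ebounded A P" if "A \<subseteq> S" for A
    unfolding b(3) ebounded_bpoly[OF b(1) that] using that by (auto simp: pdom_def)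
  show "ebounded A (pcon S T P) \<longleftrightarrow> ebounded (S \<union> A) P" if "A \<subseteq> T" for A
    unfolding b(4) ebounded_bpoly[OF b(2) that] using that by (auto simp: pdom_def)
  show "hv (pres S P) A = hv P A" if "A \<subseteq> S" "ebounded A P" for A
    unfolding b(3) by (subst hv_bpoly[OF b(1)]) (use that in \<open>auto simp: pdom_def\<close>)
  show "hv (pcon S T P) A = hv P (S \<union> A) - hv P S" if "A \<subseteq> T" "ebounded (S \<union> A) P" for A
    unfolding b(4) by (subst hv_bpoly[OF b(2)]) (use that in \<open>auto simp: pdom_def\<close>)
qed

lemma
  assumes P: "egp I P" and inj: "inj_on \<sigma> I"
  shows egp_ppush: "egp (\<sigma> ` I) (ppush \<sigma> I P)"
    and ebounded_ppush: "\<And>A. A \<subseteq> I \<Longrightarrow> ebounded (\<sigma> ` A) (ppush \<sigma> I P) \<longleftrightarrow> ebounded A P"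
    and hv_ppush: "\<And>A. A \<subseteq> I \<Longrightarrow> ebounded A P \<Longrightarrow> hv (ppush \<sigma> I P) (\<sigma> ` A) = hv P A"
proof -
  note b = ppush_bpoly[OF egp_submod(1)[OF P] inj, folded egp_submod(2)[OF P]]
  have pre: "{i \<in> I. \<sigma> i \<in> \<sigma> ` A} = A" if "A \<subseteq> I" for A
    using that inj by (auto dest: inj_onD)
  show "egp (\<sigma> ` I) (ppush \<sigma> I P)" unfolding b(2) by (rule egp_bpoly[OF b(1)])
  show "ebounded (\<sigma> ` A) (ppush \<sigma> I P) \<longleftrightarrow> ebounded A P" if "A \<subseteq> I" for A
  proof -
    have "\<sigma> ` A \<in> (`) \<sigma> ` pdom I P \<longleftrightarrow> A \<in> pdom I P"
    proof
      assume "\<sigma> ` A \<in> (`) \<sigma> ` pdom I P"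
      then obtain B where "B \<in> pdom I P" "\<sigma> ` A = \<sigma> ` B" by blast
      moreover from this have "A = B" using inj_on_image_eq_iff[OF inj that] by (simp add: pdom_def)
      ultimately show "A \<in> pdom I P" by simp
    qed simp
    then show ?thesis
      unfolding b(2) using ebounded_bpoly[OF b(1) image_mono[OF that]] that by (simp add: pdom_def)
  qed
  show "hv (ppush \<sigma> I P) (\<sigma> ` A) = hv P A" if "A \<subseteq> I" "ebounded A P" for A
    unfolding b(2) by (subst hv_bpoly[OF b(1)]) (use that in \<open>auto simp: pdom_def pre\<close>)
qed

section \<open>The Euler characteristic of compact convex sets\<close>

text \<open>Comparing the relation at a right endpoint \<open>\<rho>\<close> with the relation just
  after it isolates the intervals that end at \<open>\<rho>\<close>; their coefficients cancel, and
  every interval ends somewhere.\<close>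

lemma sum_intervals_eq_0:
  fixes l r a :: "'b \<Rightarrow> real"
  assumes fin: "finite N" and lr: "\<And>n. n \<in> N \<Longrightarrow> l n \<le> r n"
    and z: "\<And>t. (\<Sum>n\<in>N. if l n \<le> t \<and> t \<le> r n then a n else 0) = 0"
  shows "sum a N = 0"
proof -
  have jump: "(\<Sum>n\<in>{n\<in>N. r n = \<rho>}. a n) = 0" for \<rho>
  proof -
    \<comment> \<open>Half the distance from \<open>\<rho>\<close> to the next endpoint, so that no
      interval starts or ends in between; the 1 covers the case that no endpoint lies to the
      right.\<close>
    let ?G = "insert 1 ((\<lambda>v. v - \<rho>) ` {v \<in> l ` N \<union> r ` N. v > \<rho>})"
    define e where "e = Min ?G / 2"
    have "Min ?G > 0" using fin by (subst Min_gr_iff) auto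
    then have e0: "e > 0" by (simp add: e_def)
    have e: "\<rho> + e < v" if "v \<in> l ` N \<union> r ` N" "v > \<rho>" for v
    proof -
      have "Min ?G \<le> v - \<rho>" using that fin by (intro Min_le) auto
      then show ?thesis using e0 by (simp add: e_def)
    qed
    have "(\<Sum>n\<in>{n\<in>N. r n = \<rho>}. a n) = (\<Sum>n\<in>N. if r n = \<rho> then a n else 0)"
      using fin by (simp add: sum.inter_filter)
    also have "\<dots> = (\<Sum>n\<in>N. (if l n \<le> \<rho> \<and> \<rho> \<le> r n then a n else 0)
        - (if l n \<le> \<rho> + e \<and> \<rho> + e \<le> r n then a n else 0))"
    proof (rule sum.cong[OF refl])
      fix n assume n: "n \<in> N"
      have "l n \<le> \<rho> + e \<longleftrightarrow> l n \<le> \<rho>" using e[of "l n"] n e0 by force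
      moreover have "\<rho> + e \<le> r n \<longleftrightarrow> \<rho> < r n" using e[of "r n"] n e0 by force
      ultimately show "(if r n = \<rho> then a n else 0) = (if l n \<le> \<rho> \<and> \<rho> \<le> r n then a n else 0)
        - (if l n \<le> \<rho> + e \<and> \<rho> + e \<le> r n then a n else 0)"
        using lr[OF n] by auto
    qed
    also have "\<dots> = 0" by (simp add: sum_subtractf z)
    finally show ?thesis .
  qed
  have "sum a N = (\<Sum>\<rho>\<in>r ` N. \<Sum>n\<in>{n\<in>N. r n = \<rho>}. a n)"
    by (rule sum.image_gen[OF fin])
  then show ?thesis by (simp add: jump)
qed

definition fconvex :: "('a \<Rightarrow> real) set \<Rightarrow> bool" where
  "fconvex P \<longleftrightarrow> (\<forall>x\<in>P. \<forall>y\<in>P. \<forall>t. 0 \<le> t \<and> t \<le> 1 \<longrightarrow> (\<lambda>i. (1 - t) * x i + t * y i) \<in> P)"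

lemma fconvex_Int: "fconvex P \<Longrightarrow> fconvex Q \<Longrightarrow> fconvex (P \<inter> Q)"
  by (simp add: fconvex_def)

lemma fconvex_slice: "fconvex {x. x i = (t::real)}"
  by (auto simp: fconvex_def algebra_simps)

lemma compact_fconvex_coordinate_image:
  fixes P :: "('a \<Rightarrow> real) set"
  assumes "compact P" "fconvex P" "P \<noteq> {}"
  obtains l r where "l \<le> r" "(\<lambda>x. x i) ` P = {l..r}"
proof -
  let ?Q = "(\<lambda>x. x i) ` P"
  have "compact ?Q" by (rule compact_continuous_image)
    (use assms continuous_on_subset[OF continuous_on_product_coordinates[of i]] in auto)
  moreover have "?Q \<noteq> {}" using assms by simp
  ultimately obtain l r where l: "l \<in> ?Q" "\<And>q. q \<in> ?Q \<Longrightarrow> l \<le> q" and r: "r \<in> ?Q" "\<And>q. q \<in> ?Q \<Longrightarrow> q \<le> r"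
    using compact_attains_inf[of ?Q] compact_attains_sup[of ?Q] by blast
  have "q \<in> ?Q" if "l \<le> q" "q \<le> r" for q
  proof (cases "l = r")
    case False
    obtain x y where x: "x \<in> P" "x i = l" and y: "y \<in> P" "y i = r" using l r by blast
    define t where "t = (q - l) / (r - l)"
    have "0 \<le> t" "t \<le> 1" using that False by (auto simp: t_def field_simps)
    then have "(\<lambda>j. (1 - t) * x j + t * y j) \<in> P" using assms(2) x y by (simp add: fconvex_def)
    moreover have "(1 - t) * x i + t * y i = q"
    proof -
      have "(1 - t) * x i + t * y i = l + t * (r - l)" using x y by (simp add: algebra_simps)
      then show ?thesis using that False by (simp add: t_def)
    qed
    ultimately show ?thesis by (metis (mono_tags, lifting) image_eqI)
  qed (use that l in auto)
  then have "?Q = {l..r}" using l r by force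
  moreover have "l \<le> r" using l(2)[OF r(1)] .
  ultimately show ?thesis using that by blast
qed

lemma euler_compact_fconvex:
  fixes P :: "'b \<Rightarrow> ('a \<Rightarrow> real) set" and a :: "'b \<Rightarrow> real"
  assumes "finite J" "finite N"
    and "\<And>n. n \<in> N \<Longrightarrow> compact (P n)" "\<And>n. n \<in> N \<Longrightarrow> fconvex (P n)"
    and "\<And>n x i. n \<in> N \<Longrightarrow> x \<in> P n \<Longrightarrow> i \<notin> J \<Longrightarrow> x i = y i"
    and "\<And>x. (\<Sum>n\<in>N. a n * indic (P n) x) = 0"
  shows "(\<Sum>n\<in>N. if P n = {} then 0 else a n) = 0"
  using assms(1,3-6)
proof (induction J arbitrary: P y rule: finite_induct)
  case empty
  have "(if P n = {} then 0 else a n) = a n * indic (P n) y" if "n \<in> N" for n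
  proof (cases "P n = {}")
    case False
    then obtain x where "x \<in> P n" by blast
    moreover from this have "x = y" using empty(3)[OF that] by (auto simp: fun_eq_iff)
    ultimately show ?thesis by (auto simp: indic_def)
  qed (simp add: indic_def)
  then have "(\<Sum>n\<in>N. if P n = {} then 0 else a n) = (\<Sum>n\<in>N. a n * indic (P n) y)"
    by (rule sum.cong[OF refl])
  then show ?case using empty(4) by simp
next
  case (insert i J)
  have cl: "closed {x::'a \<Rightarrow> real. x i = t}" for t
    by (intro closed_Collect_eq) auto
  have slice: "(\<Sum>n\<in>N. if P n \<inter> {x. x i = t} = {} then 0 else a n) = 0" for t
  proof (rule insert.IH[where y = "y(i := t)"])
    fix n assume n: "n \<in> N"
    show "compact (P n \<inter> {x. x i = t})" using insert.prems(1)[OF n] cl by (rule compact_Int_closed)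
    show "fconvex (P n \<inter> {x. x i = t})" using insert.prems(2)[OF n] fconvex_slice by (rule fconvex_Int)
    show "x j = (y(i := t)) j" if "x \<in> P n \<inter> {x. x i = t}" "j \<notin> J" for x j
      using that insert.prems(3)[OF n, of x j] by auto
  next
    fix x
    have "(\<Sum>n\<in>N. a n * indic (P n \<inter> {x. x i = t}) x) = (if x i = t then (\<Sum>n\<in>N. a n * indic (P n) x) else 0)"
      by (auto simp: indic_def intro!: sum.neutral)
    then show "(\<Sum>n\<in>N. a n * indic (P n \<inter> {x. x i = t}) x) = 0" using insert.prems(4) by simp
  qed
  let ?N = "{n \<in> N. P n \<noteq> {}}"
  have "\<forall>n\<in>?N. \<exists>l r. l \<le> r \<and> (\<lambda>x. x i) ` P n = {l..r}"
  proof
    fix n assume "n \<in> ?N"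
    then show "\<exists>l r. l \<le> r \<and> (\<lambda>x. x i) ` P n = {l..r}"
      using compact_fconvex_coordinate_image[of "P n" i] insert.prems(1,2) by auto
  qed
  from bchoice[OF this] obtain l where "\<forall>n\<in>?N. \<exists>r. l n \<le> r \<and> (\<lambda>x. x i) ` P n = {l n..r}" by blast
  from bchoice[OF this] obtain r where lr: "\<And>n. n \<in> ?N \<Longrightarrow> l n \<le> r n \<and> (\<lambda>x. x i) ` P n = {l n..r n}"
    by blast
  have "sum a ?N = 0"
  proof (rule sum_intervals_eq_0[of _ l r])
    fix t
    have "(\<Sum>n\<in>?N. if l n \<le> t \<and> t \<le> r n then a n else 0)
        = (\<Sum>n\<in>?N. if P n \<inter> {x. x i = t} = {} then 0 else a n)"
    proof (rule sum.cong[OF refl])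
      fix n assume "n \<in> ?N"
      then have "t \<in> (\<lambda>x. x i) ` P n \<longleftrightarrow> l n \<le> t \<and> t \<le> r n" using lr by simp
      then show "(if l n \<le> t \<and> t \<le> r n then a n else 0) = (if P n \<inter> {x. x i = t} = {} then 0 else a n)"
        by auto
    qed
    also have "\<dots> = (\<Sum>n\<in>N. if P n \<inter> {x. x i = t} = {} then 0 else a n)"
      using assms(2) by (intro sum.mono_neutral_left) auto
    finally show "(\<Sum>n\<in>?N. if l n \<le> t \<and> t \<le> r n then a n else 0) = 0" using slice by simp
  qed (use assms(2) lr in auto)
  moreover have "(\<Sum>n\<in>N. if P n = {} then 0 else a n) = sum a ?N"
    using assms(2) by (auto simp: sum.inter_filter intro!: sum.cong)
  ultimately show ?case by simp
qed

section \<open>Passing from compact sets to unbounded polyhedra\<close>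

lemma compact_RI_box: "compact {x \<in> RI I. \<forall>i\<in>I. \<bar>x i\<bar> \<le> (M::real)}"
proof -
  let ?B = "\<lambda>i. if i \<in> I then {-M..M} else {0::real}"
  have "{x \<in> RI I. \<forall>i\<in>I. \<bar>x i\<bar> \<le> M} = PiE UNIV ?B"
    by (auto simp: RI_def PiE_def Pi_def abs_le_iff minus_le_iff split: if_splits)
  moreover have "compactin (product_topology (\<lambda>i. euclidean) UNIV) (PiE UNIV ?B)"
    by (subst compactin_PiE) auto
  ultimately show ?thesis by (simp add: euclidean_product_topology)
qed

lemma continuous_on_coordinate_sum: "continuous_on UNIV (\<lambda>x::'a \<Rightarrow> real. sum x A)"
  by (intro continuous_on_sum) auto

lemma coordinate_sum_convex_combination:
  "(\<Sum>i\<in>A. (1 - t) * x i + t * y i) = (1 - t) * sum x A + t * sum y (A :: 'a set)"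
  for x y :: "'a \<Rightarrow> real"
  by (simp add: sum.distrib sum_distrib_left)

text \<open>The polyhedra may be unbounded. For each \<open>P\<close> in the support that meets the
  halfspaces a witness \<open>w P\<close> is fixed, and everything is intersected with a box
  containing all these witnesses. The sets become compact, and none of the nonempty intersections
  becomes empty.\<close>

lemma euler_egp:
  fixes u :: "'c \<Rightarrow> 'a set"
  assumes f: "f \<in> gp_comp I" and ind: "indf I f = (\<lambda>_. 0)"
  shows "(\<Sum>P\<in>{P. f P \<noteq> 0}. if \<exists>x\<in>P. \<forall>j\<in>C. b j \<le> sum x (u j) then f P else 0) = 0"
proof (cases "{P. f P \<noteq> 0} = {}")
  case False
  let ?N = "{P. f P \<noteq> 0}"
  have fin: "finite ?N" and egp: "\<And>P. P \<in> ?N \<Longrightarrow> egp I P" using f by (auto simp: gp_comp_def)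
  have finI: "finite I" using False egp by (auto simp: egp_def)
  let ?H = "{x::'a \<Rightarrow> real. \<forall>j\<in>C. b j \<le> sum x (u j)}"
  define w where "w P = (SOME x. x \<in> P \<and> x \<in> ?H)" for P
  have w: "w P \<in> P \<and> w P \<in> ?H" if "\<exists>x\<in>P. x \<in> ?H" for P
    unfolding w_def by (rule someI_ex[of "\<lambda>x. x \<in> P \<and> x \<in> ?H"]) (use that in blast)
  define M where "M = Max (insert 0 ((\<lambda>(P, i). \<bar>w P i\<bar>) ` (?N \<times> I)))"
  have M: "\<bar>w P i\<bar> \<le> M" if "P \<in> ?N" "i \<in> I" for P i
    unfolding M_def using fin finI that by (intro Max_ge) auto
  let ?B = "{x \<in> RI I. \<forall>i\<in>I. \<bar>x i\<bar> \<le> M}"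
  let ?Q = "\<lambda>P. P \<inter> ?H \<inter> ?B"
  have "(\<Sum>P\<in>?N. if ?Q P = {} then 0 else f P) = 0"
  proof (rule euler_compact_fconvex[OF finI fin, where y = "\<lambda>_. 0"])
    fix P assume P: "P \<in> ?N"
    have Peq: "P = RI I \<inter> {x. sum x I = hv P I} \<inter> (\<Inter>A\<in>pdom I P. {x. sum x A \<le> hv P A})"
      using egp_submod(2)[OF egp[OF P]] unfolding bpoly_def by blast
    have "closed ({x. sum x I = hv P I} \<inter> (\<Inter>A\<in>pdom I P. {x. sum x A \<le> hv P A}) \<inter> (\<Inter>j\<in>C. {x::'a \<Rightarrow> real. b j \<le> sum x (u j)}))"
      by (intro closed_Int closed_INT ballI closed_Collect_le closed_Collect_eq continuous_on_coordinate_sum continuous_on_const)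
    moreover have "?Q P = ?B \<inter> ({x. sum x I = hv P I} \<inter> (\<Inter>A\<in>pdom I P. {x. sum x A \<le> hv P A}) \<inter> (\<Inter>j\<in>C. {x::'a \<Rightarrow> real. b j \<le> sum x (u j)}))"
      by (subst Peq) auto
    ultimately show "compact (?Q P)" using compact_Int_closed[OF compact_RI_box] by (simp only:)
    have cv: "(1 - t) * u + t * v \<le> c" if "u \<le> c" "v \<le> c" "0 \<le> t" "t \<le> 1" for u v c t :: real
      using that convex_bound_le[of u c v "1 - t" t] by simp
    have cv': "c \<le> (1 - t) * u + t * v" if "c \<le> u" "c \<le> v" "0 \<le> t" "t \<le> 1" for u v c t :: real
      using cv[of "-u" "-c" "-v" t] that by simp
    have "fconvex P"
      unfolding fconvex_def
    proof (intro ballI allI impI)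
      fix x y t assume h: "x \<in> P" "y \<in> P" "0 \<le> t \<and> t \<le> (1::real)"
      show "(\<lambda>i. (1 - t) * x i + t * y i) \<in> P"
      proof (rule egp_memI[OF egp[OF P]])
        show "(\<lambda>i. (1 - t) * x i + t * y i) \<in> RI I"
          using subsetD[OF egp_RI[OF egp[OF P]] h(1)] subsetD[OF egp_RI[OF egp[OF P]] h(2)] by (simp add: RI_def)
        show "(\<Sum>i\<in>I. (1 - t) * x i + t * y i) = hv P I"
          unfolding coordinate_sum_convex_combination
          using h egp_hv(5)[OF egp[OF P]] by (simp add: algebra_simps)
        show "(\<Sum>i\<in>A. (1 - t) * x i + t * y i) \<le> hv P A" if "A \<subseteq> I" "ebounded A P" for A
          unfolding coordinate_sum_convex_combination
          using h egp_hv(4)[OF egp[OF P] _ that] by (intro cv) auto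
      qed
    qed
    moreover have "fconvex ?H"
      unfolding fconvex_def by (auto simp: coordinate_sum_convex_combination intro!: cv')
    moreover have "fconvex ?B"
      unfolding fconvex_def
    proof (intro ballI allI impI)
      fix x y t assume h: "x \<in> ?B" "y \<in> ?B" "0 \<le> t \<and> t \<le> (1::real)"
      have "\<bar>(1 - t) * x i + t * y i\<bar> \<le> M" if "i \<in> I" for i
      proof -
        have "(1 - t) * x i + t * y i \<le> M" "- M \<le> (1 - t) * x i + t * y i"
          using h that by (auto intro!: cv cv' simp: abs_le_iff minus_le_iff)
        then show ?thesis by (simp add: abs_le_iff)
      qed
      then show "(\<lambda>i. (1 - t) * x i + t * y i) \<in> ?B" using h by (auto simp: RI_def)
    qed
    ultimately show "fconvex (?Q P)" by (intro fconvex_Int)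
    show "x i = 0" if "x \<in> ?Q P" "i \<notin> I" for x i using that by (simp add: RI_def)
  next
    fix x
    have "(\<Sum>P\<in>?N. f P * indic (?Q P) x) = (if x \<in> ?H \<inter> ?B then indf I f x else 0)"
      by (auto simp: indic_def indf_def intro!: sum.neutral sum.cong)
    then show "(\<Sum>P\<in>?N. f P * indic (?Q P) x) = 0" using ind by simp
  qed
  moreover have eq: "(if ?Q P = {} then 0 else f P) = (if \<exists>x\<in>P. \<forall>j\<in>C. b j \<le> sum x (u j) then f P else 0)"
    if "P \<in> ?N" for P
  proof -
    have "?Q P \<noteq> {}" if h: "\<exists>x\<in>P. x \<in> ?H"
    proof -
      have "w P \<in> ?B" using w[OF h] M[OF \<open>P \<in> ?N\<close>] egp_RI[OF egp[OF \<open>P \<in> ?N\<close>]] by auto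
      then have "w P \<in> ?Q P" using w[OF h] by (intro IntI) simp_all
      then show ?thesis by (metis empty_iff)
    qed
    moreover have "\<exists>x\<in>P. x \<in> ?H" if "?Q P \<noteq> {}" using that by blast
    ultimately show ?thesis by (auto simp del: Int_iff)
  qed
  ultimately show ?thesis using sum.cong[OF refl eq, of ?N] by simp
qed simp

section \<open>Weighted ordered set partitions\<close>

text \<open>Recursive form of the block conditions in \<open>wosp\<close>, suited to induction on
  the list of blocks.\<close>

fun part :: "'a set \<Rightarrow> 'a set list \<Rightarrow> bool" where
  "part I [] \<longleftrightarrow> I = {}"
| "part I (B # Bs) \<longleftrightarrow> B \<noteq> {} \<and> B \<subseteq> I \<and> part (I - B) Bs"

lemma part_Union: "part I Bs \<Longrightarrow> \<Union> (set Bs) = I"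
  by (induction Bs arbitrary: I) auto

lemma part_nonempty: "part I Bs \<Longrightarrow> B \<in> set Bs \<Longrightarrow> B \<noteq> {}"
  by (induction Bs arbitrary: I) auto

lemma wosp_iff_part: "wosp I F \<longleftrightarrow> finite I \<and> part I (map fst F)"
proof -
  have "(\<forall>p\<in>set F. fst p \<noteq> {}) \<and> (\<forall>i<length F. \<forall>j<length F. i \<noteq> j \<longrightarrow> fst (F ! i) \<inter> fst (F ! j) = {}) \<and>
     \<Union> (fst ` set F) = I \<longleftrightarrow> part I (map fst F)"
  proof (induction F arbitrary: I)
    case Nil then show ?case by auto
  next
    case (Cons p F)
    let ?d = "\<lambda>F. \<forall>i<length F. \<forall>j<length F. i \<noteq> j \<longrightarrow> fst (F ! i) \<inter> fst (F ! j) = {}"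
    have "?d (p # F) \<longleftrightarrow> ?d F \<and> (\<forall>q\<in>set F. fst p \<inter> fst q = {})"
      by (simp add: All_less_Suc2 all_set_conv_all_nth Int_commute) blast
    then have "(\<forall>q\<in>set (p # F). fst q \<noteq> {}) \<and> ?d (p # F) \<and> \<Union> (fst ` set (p # F)) = I
      \<longleftrightarrow> fst p \<noteq> {} \<and> fst p \<subseteq> I \<and> ((\<forall>q\<in>set F. fst q \<noteq> {}) \<and> ?d F \<and> \<Union> (fst ` set F) = I - fst p)"
      by (auto 4 3)
    then show ?case using Cons.IH[of "I - fst p"] by simp
  qed
  then show ?thesis unfolding wosp_def by blast
qed

text \<open>Used where a partition is cut after a prefix, above all for the coproduct of
  \<open>WSigma\<close>.\<close>

lemma part_append: "part I (Bs @ Cs) \<longleftrightarrow> part (\<Union> (set Bs)) Bs \<and> \<Union> (set Bs) \<subseteq> I \<and> part (I - \<Union> (set Bs)) Cs"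
proof (induction Bs arbitrary: I)
  case (Cons B Bs)
  have e: "part (I - B) (Bs @ Cs) \<longleftrightarrow> part (\<Union> (set Bs)) Bs \<and> \<Union> (set Bs) \<subseteq> I - B \<and> part (I - B - \<Union> (set Bs)) Cs"
    by (rule Cons.IH)
  have "part (B \<union> \<Union> (set Bs)) (B # Bs) \<longleftrightarrow> B \<noteq> {} \<and> part (\<Union> (set Bs)) Bs \<and> B \<inter> \<Union> (set Bs) = {}"
  proof -
    have "part (\<Union> (set Bs) - B) Bs \<longleftrightarrow> part (\<Union> (set Bs)) Bs \<and> B \<inter> \<Union> (set Bs) = {}"
    proof
      assume h: "part (\<Union> (set Bs) - B) Bs"
      then have "\<Union> (set Bs) - B = \<Union> (set Bs)" using part_Union by fastforce
      then show "part (\<Union> (set Bs)) Bs \<and> B \<inter> \<Union> (set Bs) = {}" using h by auto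
    next
      assume "part (\<Union> (set Bs)) Bs \<and> B \<inter> \<Union> (set Bs) = {}"
      moreover from this have "\<Union> (set Bs) - B = \<Union> (set Bs)" by blast
      ultimately show "part (\<Union> (set Bs) - B) Bs" by simp
    qed
    moreover have "B \<union> \<Union> (set Bs) - B = \<Union> (set Bs) - B" by blast
    ultimately show ?thesis by simp
  qed
  moreover have "I - B - \<Union> (set Bs) = I - (B \<union> \<Union> (set Bs))" by blast
  moreover have "part I ((B # Bs) @ Cs) \<longleftrightarrow> B \<noteq> {} \<and> B \<subseteq> I \<and> part (I - B) (Bs @ Cs)"
    "\<Union> (set (B # Bs)) = B \<union> \<Union> (set Bs)" by simp_all
  ultimately show ?case using e
    by (simp only:) blast
qed auto

lemma part_length: "finite I \<Longrightarrow> part I Bs \<Longrightarrow> length Bs \<le> card I"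
proof (induction Bs arbitrary: I)
  case (Cons B Bs)
  then have "length Bs \<le> card (I - B)" by auto
  moreover have "card (I - B) < card I" using Cons.prems by (intro psubset_card_mono) auto
  ultimately show ?case by simp
qed simp

lemma finite_part:
  assumes "finite I" shows "finite {Bs. part I Bs}"
proof (rule finite_subset)
  show "{Bs. part I Bs} \<subseteq> {Bs. set Bs \<subseteq> Pow I \<and> length Bs \<le> card I}"
    using part_length[OF assms] part_Union by blast
  show "finite {Bs. set Bs \<subseteq> Pow I \<and> length Bs \<le> card I}"
    using assms by (intro finite_lists_length_le) simp
qed

definition UF :: "('a set \<times> real) list \<Rightarrow> 'a set" where
  "UF F = \<Union> (fst ` set F)"

lemma UF_simps [simp]: "UF [] = {}" "UF (p # F) = fst p \<union> UF F" "UF (F @ G) = UF F \<union> UF G"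
  by (auto simp: UF_def)

lemma wosp_UF: "wosp I F \<Longrightarrow> UF F = I"
  by (simp add: wosp_def UF_def)

text \<open>The weights of \<open>F\<close> are the increments of the support function of \<open>P\<close> along the chain of sets
obtained from \<open>A\<close> by adding the blocks of \<open>F\<close> one by one.\<close>

fun fits :: "('a \<Rightarrow> real) set \<Rightarrow> 'a set \<Rightarrow> ('a set \<times> real) list \<Rightarrow> bool" where
  "fits P A [] \<longleftrightarrow> True"
| "fits P A ((B, w) # F) \<longleftrightarrow> ebounded (A \<union> B) P \<and> w = hv P (A \<union> B) - hv P A \<and> fits P (A \<union> B) F"

text \<open>The only weights that can fit \<open>P\<close> once the blocks are given. Hence each
  \<open>P\<close> fits finitely many weighted partitions, and sums over them become sums over block
  lists.\<close>

fun wlist :: "('a \<Rightarrow> real) set \<Rightarrow> 'a set \<Rightarrow> 'a set list \<Rightarrow> ('a set \<times> real) list" where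
  "wlist P A [] = []"
| "wlist P A (B # Bs) = (B, hv P (A \<union> B) - hv P A) # wlist P (A \<union> B) Bs"

lemma map_fst_wlist [simp]: "map fst (wlist P A Bs) = Bs"
  by (induction Bs arbitrary: A) auto

lemma fits_wlist: "fits P A F \<Longrightarrow> F = wlist P A (map fst F)"
  by (induction P A F rule: fits.induct) auto

lemma fits_append: "fits P A (F @ G) \<longleftrightarrow> fits P A F \<and> fits P (A \<union> UF F) G"
  by (induction P A F rule: fits.induct) (auto simp: Un_assoc)

lemma fits_hv: "fits P A F \<Longrightarrow> hv P (A \<union> UF F) = hv P A + sum_list (map snd F)"
  by (induction P A F rule: fits.induct) (auto simp: Un_assoc)

lemma fits_ebounded: "fits P A F \<Longrightarrow> ebounded A P \<Longrightarrow> ebounded (A \<union> UF F) P"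
  by (induction P A F rule: fits.induct) (auto simp: Un_assoc)

text \<open>Summing the increments turns fitting into one separate condition per prefix, the form in
  which it can be written as a product and expanded.\<close>

lemma fits_iff_take:
  assumes "ebounded A P"
  shows "fits P A F \<longleftrightarrow> (\<forall>j\<le>length F. ebounded (A \<union> UF (take j F)) P \<and>
           hv P (A \<union> UF (take j F)) = hv P A + sum_list (map snd (take j F)))"
  using assms
proof (induction F arbitrary: A)
  case (Cons p F)
  obtain B w where p: "p = (B, w)" by fastforce
  have split: "(\<forall>j\<le>length (p # F). Q j) \<longleftrightarrow> Q 0 \<and> (\<forall>j\<le>length F. Q (Suc j))" for Q
    by (metis Suc_le_mono le_0_eq length_Cons nat.exhaust zero_le)
  let ?Q = "\<lambda>A F j. ebounded (A \<union> UF (take j F)) P \<and> hv P (A \<union> UF (take j F)) = hv P A + sum_list (map snd (take j F))"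
  have "fits P A (p # F) \<longleftrightarrow> (\<forall>j\<le>length F. ?Q A (p # F) (Suc j))"
  proof
    assume h: "fits P A (p # F)"
    then have "\<forall>j\<le>length F. ?Q (A \<union> B) F j" using Cons.IH[of "A \<union> B"] by (simp add: p)
    then show "\<forall>j\<le>length F. ?Q A (p # F) (Suc j)" using h by (simp add: p Un_assoc)
  next
    assume h: "\<forall>j\<le>length F. ?Q A (p # F) (Suc j)"
    then have 0: "ebounded (A \<union> B) P" "hv P (A \<union> B) = hv P A + w"
      by (auto simp: p dest: spec[of _ 0])
    then have "\<forall>j\<le>length F. ?Q (A \<union> B) F j" using h by (simp add: p Un_assoc)
    then show "fits P A (p # F)" using 0 Cons.IH[of "A \<union> B"] by (simp add: p)
  qed
  then show ?case unfolding split using Cons.prems by simp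
qed simp

definition phi :: "'a set \<Rightarrow> ('a \<Rightarrow> real) set \<Rightarrow> ('a set \<times> real) list \<Rightarrow> real" where
  "phi I P F = (if wosp I F \<and> fits P {} F then 1 else 0)"

lemma phi_nonzero: "phi I P F \<noteq> 0 \<longleftrightarrow> wosp I F \<and> fits P {} F"
  by (simp add: phi_def)

lemma finite_phi: "finite {F. phi I P F \<noteq> 0}"
proof (cases "finite I")
  case True
  have "{F. phi I P F \<noteq> 0} \<subseteq> wlist P {} ` {Bs. part I Bs}"
    unfolding phi_nonzero wosp_iff_part using fits_wlist by blast
  then show ?thesis using finite_part[OF True] finite_subset by blast
qed (simp add: phi_def wosp_def)

lemma phi_in_w_comp: "phi I P \<in> w_comp I"
  unfolding w_comp_def using finite_phi[of I P] by (auto simp: phi_nonzero)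

section \<open>Indicator functions in terms of weighted ordered set partitions\<close>

text \<open>The chains \<open>A \<union> B1 \<subset> A \<union> B1 \<union> B2 \<subset> \<dots> \<subset> I\<close> all of whose members except \<open>I\<close> lie in
\<open>N\<close>, given by their successive differences.\<close>

fun nchain :: "'a set set \<Rightarrow> 'a set \<Rightarrow> 'a set \<Rightarrow> 'a set list \<Rightarrow> bool" where
  "nchain N I A [] \<longleftrightarrow> A = I"
| "nchain N I A (B # Bs) \<longleftrightarrow> B \<noteq> {} \<and> B \<subseteq> I - A \<and> (Bs \<noteq> [] \<longrightarrow> A \<union> B \<in> N) \<and> nchain N I (A \<union> B) Bs"

lemma nchain_part: "nchain N I A Bs \<Longrightarrow> A \<subseteq> I \<Longrightarrow> part (I - A) Bs"
proof (induction Bs arbitrary: A)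
  case (Cons B Bs)
  then have "part (I - (A \<union> B)) Bs" by auto
  moreover have "I - (A \<union> B) = I - A - B" by blast
  ultimately show ?case using Cons.prems by auto
qed simp

text \<open>A list of \<open>k\<close> differences stands for a chain with \<open>k - 1\<close>
  members in \<open>N\<close>, so the empty chain contributes 1. For \<open>A\<close> properly
  inside \<open>I\<close> the sum is one minus the Euler characteristic of the order complex of the
  members of \<open>N\<close> strictly above \<open>A\<close>. For \<open>A = I\<close> only the
  empty list counts, and truncated subtraction gives 1.\<close>

definition chain_euler :: "'a set set \<Rightarrow> 'a set \<Rightarrow> 'a set \<Rightarrow> real" where
  "chain_euler N I A = (\<Sum>Bs\<in>{Bs. nchain N I A Bs}. (-1) ^ (length Bs - 1))"

lemma finite_nchain: "finite I \<Longrightarrow> A \<subseteq> I \<Longrightarrow> finite {Bs. nchain N I A Bs}"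
  by (rule finite_subset[OF _ finite_part[of "I - A"]]) (auto dest: nchain_part)

text \<open>Chains are sorted by their smallest member in \<open>N\<close>. The 1 is the empty
  chain, and deleting the smallest member flips the sign.\<close>

lemma chain_euler_rec:
  assumes "finite I" "A \<subset> I" "\<And>U. U \<in> N \<Longrightarrow> U \<subset> I"
  shows "chain_euler N I A = 1 - (\<Sum>U\<in>{U\<in>N. A \<subset> U}. chain_euler N I U)"
proof -
  let ?L = "\<lambda>A. {Bs. nchain N I A Bs}" and ?U = "{U\<in>N. A \<subset> U}"
  have L: "?L A = {[I - A]} \<union> (\<Union>U\<in>?U. (#) (U - A) ` ?L U)"
  proof
    show "?L A \<subseteq> {[I - A]} \<union> (\<Union>U\<in>?U. (#) (U - A) ` ?L U)"
    proof
      fix Bs assume "Bs \<in> ?L A"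
      then have h: "nchain N I A Bs" by simp
      show "Bs \<in> {[I - A]} \<union> (\<Union>U\<in>?U. (#) (U - A) ` ?L U)"
      proof (cases Bs)
        case Nil then show ?thesis using h assms(2) by auto
      next
        case (Cons B Cs)
        show ?thesis
        proof (cases "Cs = []")
          case True
          then have "A \<union> B = I" "B \<subseteq> I - A" using h Cons by auto
          then have "B = I - A" by blast
          then show ?thesis using True Cons by simp
        next
          case False
          then have "A \<union> B \<in> ?U" "B = (A \<union> B) - A" "nchain N I (A \<union> B) Cs" using h Cons by auto
          then show ?thesis using Cons by blast
        qed
      qed
    qed
    have "(U - A) # Cs \<in> ?L A" if "U \<in> ?U" "nchain N I U Cs" for U Cs
    proof -
      have "A \<union> (U - A) = U" "U - A \<noteq> {}" "U \<subset> I" using that assms(3) by auto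
      then show ?thesis using that by auto
    qed
    moreover have "[I - A] \<in> ?L A" using assms(2) by auto
    ultimately show "{[I - A]} \<union> (\<Union>U\<in>?U. (#) (U - A) ` ?L U) \<subseteq> ?L A" by blast
  qed
  have ne: "Cs \<noteq> []" if "U \<in> ?U" "Cs \<in> ?L U" for U Cs
    using that assms(3)[of U] by (cases Cs) auto
  have "N \<subseteq> Pow I" using assms(3) by blast
  then have finU: "finite ?U" using assms(1) by (auto intro: finite_subset[of _ "Pow I"])
  have fin: "finite ((#) (U - A) ` ?L U)" if "U \<in> ?U" for U
    using that assms(1,3) by (intro finite_imageI finite_nchain) auto
  have "chain_euler N I A = (\<Sum>Bs\<in>{[I - A]}. (-1) ^ (length Bs - 1)) +
      (\<Sum>Bs\<in>(\<Union>U\<in>?U. (#) (U - A) ` ?L U). (-1) ^ (length Bs - 1))"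
    unfolding chain_euler_def L
    by (rule sum.union_disjoint) (use finU fin ne in auto)
  also have "(\<Sum>Bs\<in>(\<Union>U\<in>?U. (#) (U - A) ` ?L U). (-1) ^ (length Bs - 1))
      = (\<Sum>U\<in>?U. \<Sum>Bs\<in>(#) (U - A) ` ?L U. (-1) ^ (length Bs - 1))"
    by (rule sum.UNION_disjoint) (use finU fin in auto)
  also have "\<dots> = (\<Sum>U\<in>?U. - chain_euler N I U)"
  proof (rule sum.cong[OF refl])
    fix U assume U: "U \<in> ?U"
    have "(\<Sum>Bs\<in>(#) (U - A) ` ?L U. (-1) ^ (length Bs - 1)) = (\<Sum>Bs\<in>?L U. (-1) ^ length Bs :: real)"
      by (subst sum.reindex) auto
    also have "\<dots> = (\<Sum>Bs\<in>?L U. - ((-1) ^ (length Bs - 1)))"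
    proof (rule sum.cong[OF refl])
      fix Bs assume "Bs \<in> ?L U"
      then have "Bs \<noteq> []" using ne U by blast
      then show "(-1) ^ length Bs = - ((-1) ^ (length Bs - 1) :: real)" by (cases Bs) auto
    qed
    finally show "(\<Sum>Bs\<in>(#) (U - A) ` ?L U. (-1) ^ (length Bs - 1)) = - chain_euler N I U"
      by (simp add: chain_euler_def sum_negf)
  qed
  finally show ?thesis by (simp add: sum_negf)
qed

text \<open>If \<open>V \<mapsto> V \<union> U0\<close> preserves \<open>N\<close> then the order complex of \<open>N\<close> is contractible.\<close>

lemma chain_euler_contractible:
  assumes "finite I" "\<And>U. U \<in> N \<Longrightarrow> U \<subset> I" "U0 \<in> N" "\<And>V. V \<in> N \<Longrightarrow> V \<union> U0 \<in> N"
    and "A \<in> insert {} N" "\<not> U0 \<subseteq> A"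
  shows "chain_euler N I A = 0"
  using assms(5,6)
proof (induction "card I - card A" arbitrary: A rule: less_induct)
  case less
  have AI: "A \<subset> I" using less.prems assms(2,3) by auto
  have AU: "A \<union> U0 \<in> N" using less.prems assms(3,4) by auto
  let ?U = "{U\<in>N. A \<subset> U}" and ?V = "{U\<in>N. A \<union> U0 \<subset> U}"
  have "N \<subseteq> Pow I" using assms(2) by blast
  then have finN: "finite N" using assms(1) by (auto intro: finite_subset[of _ "Pow I"])
  have 0: "chain_euler N I U = 0" if "U \<in> N" "A \<subset> U" "\<not> U0 \<subseteq> U" for U
  proof (rule less.hyps)
    have "U \<subset> I" using assms(2) that by blast
    then have "card U < card I" "card A < card U"
      using assms(1) that by (auto intro!: psubset_card_mono intro: finite_subset)
    then show "card I - card U < card I - card A" by simp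
  qed (use that in auto)
  \<comment> \<open>By induction the sets not containing \<open>U0\<close> contribute nothing. What
    remains is \<open>A \<union> U0\<close> and the sets strictly above it, whose total is 1 by the
    recursion at \<open>A \<union> U0\<close>; the recursion at \<open>A\<close> then gives
    0.\<close>
  have "(\<Sum>U\<in>?U. chain_euler N I U) = (\<Sum>U\<in>insert (A \<union> U0) ?V. chain_euler N I U)"
  proof (rule sum.mono_neutral_right)
    show "insert (A \<union> U0) ?V \<subseteq> ?U" using AU less.prems(2) by auto
    show "\<forall>U\<in>?U - insert (A \<union> U0) ?V. chain_euler N I U = 0" using 0 by auto
  qed (use finN in auto)
  also have "\<dots> = chain_euler N I (A \<union> U0) + (\<Sum>U\<in>?V. chain_euler N I U)"
    using finN by (subst sum.insert) auto
  also have "\<dots> = 1" using chain_euler_rec[OF assms(1) assms(2)[OF AU] assms(2)] by simp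
  finally show ?case using chain_euler_rec[OF assms(1) AI assms(2)] by simp
qed

text \<open>\<open>A\<close> and \<open>c\<close> carry the union and the total weight of the blocks
  already passed. The last prefix, which is the whole ground set, is exempt because
  \<open>lam\<close> demands equality there.\<close>

fun dualc :: "('a \<Rightarrow> real) \<Rightarrow> 'a set \<Rightarrow> real \<Rightarrow> ('a set \<times> real) list \<Rightarrow> bool" where
  "dualc x A c [] \<longleftrightarrow> True"
| "dualc x A c ((B, w) # F) \<longleftrightarrow> (F \<noteq> [] \<longrightarrow> c + w < sum x (A \<union> B)) \<and> dualc x (A \<union> B) (c + w) F"

text \<open>Up to sign, the indicator function of the open cone cut out by the reversed strict
inequalities at the proper prefixes of \<open>F\<close>.\<close>

definition lam :: "'a set \<Rightarrow> ('a \<Rightarrow> real) \<Rightarrow> ('a set \<times> real) list \<Rightarrow> real" where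
  "lam I x F = (if x \<in> RI I \<and> sum x I = sum_list (map snd F) \<and> dualc x {} 0 F
     then (-1) ^ (length F - 1) else 0)"

text \<open>For a partition that fits \<open>P\<close> the running totals are values of the support
  function, so the strict inequalities say that the proper prefixes lie in the set of violated
  constraints.\<close>

lemma dualc_iff_nchain:
  assumes "fits P A F" "part (I - A) (map fst F)" "A \<subseteq> I"
  shows "dualc x A (hv P A) F \<longleftrightarrow> nchain {U. U \<subset> I \<and> ebounded U P \<and> hv P U < sum x U} I A (map fst F)"
  using assms
proof (induction F arbitrary: A)
  case Nil then show ?case by auto
next
  case (Cons p F)
  obtain B w where p: "p = (B, w)" by fastforce
  have AB: "ebounded (A \<union> B) P" "hv P A + w = hv P (A \<union> B)" "fits P (A \<union> B) F"
    "B \<noteq> {}" "B \<subseteq> I - A" "part (I - A - B) (map fst F)" using Cons.prems by (auto simp: p)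
  have e: "I - A - B = I - (A \<union> B)" by blast
  have "A \<union> B \<subset> I" if "F \<noteq> []"
  proof -
    have "I - (A \<union> B) \<noteq> {}" using that AB(6) unfolding e by (cases F) auto
    then show ?thesis using Cons.prems(3) AB(5) by blast
  qed
  then show ?case
    using Cons.IH[OF AB(3) AB(6)[unfolded e]] Cons.prems(3) AB by (auto simp: p)
qed

lemma nchain_fits:
  assumes "nchain {U. U \<subset> I \<and> ebounded U P \<and> hv P U < sum x U} I A Bs" "ebounded I P"
  shows "fits P A (wlist P A Bs)"
  using assms
proof (induction Bs arbitrary: A)
  case (Cons B Bs)
  then show ?case by (cases Bs) auto
qed simp

lemma indic_eq_sum_lam:
  assumes P: "egp I P"
  shows "indic P x = fsum (phi I P) (lam I x)"
proof -
  let ?X = "{F. phi I P F \<noteq> 0}"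
  have fs: "fsum (phi I P) (lam I x) = (\<Sum>F\<in>?X. lam I x F)"
    unfolding fsum_def by (rule sum.cong) (auto simp: phi_def)
  have finI: "finite I" using P by (rule egp_finite)
  note hv = egp_hv[OF P]
  show ?thesis
  proof (cases "x \<in> RI I \<and> sum x I = hv P I")
    case False
    have "lam I x F = 0" if "F \<in> ?X" for F
    proof -
      have "fits P {} F" "UF F = I" using that wosp_UF by (auto simp: phi_nonzero)
      then have "hv P I = sum_list (map snd F)" using fits_hv[of P "{}" F] hv(3) by simp
      then show ?thesis using False by (auto simp: lam_def)
    qed
    moreover have "x \<notin> P" using False egp_mem_iff[OF P] by blast
    ultimately show ?thesis unfolding fs by (simp add: indic_def)
  next
    case True
    define N where "N = {U. U \<subset> I \<and> ebounded U P \<and> hv P U < sum x U}"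
    have lamX: "lam I x F = (if nchain N I {} (map fst F) then (-1) ^ (length (map fst F) - 1) else 0)"
      if "F \<in> ?X" for F
    proof -
      have F: "fits P {} F" "UF F = I" "part I (map fst F)"
        using that wosp_UF by (auto simp: phi_nonzero wosp_iff_part)
      then have "hv P I = sum_list (map snd F)" using fits_hv[of P "{}" F] hv(3) by simp
      moreover have "dualc x {} 0 F \<longleftrightarrow> nchain N I {} (map fst F)"
        using dualc_iff_nchain[of P "{}" F I x] F hv(3) unfolding N_def by simp
      ultimately show ?thesis using True by (simp add: lam_def)
    qed
    \<comment> \<open>Weights are forced by the blocks, so a fitting partition is the same as its
      chain. Conversely, members of \<open>N\<close> are bounded on \<open>P\<close>, so every chain
      in \<open>N\<close> carries weights that fit.\<close>
    have bij: "bij_betw (map fst) {F\<in>?X. nchain N I {} (map fst F)} {Bs. nchain N I {} Bs}"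
    proof (rule bij_betwI[where g = "wlist P {}"])
      show "wlist P {} \<in> {Bs. nchain N I {} Bs} \<rightarrow> {F\<in>?X. nchain N I {} (map fst F)}"
      proof
        fix Bs assume "Bs \<in> {Bs. nchain N I {} Bs}"
        then have "nchain N I {} Bs" by simp
        then show "wlist P {} Bs \<in> {F\<in>?X. nchain N I {} (map fst F)}"
          using nchain_fits[of I P x "{}" Bs] nchain_part[of N I "{}" Bs] hv(2) finI
          by (simp add: phi_nonzero wosp_iff_part N_def[symmetric])
      qed
    qed (auto simp: phi_nonzero dest: fits_wlist[symmetric])
    have "(\<Sum>F\<in>?X. lam I x F) = (\<Sum>F\<in>{F\<in>?X. nchain N I {} (map fst F)}. (-1) ^ (length (map fst F) - 1))"
      using finite_phi[of I P] lamX by (subst sum.inter_filter) (auto intro!: sum.cong)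
    also have "\<dots> = chain_euler N I {}"
      unfolding chain_euler_def by (rule sum.reindex_bij_betw[OF bij])
    also have "\<dots> = indic P x"
    \<comment> \<open>The recursion for \<open>chain_euler\<close> starts from a proper subset of
      \<open>I\<close>, so the empty ground set is treated by hand.\<close>
    proof (cases "I = {}")
      case Ie: True
      have "{Bs. nchain N I {} Bs} = {[]}"
      proof -
        have "nchain N I {} Bs \<longleftrightarrow> Bs = []" for Bs using Ie by (cases Bs) auto
        then show ?thesis by auto
      qed
      then have "chain_euler N I {} = 1" by (simp add: chain_euler_def)
      moreover have "x \<in> P" using egp_mem_iff[OF P] True Ie hv(3) by auto
      ultimately show ?thesis by (simp add: indic_def)
    next
      case Ine: False
      have NI: "\<And>U. U \<in> N \<Longrightarrow> U \<subset> I" by (simp add: N_def)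
      have N0: "{} \<notin> N" using hv(3) by (simp add: N_def)
      show ?thesis
      proof (cases "N = {}")
        case Ne: True
        have "x \<in> P"
        proof (rule egp_memI[OF P])
          show "sum x A \<le> hv P A" if "A \<subseteq> I" "ebounded A P" for A
            using Ne that True unfolding N_def by (cases "A = I") (force simp: not_less)+
        qed (use True in auto)
        moreover have "chain_euler N I {} = 1"
          using chain_euler_rec[OF finI, of "{}" N] Ine Ne by auto
        ultimately show ?thesis by (simp add: indic_def)
      next
        case Nne: False
        note D = submodD[OF egp_submod(1)[OF P]]
        let ?g = "\<lambda>U. hv P U - sum x U"
        have "N \<subseteq> Pow I" using NI by blast
        then have finN: "finite N" using finI by (auto intro: finite_subset[of _ "Pow I"])
        have ND: "U \<in> pdom I P" if "U \<in> N" for U using that by (auto simp: N_def pdom_def)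
        obtain U0 where U0: "U0 \<in> N" "\<And>U. U \<in> N \<Longrightarrow> ?g U0 \<le> ?g U"
          using arg_min_if_finite(1)[OF finN Nne, of ?g] arg_min_least[OF finN Nne, of _ ?g] by blast
        \<comment> \<open>Minimality extends from \<open>N\<close> to all bounded sets because
          \<open>?g\<close> is nonnegative outside \<open>N\<close>. It is needed for the
          intersections \<open>V \<inter> U0\<close>, which may lie outside
          \<open>N\<close>.\<close>
        have U0': "?g U0 \<le> ?g U" if "U \<in> pdom I P" for U
        proof (cases "U \<in> N")
          case False
          have "?g U \<ge> 0" using False that True by (cases "U = I") (auto simp: N_def pdom_def)
          moreover have "?g U0 < 0" using U0(1) by (simp add: N_def)
          ultimately show ?thesis by simp
        qed (rule U0(2))
        \<comment> \<open>\<open>?g (V \<union> U0) \<le> ?g V + ?g U0 - ?g (V \<inter> U0) \<le> ?g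
          V < 0\<close>, by submodularity and minimality. The union is a proper subset because
          \<open>?g I = 0\<close>.\<close>
        have cl: "V \<union> U0 \<in> N" if V: "V \<in> N" for V
        proof -
          have f: "finite V" "finite U0" using V U0(1) NI finI by (meson finite_subset psubset_imp_subset)+
          have "sum x (V \<union> U0) + sum x (V \<inter> U0) = sum x V + sum x U0"
            by (rule sum.union_inter[OF f])
          moreover have "hv P (V \<union> U0) + hv P (V \<inter> U0) \<le> hv P V + hv P U0"
            by (rule D(10)[OF ND[OF V] ND[OF U0(1)]])
          moreover have "?g U0 \<le> ?g (V \<inter> U0)" by (rule U0'[OF D(9)[OF ND[OF V] ND[OF U0(1)]]])
          moreover have "?g V < 0" using V by (simp add: N_def)
          ultimately have "?g (V \<union> U0) < 0" by linarith
          moreover from this have "V \<union> U0 \<noteq> I" using True by auto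
          moreover have "V \<union> U0 \<in> pdom I P" by (rule D(8)[OF ND[OF V] ND[OF U0(1)]])
          ultimately show ?thesis by (auto simp: N_def pdom_def)
        qed
        \<comment> \<open>\<open>?g {} = 0\<close>, so the minimizer is not empty and the
          contraction argument applies to chains starting at \<open>{}\<close>.\<close>
        have "\<not> U0 \<subseteq> {}" using U0(1) N0 by auto
        then have "chain_euler N I {} = 0"
          using chain_euler_contractible[OF finI NI U0(1) cl, of "{}"] by simp
        moreover have "x \<notin> P"
        proof
          assume "x \<in> P"
          then have "sum x U0 \<le> hv P U0" using hv(4) ND[OF U0(1)] by (simp add: pdom_def)
          then show False using U0(1) by (simp add: N_def)
        qed
        ultimately show ?thesis by (simp add: indic_def)
      qed
    qed
    finally show ?thesis unfolding fs by simp
  qed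
qed

section \<open>The linear maps from polyhedra to ordered set partitions and on to indicator
  functions\<close>

definition Phi :: "'a set \<Rightarrow> (('a \<Rightarrow> real) set \<Rightarrow> real) \<Rightarrow> (('a set \<times> real) list \<Rightarrow> real)" where
  "Phi I f = (\<lambda>F. fsum f (\<lambda>P. phi I P F))"

definition psi :: "'a set \<Rightarrow> (('a set \<times> real) list \<Rightarrow> real) \<Rightarrow> (('a \<Rightarrow> real) \<Rightarrow> real)" where
  "psi I a = (\<lambda>x. fsum a (lam I x))"

lemma gp_comp_lspan: "gp_comp I = lspan (basisv ` {P. egp I P})"
  by (simp add: gp_comp_eq fsupp_eq_lspan)

lemma fsubspace_gp_comp: "fsubspace (gp_comp I)" and fsubspace_w_comp: "fsubspace (w_comp I)"
  by (simp_all add: gp_comp_eq w_comp_eq fsubspace_fsupp)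

lemma linear_on_Phi: "linear_on (gp_comp I) (Phi I)"
  unfolding gp_comp_eq Phi_def by (rule linear_on_fsum)

lemma linear_on_psi: "linear_on (w_comp I) (psi I)"
  unfolding w_comp_eq psi_def by (rule linear_on_fsum)

lemma indf_eq_fsum: "indf I f = (\<lambda>x. fsum f (\<lambda>P. indic P x))"
  by (simp add: indf_def fsum_def indic_def)

lemma linear_on_indf: "linear_on (gp_comp I) (indf I)"
  unfolding gp_comp_eq indf_eq_fsum by (rule linear_on_fsum)

lemma Phi_basisv [simp]: "Phi I (basisv P) = phi I P"
  by (simp add: Phi_def)

lemma indf_basisv [simp]: "indf I (basisv P) = indic P"
  by (simp add: indf_eq_fsum)

lemma Phi_in_w_comp:
  assumes "f \<in> gp_comp I" shows "Phi I f \<in> w_comp I"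
proof -
  have "Phi I ` lspan (basisv ` {P. egp I P}) \<subseteq> w_comp I"
    by (rule linear_on_image_subset[OF linear_on_Phi[of I, unfolded gp_comp_lspan] fsubspace_w_comp])
      (auto simp: phi_in_w_comp)
  then show ?thesis using assms unfolding gp_comp_lspan by blast
qed

lemma psi_phi: "egp I P \<Longrightarrow> psi I (phi I P) = indic P"
  using indic_eq_sum_lam[of I P] by (auto simp: psi_def)

text \<open>The map to indicator functions factors through \<open>Phi\<close>, so the kernel of
  \<open>Phi\<close> lies in \<open>ie\<close>. The converse is \<open>Phi_eq_0\<close>.\<close>

lemma indf_eq_psi_Phi:
  assumes "f \<in> gp_comp I" shows "indf I f = psi I (Phi I f)"
proof (rule linear_on_lspan_eq[where A = "basisv ` {P. egp I P}"])
  show "linear_on (lspan (basisv ` {P. egp I P})) (indf I)"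
    using linear_on_indf[of I] by (simp add: gp_comp_lspan)
  show "linear_on (lspan (basisv ` {P. egp I P})) (\<lambda>f. psi I (Phi I f))"
    using linear_on_comp[OF linear_on_Phi linear_on_psi Phi_in_w_comp, of I] by (simp add: gp_comp_lspan)
qed (use assms psi_phi[symmetric] in \<open>auto simp: gp_comp_lspan\<close>)

section \<open>Linear relations among indicator functions\<close>

lemma UF_map_fst: "UF F = \<Union> (set (map fst F))"
  by (simp add: UF_def)

text \<open>Refines the ordered partition to a linear order of the ground set, along which the
  greedy algorithm can run.\<close>

lemma wosp_enumeration:
  assumes "wosp I F"
  shows "\<exists>xs. distinct xs \<and> set xs = I \<and> (\<forall>j. \<exists>k. UF (take j F) = set (take k xs))"
proof -
  have "finite I \<Longrightarrow> part I (map fst F) \<Longrightarrow> ?thesis"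
  proof (induction F arbitrary: I)
    case (Cons p F)
    then have p: "fst p \<noteq> {}" "fst p \<subseteq> I" "part (I - fst p) (map fst F)" "finite (I - fst p)" by auto
    obtain xs where xs: "distinct xs" "set xs = I - fst p" "\<And>j. \<exists>k. UF (take j F) = set (take k xs)"
      using Cons.IH[OF p(4,3)] by blast
    obtain ys where ys: "distinct ys" "set ys = fst p"
      using finite_distinct_list finite_subset[OF p(2) Cons.prems(1)] by metis
    have "\<exists>k. UF (take j (p # F)) = set (take k (ys @ xs))" for j
    proof (cases j)
      case 0 then show ?thesis by (intro exI[of _ 0]) simp
    next
      case (Suc i)
      obtain k where "UF (take i F) = set (take k xs)" using xs(3) by blast
      then show ?thesis using Suc ys(2) by (intro exI[of _ "length ys + k"]) simp
    qed
    moreover have "distinct (ys @ xs)" "set (ys @ xs) = I" using xs ys p(2) by auto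
    ultimately show ?case by blast
  qed simp
  then show ?thesis using assms wosp_iff_part by blast
qed

text \<open>One greedy point attains the support function at all bounded prefixes simultaneously. At
  the unbounded ones it exceeds the largest threshold \<open>M\<close>, so only the bounded prefixes
  impose conditions.\<close>

lemma prefix_halfspaces_meet_iff:
  assumes P: "egp I P" and F: "wosp I F"
  shows "(\<exists>x\<in>P. \<forall>j\<le>length F. b j \<le> sum x (UF (take j F))) \<longleftrightarrow>
    (\<forall>j\<le>length F. ebounded (UF (take j F)) P \<longrightarrow> b j \<le> hv P (UF (take j F)))"
proof -
  have sub: "UF (take j F) \<subseteq> I" for j
    using wosp_UF[OF F] set_take_subset[of j F] unfolding UF_def by blast
  show ?thesis
  proof
    assume "\<exists>x\<in>P. \<forall>j\<le>length F. b j \<le> sum x (UF (take j F))"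
    then show "\<forall>j\<le>length F. ebounded (UF (take j F)) P \<longrightarrow> b j \<le> hv P (UF (take j F))"
      using egp_hv(4)[OF P _ sub] order_trans by blast
  next
    assume h: "\<forall>j\<le>length F. ebounded (UF (take j F)) P \<longrightarrow> b j \<le> hv P (UF (take j F))"
    obtain xs where xs: "distinct xs" "set xs = I" "\<And>j. \<exists>k. UF (take j F) = set (take k xs)"
      using wosp_enumeration[OF F] by blast
    define M where "M = Max (b ` {..length F})"
    have M: "b j \<le> M" if "j \<le> length F" for j unfolding M_def using that by auto
    obtain x where x: "x \<in> P" and xk: "\<And>k. let U = set (take k xs) in
        (U \<in> pdom I P \<longrightarrow> sum x U = hv P U) \<and> (U \<notin> pdom I P \<longrightarrow> sum x U \<ge> M)"
      using bpoly_chain_point[OF egp_submod(1)[OF P] xs(1,2), folded egp_submod(2)[OF P], of M] by blast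
    have "b j \<le> sum x (UF (take j F))" if "j \<le> length F" for j
    proof -
      obtain k where k: "UF (take j F) = set (take k xs)" using xs(3) by blast
      show ?thesis
      proof (cases "ebounded (UF (take j F)) P")
        case True
        then have "sum x (UF (take j F)) = hv P (UF (take j F))"
          using xk[of k] sub[of j] unfolding k[symmetric] by (simp add: Let_def pdom_def)
        then show ?thesis using h True that by simp
      next
        case False
        then have "sum x (UF (take j F)) \<ge> M"
          using xk[of k] unfolding k[symmetric] by (simp add: Let_def pdom_def)
        then show ?thesis using M[OF that] by simp
      qed
    qed
    then show "\<exists>x\<in>P. \<forall>j\<le>length F. b j \<le> sum x (UF (take j F))" using x by blast
  qed
qed

lemma Phi_eq_0:
  assumes f: "f \<in> gp_comp I" and ind: "indf I f = (\<lambda>_. 0)"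
  shows "Phi I f = (\<lambda>_. 0)"
proof
  fix F
  show "Phi I f F = 0"
  proof (cases "wosp I F")
    case False
    then show ?thesis by (simp add: Phi_def phi_def)
  next
    case F: True
    let ?N = "{P. f P \<noteq> 0}" and ?C = "{..length F}"
    let ?u = "\<lambda>j. UF (take j F)" and ?c = "\<lambda>j. sum_list (map snd (take j F))"
    have fin: "finite ?N" and egp: "\<And>P. P \<in> ?N \<Longrightarrow> egp I P" using f by (auto simp: gp_comp_def)
    \<comment> \<open>Smallest positive excess of a support value over the prescribed weight, among
      the finitely many polyhedra and prefixes involved. Raising a threshold by \<open>E\<close>
      therefore excludes exact equality and no larger value.\<close>
    define E where "E = Min (insert 1 {v. v > 0 \<and> (\<exists>P\<in>?N. \<exists>j\<in>?C. v = hv P (?u j) - ?c j)})"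
    have finE: "finite {v. v > 0 \<and> (\<exists>P\<in>?N. \<exists>j\<in>?C. v = hv P (?u j) - ?c j)}"
    proof (rule finite_subset)
      show "{v. v > 0 \<and> (\<exists>P\<in>?N. \<exists>j\<in>?C. v = hv P (?u j) - ?c j)} \<subseteq> (\<lambda>(P, j). hv P (?u j) - ?c j) ` (?N \<times> ?C)"
        by auto
    qed (use fin in auto)
    have E0: "E > 0" unfolding E_def using finE by (subst Min_gr_iff) auto
    have E: "?c j + E \<le> hv P (?u j)" if "P \<in> ?N" "j \<in> ?C" "?c j < hv P (?u j)" for P j
    proof -
      have "E \<le> hv P (?u j) - ?c j" unfolding E_def
        by (rule Min_le) (use finE that in auto)
      then show ?thesis by simp
    qed
    \<comment> \<open>\<open>g0 - g1\<close> is the indicator of a bounded prefix with exact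
      equality. At an unbounded prefix both are 1 and cancel.\<close>
    define g0 g1 :: "('a \<Rightarrow> real) set \<Rightarrow> nat \<Rightarrow> real" where
      "g0 P j = (if ebounded (?u j) P \<longrightarrow> ?c j \<le> hv P (?u j) then 1 else 0)" and
      "g1 P j = (if ebounded (?u j) P \<longrightarrow> ?c j + E \<le> hv P (?u j) then 1 else 0)" for P j
    \<comment> \<open>A choice \<open>X\<close> of the prefixes with raised threshold describes one
      intersection of closed halfspaces. By \<open>prefix_halfspaces_meet_iff\<close> the product of
      indicators says that \<open>P\<close> meets it, and the Euler relation applies.\<close>
    have zero: "(\<Sum>P\<in>?N. f P * ((\<Prod>j\<in>X. g1 P j) * (\<Prod>j\<in>?C - X. g0 P j))) = 0" if X: "X \<in> Pow ?C" for X
    proof -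
      let ?b = "\<lambda>j. if j \<in> X then ?c j + E else ?c j"
      have "(\<Prod>j\<in>X. g1 P j) * (\<Prod>j\<in>?C - X. g0 P j) = (if \<exists>x\<in>P. \<forall>j\<in>?C. ?b j \<le> sum x (?u j) then 1 else 0)"
        if P: "P \<in> ?N" for P
      proof -
        let ?g = "\<lambda>j. if ebounded (?u j) P \<longrightarrow> ?b j \<le> hv P (?u j) then 1 else (0::real)"
        have "(\<Prod>j\<in>X. g1 P j) * (\<Prod>j\<in>?C - X. g0 P j) = (\<Prod>j\<in>X. ?g j) * (\<Prod>j\<in>?C - X. ?g j)"
          by (intro arg_cong2[of _ _ _ _ "(*)"] prod.cong) (auto simp: g0_def g1_def)
        also have "\<dots> = (\<Prod>j\<in>?C. ?g j)"
          using X prod.subset_diff[of X ?C ?g] by (simp add: mult.commute)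
        also have "\<dots> = (if \<forall>j\<in>?C. ebounded (?u j) P \<longrightarrow> ?b j \<le> hv P (?u j) then 1 else 0)"
          by (auto intro: prod.neutral)
        also have "(\<forall>j\<in>?C. ebounded (?u j) P \<longrightarrow> ?b j \<le> hv P (?u j)) \<longleftrightarrow> (\<exists>x\<in>P. \<forall>j\<in>?C. ?b j \<le> sum x (?u j))"
          using prefix_halfspaces_meet_iff[OF egp[OF P] F, of ?b] by (simp only: Ball_def atMost_iff)
        finally show ?thesis .
      qed
      then have "(\<Sum>P\<in>?N. f P * ((\<Prod>j\<in>X. g1 P j) * (\<Prod>j\<in>?C - X. g0 P j)))
          = (\<Sum>P\<in>?N. if \<exists>x\<in>P. \<forall>j\<in>?C. ?b j \<le> sum x (?u j) then f P else 0)"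
        by (intro sum.cong) auto
      then show ?thesis using euler_egp[OF f ind, of ?C ?b ?u] by simp
    qed
    have phi: "phi I P F = (\<Sum>X\<in>Pow ?C. (-1) ^ card X * ((\<Prod>j\<in>X. g1 P j) * (\<Prod>j\<in>?C - X. g0 P j)))"
      if P: "P \<in> ?N" for P
    proof -
      have "phi I P F = (if \<forall>j\<in>?C. ebounded (?u j) P \<and> hv P (?u j) = ?c j then 1 else 0)"
        using fits_iff_take[of "{}" P F] egp_hv(1,3)[OF egp[OF P]] F by (simp add: phi_def Ball_def)
      also have "\<dots> = (\<Prod>j\<in>?C. if ebounded (?u j) P \<and> hv P (?u j) = ?c j then 1 else 0)"
        by (auto intro: prod.neutral)
      also have "\<dots> = (\<Prod>j\<in>?C. - g1 P j + g0 P j)"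
      proof (rule prod.cong[OF refl])
        fix j assume j: "j \<in> ?C"
        show "(if ebounded (?u j) P \<and> hv P (?u j) = ?c j then 1 else 0) = - g1 P j + g0 P j"
          using E[OF P j] E0 by (cases "?c j < hv P (?u j)") (auto simp: g0_def g1_def)
      qed
      also have "\<dots> = (\<Sum>X\<in>Pow ?C. (\<Prod>j\<in>X. - g1 P j) * (\<Prod>j\<in>?C - X. g0 P j))"
        by (rule prod_add) simp
      also have "\<dots> = (\<Sum>X\<in>Pow ?C. (-1) ^ card X * ((\<Prod>j\<in>X. g1 P j) * (\<Prod>j\<in>?C - X. g0 P j)))"
        by (simp add: prod_uminus mult.assoc)
      finally show ?thesis .
    qed
    have "Phi I f F = (\<Sum>P\<in>?N. f P * (\<Sum>X\<in>Pow ?C. (-1) ^ card X * ((\<Prod>j\<in>X. g1 P j) * (\<Prod>j\<in>?C - X. g0 P j))))"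
      unfolding Phi_def fsum_def using phi by (intro sum.cong) auto
    also have "\<dots> = (\<Sum>P\<in>?N. \<Sum>X\<in>Pow ?C. (-1) ^ card X * (f P * ((\<Prod>j\<in>X. g1 P j) * (\<Prod>j\<in>?C - X. g0 P j))))"
      by (simp add: sum_distrib_left mult.left_commute)
    also have "\<dots> = (\<Sum>X\<in>Pow ?C. \<Sum>P\<in>?N. (-1) ^ card X * (f P * ((\<Prod>j\<in>X. g1 P j) * (\<Prod>j\<in>?C - X. g0 P j))))"
      by (rule sum.swap)
    also have "\<dots> = (\<Sum>X\<in>Pow ?C. (-1) ^ card X * 0)"
      by (rule sum.cong[OF refl]) (simp only: sum_distrib_left[symmetric] zero)
    finally show ?thesis by simp
  qed
qed

section \<open>Surjectivity by triangularity\<close>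

text \<open>If all prefixes of \<open>Cs\<close> are prefixes of \<open>Bs\<close>, each block of
  \<open>Cs\<close> is a union of consecutive blocks of \<open>Bs\<close>. Either nothing is merged
  or the list gets shorter. The induction strips the first block of \<open>Cs\<close> together with
  the blocks of \<open>Bs\<close> it consists of.\<close>

lemma part_prefixes_eq:
  assumes "part J Bs" "part J Cs"
    and "\<And>j. \<exists>k\<le>length Bs. \<Union> (set (take j Cs)) = \<Union> (set (take k Bs))"
  shows "Cs = Bs \<or> length Cs < length Bs"
  using assms
proof (induction Bs arbitrary: J Cs rule: length_induct)
  case (1 Bs)
  show ?case
  proof (cases Cs)
    case Nil
    then show ?thesis using 1(2,3) by (cases Bs) auto
  next
    case (Cons C Ds)
    obtain k where k: "k \<le> length Bs" "C = \<Union> (set (take k Bs))" using 1(4)[of 1] Cons by auto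
    have C: "C \<noteq> {}" "C \<subseteq> J" "part (J - C) Ds" using 1(3) Cons by auto
    have k1: "k \<ge> 1" using k C(1) by (cases k) auto
    have p: "part (J - C) (drop k Bs)"
      using 1(2) part_append[of J "take k Bs" "drop k Bs"] k by simp
    have "\<exists>l\<le>length (drop k Bs). \<Union> (set (take j Ds)) = \<Union> (set (take l (drop k Bs)))" for j
    proof -
      obtain l where l: "l \<le> length Bs" "C \<union> \<Union> (set (take j Ds)) = \<Union> (set (take l Bs))"
        using 1(4)[of "Suc j"] Cons by auto
      have "\<Union> (set (take j Ds)) \<subseteq> J - C"
        using part_Union[OF C(3)] set_take_subset[of j Ds] by blast
      then have e: "\<Union> (set (take j Ds)) = \<Union> (set (take l Bs)) - C" using l by blast
      have d: "\<Union> (set (take (l - k) (drop k Bs))) \<subseteq> J - C"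
        using part_Union[OF p] set_take_subset[of "l - k" "drop k Bs"] by blast
      show ?thesis
      proof (cases "k \<le> l")
        case True
        then have "take l Bs = take k Bs @ take (l - k) (drop k Bs)"
          by (metis le_add_diff_inverse take_add)
        then have "\<Union> (set (take l Bs)) = C \<union> \<Union> (set (take (l - k) (drop k Bs)))" using k by simp
        then show ?thesis using e d l(1) by (intro exI[of _ "l - k"]) auto
      next
        case False
        then have "\<Union> (set (take l Bs)) \<subseteq> C"
          using k(2) set_take_subset_set_take[of l k Bs] by auto
        then show ?thesis using e by (intro exI[of _ 0]) auto
      qed
    qed
    then have "Ds = drop k Bs \<or> length Ds < length (drop k Bs)"
      using 1(1) k1 k(1) p C(3) by (metis One_nat_def diff_less dual_order.strict_trans1 length_drop less_le_trans zero_less_one)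
    moreover have "Cs = Bs" if "k = 1" "Ds = drop k Bs"
      using that k k1 Cons by (cases Bs) auto
    ultimately show ?thesis using k1 k(1) Cons by (cases "k = 1") auto
  qed
qed

text \<open>The whole weight of each block is placed on one of its elements. The point serves to
  translate the cone in \<open>cone_phi\<close>.\<close>

lemma block_point:
  assumes "finite I" "part I (map fst F)"
  shows "\<exists>x :: 'a \<Rightarrow> real. \<forall>(B, w)\<in>set F. sum x B = w"
  using assms
proof (induction F arbitrary: I)
  case (Cons p F)
  obtain B w where p: "p = (B, w)" by fastforce
  have B: "B \<noteq> {}" "B \<subseteq> I" "part (I - B) (map fst F)" using Cons.prems by (auto simp: p)
  obtain x where x: "\<forall>(B, w)\<in>set F. sum x B = w" using Cons.IH[of "I - B"] Cons.prems(1) B by auto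
  obtain b where b: "b \<in> B" using B by blast
  define y where "y i = (if i \<in> B then (if i = b then w else 0) else x i)" for i
  have finB: "finite B" using B(2) Cons.prems(1) by (rule finite_subset)
  have "sum y B = (\<Sum>i\<in>B. if i = b then w else 0)" by (rule sum.cong) (auto simp: y_def)
  then have "sum y B = w" using finB b by simp
  moreover have "sum y C = v" if "(C, v) \<in> set F" for C v
  proof -
    have "C \<subseteq> I - B" using part_Union[OF B(3)] that by force
    then have "sum y C = sum x C" by (intro sum.cong) (auto simp: y_def)
    then show ?thesis using x that by auto
  qed
  ultimately show ?case using p by (intro exI[of _ y]) auto
qed auto

lemma sum_UF_take:
  fixes x :: "'a \<Rightarrow> real"
  assumes "finite I" "part I (map fst F)" "\<forall>(B, w)\<in>set F. sum x B = w"
  shows "sum x (UF (take j F)) = sum_list (map snd (take j F))"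
  using assms
proof (induction F arbitrary: I j)
  case (Cons p F)
  show ?case
  proof (cases j)
    case (Suc i)
    have p: "fst p \<subseteq> I" "part (I - fst p) (map fst F)" "sum x (fst p) = snd p" using Cons.prems by auto
    have s: "UF (take i F) \<subseteq> I - fst p"
      using part_Union[OF p(2)] set_take_subset[of i F] unfolding UF_def by auto
    have "sum x (fst p \<union> UF (take i F)) = sum x (fst p) + sum x (UF (take i F))"
      using s p(1) Cons.prems(1) by (intro sum.union_disjoint) (auto intro: finite_subset)
    then show ?thesis using Suc Cons.IH[of "I - fst p" i] Cons.prems p by auto
  qed simp
qed simp

text \<open>\<open>P\<close> is the translate by \<open>x\<close> of the cone of points with total 0
  and nonpositive sum over each prefix of \<open>F\<close>. The sum of coordinates of
  \<open>x\<close> is modular, and prefixes form a chain, so submodularity is immediate. Only prefix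
  unions are bounded on \<open>P\<close>, so a partition that fits \<open>P\<close> is
  \<open>F\<close> or a proper coarsening of it.\<close>

lemma cone_phi:
  assumes F: "wosp I F"
  obtains P where "egp I P" "phi I P F = 1"
    "\<And>G. phi I P G \<noteq> 0 \<Longrightarrow> G = F \<or> length G < length F"
proof -
  have fin: "finite I" and part: "part I (map fst F)" using F by (auto simp: wosp_iff_part)
  obtain x :: "'a \<Rightarrow> real" where x: "\<forall>(B, w)\<in>set F. sum x B = w" using block_point[OF fin part] by blast
  let ?u = "\<lambda>j. UF (take j F)"
  define D where "D = ?u ` {..length F}"
  have sub: "?u j \<subseteq> I" for j
    using wosp_UF[OF F] set_take_subset[of j F] unfolding UF_def by blast
  have chain: "?u j \<subseteq> ?u k" if "j \<le> k" for j k
    using set_take_subset_set_take[OF that, of F] unfolding UF_def by blast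
  have sm: "submod I D (sum x)"
    unfolding submod_def
  proof (intro conjI ballI)
    fix A B assume AB: "A \<in> D" "B \<in> D"
    then obtain j k where "A = ?u j" "B = ?u k" unfolding D_def by blast
    then have "A \<subseteq> B \<or> B \<subseteq> A" using chain[of j k] chain[of k j] by (cases "j \<le> k") auto
    then have "(A \<union> B = B \<and> A \<inter> B = A) \<or> (A \<union> B = A \<and> A \<inter> B = B)" by blast
    then show "A \<union> B \<in> D" "A \<inter> B \<in> D" "sum x (A \<union> B) + sum x (A \<inter> B) \<le> sum x A + sum x B"
      using AB by auto
  next
    show "{} \<in> D" unfolding D_def by (rule image_eqI[of _ _ 0]) auto
    show "I \<in> D" unfolding D_def by (rule image_eqI[of _ _ "length F"]) (use wosp_UF[OF F] in auto)
  qed (use fin sub in \<open>auto simp: D_def\<close>)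
  define P where "P = bpoly I D (sum x)"
  have egp: "egp I P" unfolding P_def by (rule egp_bpoly[OF sm])
  have eb: "ebounded A P \<longleftrightarrow> A \<in> D" if "A \<subseteq> I" for A
    unfolding P_def by (rule ebounded_bpoly[OF sm that])
  have hv: "hv P A = sum x A" if "A \<in> D" for A unfolding P_def by (rule hv_bpoly[OF sm that])
  have uD: "?u j \<in> D" if "j \<le> length F" for j using that by (auto simp: D_def)
  have fits: "fits P {} F"
    using fits_iff_take[OF egp_hv(1)[OF egp], of F] eb[OF sub] hv[OF uD] uD egp_hv(3)[OF egp]
      sum_UF_take[OF fin part x] by simp
  have "G = F \<or> length G < length F" if "phi I P G \<noteq> 0" for G
  proof -
    have G: "wosp I G" "fits P {} G" using that by (auto simp: phi_nonzero)
    have "\<exists>k\<le>length (map fst F). \<Union> (set (take j (map fst G))) = \<Union> (set (take k (map fst F)))" for j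
    proof -
      have "UF (take j G) \<subseteq> I"
        using wosp_UF[OF G(1)] set_take_subset[of j G] unfolding UF_def by blast
      moreover have "ebounded (UF (take j G)) P"
        using fits_append[of P "{}" "take j G" "drop j G"] fits_ebounded[of P "{}" "take j G"]
          G(2) egp_hv(1)[OF egp] by simp
      ultimately have "UF (take j G) \<in> D" using eb by blast
      then show ?thesis unfolding D_def UF_map_fst by (auto simp: take_map)
    qed
    then have "map fst G = map fst F \<or> length G < length F"
      using part_prefixes_eq[OF part, of "map fst G"] G(1) by (simp add: wosp_iff_part)
    then show ?thesis using fits_wlist[OF fits] fits_wlist[OF G(2)] by metis
  qed
  moreover have "phi I P F = 1" using F fits by (simp add: phi_def)
  ultimately show thesis using that egp by blast
qed

lemma basisv_in_gp_comp: "egp I P \<Longrightarrow> basisv P \<in> gp_comp I"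
  by (simp add: gp_comp_eq basisv_in_fsupp)

text \<open>Induction on the number of blocks: \<open>Phi\<close> of the cone of \<open>F\<close> is
  \<open>basisv F\<close> plus basis vectors of strictly shorter partitions.\<close>

lemma Phi_surj: "Phi I ` gp_comp I = w_comp I"
proof
  show "Phi I ` gp_comp I \<subseteq> w_comp I" using Phi_in_w_comp by blast
  have sub: "fsubspace (Phi I ` gp_comp I)"
    by (rule fsubspace_image[OF linear_on_Phi fsubspace_gp_comp])
  have "basisv F \<in> Phi I ` gp_comp I" if "wosp I F" for F
    using that
  proof (induction F rule: length_induct)
    case (1 F)
    obtain P where P: "egp I P" "phi I P F = 1"
      and small: "\<And>G. phi I P G \<noteq> 0 \<Longrightarrow> G = F \<or> length G < length F"
      using cone_phi[OF 1(2)] by metis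
    let ?X = "{G. phi I P G \<noteq> 0} - {F}"
    have "phi I P \<in> Phi I ` gp_comp I"
      using basisv_in_gp_comp[OF P(1)] Phi_basisv[of I P] by (metis imageI)
    moreover have "(\<lambda>G. \<Sum>H\<in>?X. (-1) * basisv H G) \<in> Phi I ` gp_comp I"
      by (rule fsubspace_sum[OF sub]) (use small 1(1) in \<open>auto simp: phi_nonzero\<close>)
    ultimately have "(\<lambda>G. phi I P G + (\<Sum>H\<in>?X. (-1) * basisv H G)) \<in> Phi I ` gp_comp I"
      by (rule fsubspace_add[OF sub])
    moreover have "phi I P G + (\<Sum>H\<in>?X. (-1) * basisv H G) = basisv F G" for G
    proof -
      have "(\<Sum>H\<in>?X. (-1) * basisv H G) = (if G \<in> ?X then -1 else 0)"
        using finite_phi[of I P] by (simp add: basisv_def sum_negf)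
      then show ?thesis using P(2) by (auto simp: basisv_def phi_def)
    qed
    ultimately show ?case by (simp only:)
  qed
  then show "w_comp I \<subseteq> Phi I ` gp_comp I"
    unfolding w_comp_eq fsupp_eq_lspan by (intro lspan_minimal[OF sub]) auto
qed

text \<open>By surjectivity both arguments lift to combinations of polyhedra. Their difference has
  zero indicator function, hence is killed by \<open>Phi\<close>. This is what allows
  \<open>psi\<close> to be inverted.\<close>

lemma psi_inj: "inj_on (psi I) (w_comp I)"
proof (rule inj_onI)
  fix a b assume ab: "a \<in> w_comp I" "b \<in> w_comp I" "psi I a = psi I b"
  obtain f g where f: "f \<in> gp_comp I" "a = Phi I f" and g: "g \<in> gp_comp I" "b = Phi I g"
    using ab Phi_surj by (metis imageE)
  let ?h = "\<lambda>P. 1 * f P + (-1) * g P"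
  have h: "?h \<in> gp_comp I" by (rule fsubspace_lincomb[OF fsubspace_gp_comp f(1) g(1)])
  have "indf I ?h = (\<lambda>x. 1 * indf I f x + (-1) * indf I g x)"
    by (rule linear_onD[OF linear_on_indf f(1) g(1)])
  then have "indf I ?h = (\<lambda>_. 0)"
    using ab(3) f(2) g(2) indf_eq_psi_Phi[OF f(1)] indf_eq_psi_Phi[OF g(1)] by simp
  then have "Phi I ?h = (\<lambda>_. 0)" by (rule Phi_eq_0[OF h])
  moreover have "Phi I ?h = (\<lambda>x. 1 * Phi I f x + (-1) * Phi I g x)"
    by (rule linear_onD[OF linear_on_Phi f(1) g(1)])
  ultimately have "(\<lambda>x. Phi I f x - Phi I g x) = (\<lambda>_. 0)" by simp
  then show "a = b" using f g by (simp add: fun_eq_iff)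
qed

section \<open>Compatibility with relabelling, products and coproducts\<close>

lemma fsum_single:
  assumes "finite {P. f P \<noteq> 0}" "\<And>P. f P \<noteq> 0 \<Longrightarrow> P \<noteq> P0 \<Longrightarrow> k P = 0"
  shows "fsum f k = f P0 * k P0"
proof -
  have "fsum f k = (\<Sum>P\<in>insert P0 {P. f P \<noteq> 0}. f P * k P)"
    using assms(1) by (intro fsum_superset) auto
  also have "\<dots> = (\<Sum>P\<in>insert P0 {P. f P \<noteq> 0}. if P = P0 then f P0 * k P0 else 0)"
    by (rule sum.cong) (use assms(2) in auto)
  finally show ?thesis using assms(1) by simp
qed

section \<open>Relabelling of ordered set partitions\<close>

lemma part_image:
  assumes "inj_on \<sigma> J" "I \<subseteq> J" "\<Union> (set Bs) \<subseteq> J"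
  shows "part (\<sigma> ` I) (map ((`) \<sigma>) Bs) \<longleftrightarrow> part I Bs"
  using assms(2,3)
proof (induction Bs arbitrary: I)
  case (Cons B Bs)
  have "\<sigma> ` B \<subseteq> \<sigma> ` I \<longleftrightarrow> B \<subseteq> I"
  proof
    assume h: "\<sigma> ` B \<subseteq> \<sigma> ` I"
    show "B \<subseteq> I"
    proof
      fix i assume "i \<in> B"
      then obtain j where "j \<in> I" "\<sigma> i = \<sigma> j" using h by blast
      then show "i \<in> I" using inj_onD[OF assms(1), of i j] \<open>i \<in> B\<close> Cons.prems by auto
    qed
  qed auto
  moreover have "\<sigma> ` I - \<sigma> ` B = \<sigma> ` (I - B)"
    using inj_on_image_set_diff[OF assms(1), of I B] Cons.prems by auto
  moreover have "part (\<sigma> ` (I - B)) (map ((`) \<sigma>) Bs) \<longleftrightarrow> part (I - B) Bs"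
    using Cons.IH[of "I - B"] Cons.prems by auto
  ultimately show ?case by simp
qed auto

lemma fits_ppush:
  assumes P: "egp I P" and inj: "inj_on \<sigma> I" and "A \<union> UF F \<subseteq> I" "ebounded A P"
  shows "fits (ppush \<sigma> I P) (\<sigma> ` A) (map (\<lambda>(B, w). (\<sigma> ` B, w)) F) \<longleftrightarrow> fits P A F"
  using assms(3,4)
proof (induction F arbitrary: A)
  case (Cons p F)
  obtain B w where p: "p = (B, w)" by fastforce
  have s: "A \<union> B \<subseteq> I" "A \<union> B \<union> UF F \<subseteq> I" "A \<subseteq> I" using Cons.prems(1) by (auto simp: p)
  have e: "\<sigma> ` A \<union> \<sigma> ` B = \<sigma> ` (A \<union> B)" by (simp add: image_Un)
  show ?case
  proof (cases "ebounded (A \<union> B) P")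
    case True
    then show ?thesis
      using Cons.IH[OF s(2) True] hv_ppush[OF P inj s(1) True] hv_ppush[OF P inj s(3) Cons.prems(2)]
        ebounded_ppush[OF P inj s(1)] by (simp add: p e)
  next
    case False
    then show ?thesis using ebounded_ppush[OF P inj s(1)] by (simp add: p e)
  qed
qed simp

lemma WSigma_hrel_phi:
  assumes P: "egp I P" and inj: "inj_on \<sigma> I"
  shows "hrel WSigma \<sigma> I (phi I P) = phi (\<sigma> ` I) (ppush \<sigma> I P)"
proof
  fix G :: "('a set \<times> real) list"
  let ?r = "map (\<lambda>(B, w). (\<sigma> ` B, w))"
  \<comment> \<open>The only partition of \<open>I\<close> that can be carried to \<open>G\<close>:
    its blocks are the preimages of the blocks of \<open>G\<close>.\<close>
  define F0 where "F0 = map (\<lambda>(B, w). ({i\<in>I. \<sigma> i \<in> B}, w)) G"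
  have finI: "finite I" using P by (rule egp_finite)
  have "hrel WSigma \<sigma> I (phi I P) G = fsum (phi I P) (\<lambda>F. if ?r F = G then 1 else 0)"
    unfolding WSigma_def using sum_indicator_eq_fsum[OF finite_phi] by simp
  also have "\<dots> = phi I P F0 * (if ?r F0 = G then 1 else 0)"
  proof (rule fsum_single[OF finite_phi])
    fix F assume F: "phi I P F \<noteq> 0" "F \<noteq> F0"
    have "F = F0" if "?r F = G"
    proof -
      have "UF F = I" using F(1) wosp_UF by (auto simp: phi_nonzero)
      then have "{i\<in>I. \<sigma> i \<in> \<sigma> ` B} = B" if "(B, w) \<in> set F" for B w
        using inj that unfolding UF_def by (force dest: inj_onD)
      then have "map (\<lambda>(B, w). ({i\<in>I. \<sigma> i \<in> \<sigma> ` B}, w)) F = F"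
        by (intro map_idI) auto
      then show ?thesis using that by (auto simp: F0_def comp_def case_prod_unfold)
    qed
    then show "(if ?r F = G then 1 else 0) = (0::real)" using F(2) by auto
  qed
  also have "\<dots> = phi (\<sigma> ` I) (ppush \<sigma> I P) G"
  proof (cases "?r F0 = G")
    case True
    have sub: "UF F0 \<subseteq> I" unfolding F0_def UF_def by auto
    have "map fst G = map ((`) \<sigma>) (map fst F0)" unfolding True[symmetric] by (simp add: comp_def case_prod_unfold)
    then have "wosp (\<sigma> ` I) G \<longleftrightarrow> wosp I F0"
      using part_image[OF inj order_refl, of "map fst F0"] sub finI by (simp add: wosp_iff_part UF_def)
    moreover have "fits (ppush \<sigma> I P) {} G \<longleftrightarrow> fits P {} F0"
      using fits_ppush[OF P inj, of "{}" F0] sub egp_hv(1)[OF P] True by simp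
    ultimately show ?thesis using True by (simp add: phi_def)
  next
    case False
    have "\<not> wosp (\<sigma> ` I) G"
    proof
      assume "wosp (\<sigma> ` I) G"
      then have "UF G = \<sigma> ` I" by (rule wosp_UF)
      then have "\<sigma> ` {i\<in>I. \<sigma> i \<in> B} = B" if "(B, w) \<in> set G" for B w
        using that unfolding UF_def by force
      then have "map (\<lambda>(B, w). (\<sigma> ` {i\<in>I. \<sigma> i \<in> B}, w)) G = G" by (intro map_idI) auto
      then show False using False by (auto simp: F0_def comp_def case_prod_unfold)
    qed
    then show ?thesis using False by (simp add: phi_def)
  qed
  finally show "hrel WSigma \<sigma> I (phi I P) G = phi (\<sigma> ` I) (ppush \<sigma> I P) G" .
qed

section \<open>Quasi-shuffles and products\<close>

lemma ores_Cons: "ores S (B # Bs) = (if B \<inter> S = {} then ores S Bs else (B \<inter> S) # ores S Bs)"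
  by (simp add: ores_def)

lemma ores_Nil: "ores S [] = []"
  by (simp add: ores_def)

lemma part_ores: "part J Bs \<Longrightarrow> part (J \<inter> S) (ores S Bs)"
proof (induction Bs arbitrary: J)
  case (Cons B Bs)
  then have "part ((J - B) \<inter> S) (ores S Bs)" by auto
  moreover have "(J - B) \<inter> S = J \<inter> S - B \<inter> S" "B \<inter> S = {} \<Longrightarrow> J \<inter> S - B \<inter> S = J \<inter> S" by auto
  ultimately show ?case using Cons.prems by (auto simp: ores_Cons)
qed (simp add: ores_Nil)

lemma wt_Cons: "wt ((C, w) # F) B = (if C = B then w else 0) + wt F B"
  by (simp add: wt_def)

lemma wt_not_block: "B \<notin> fst ` set F \<Longrightarrow> wt F B = 0"
  by (induction F) (auto simp: wt_def split: if_splits)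

text \<open>The support function of a product is additive, so the increment at a block is the sum of
  the increments at its traces on \<open>S\<close> and \<open>T\<close>. Empty traces are dropped by
  \<open>ores\<close>; there the increment is 0, and so is \<open>wt\<close>. This is precisely the
  weight rule of quasi-shuffles.\<close>

lemma fits_pprod:
  assumes P: "egp S P" and Q: "egp T Q" and disj: "S \<inter> T = {}"
    and "A \<subseteq> S \<union> T" "part (S \<union> T - A) (map fst H)" "ebounded (A \<inter> S) P" "ebounded (A \<inter> T) Q"
  defines "f \<equiv> \<lambda>A H. wlist P (A \<inter> S) (ores S (map fst H))" and "g \<equiv> \<lambda>A H. wlist Q (A \<inter> T) (ores T (map fst H))"
  shows "fits (pprod S T P Q) A H \<longleftrightarrow> fits P (A \<inter> S) (f A H) \<and> fits Q (A \<inter> T) (g A H) \<and>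
     (\<forall>(B, w)\<in>set H. w = wt (f A H) (B \<inter> S) + wt (g A H) (B \<inter> T))"
  using assms(4-7)
proof (induction H arbitrary: A)
  case Nil
  then show ?case by (simp add: f_def g_def ores_Nil)
next
  case (Cons p H)
  obtain B w where p: "p = (B, w)" by fastforce
  have e: "S \<union> T - A - B = S \<union> T - (A \<union> B)" by blast
  have B: "B \<noteq> {}" "B \<subseteq> S \<union> T" "B \<inter> A = {}" "part (S \<union> T - (A \<union> B)) (map fst H)"
    using Cons.prems(2) e by (auto simp: p)
  have AB: "A \<union> B \<subseteq> S \<union> T" using Cons.prems(1) B by auto
  \<comment> \<open>The facts about traces concern one factor at a time; they are proved for a
    generic factor \<open>R\<close> on \<open>X\<close> and then used for both.\<close>
  have one: "(fits R (A \<inter> X) (wlist R (A \<inter> X) (ores X (map fst (p # H)))) \<longleftrightarrow>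
        ebounded ((A \<union> B) \<inter> X) R \<and> fits R ((A \<union> B) \<inter> X) (wlist R ((A \<union> B) \<inter> X) (ores X (map fst H))))"
    and wt1: "wt (wlist R (A \<inter> X) (ores X (map fst (p # H)))) (B \<inter> X) = hv R ((A \<union> B) \<inter> X) - hv R (A \<inter> X)"
    and wt2: "\<And>C v. (C, v) \<in> set H \<Longrightarrow> wt (wlist R (A \<inter> X) (ores X (map fst (p # H)))) (C \<inter> X)
        = wt (wlist R ((A \<union> B) \<inter> X) (ores X (map fst H))) (C \<inter> X)"
    if R: "ebounded (A \<inter> X) R" for R X
  proof -
    let ?F = "wlist R ((A \<union> B) \<inter> X) (ores X (map fst H))"
    have AX: "A \<inter> X \<union> B \<inter> X = (A \<union> B) \<inter> X" by blast
    have pt: "part ((S \<union> T - (A \<union> B)) \<inter> X) (ores X (map fst H))" by (rule part_ores[OF B(4)])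
    have blocks: "fst ` set ?F = set (ores X (map fst H))" by (metis list.set_map map_fst_wlist)
    \<comment> \<open>Either \<open>B \<inter> X\<close> is empty, and \<open>ores\<close> keeps no
      empty blocks, or it is disjoint from all later traces.\<close>
    have w0: "wt ?F (B \<inter> X) = 0"
    proof (rule wt_not_block, unfold blocks)
      show "B \<inter> X \<notin> set (ores X (map fst H))"
        using part_Union[OF pt] part_nonempty[OF pt] B(2) by blast
    qed
    show "(fits R (A \<inter> X) (wlist R (A \<inter> X) (ores X (map fst (p # H)))) \<longleftrightarrow> ebounded ((A \<union> B) \<inter> X) R \<and> fits R ((A \<union> B) \<inter> X) ?F)"
    proof (cases "B \<inter> X = {}")
      case True
      then have "(A \<union> B) \<inter> X = A \<inter> X" by blast
      then show ?thesis using True R by (simp add: p ores_Cons)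
    qed (simp add: p ores_Cons AX)
    show "wt (wlist R (A \<inter> X) (ores X (map fst (p # H)))) (B \<inter> X) = hv R ((A \<union> B) \<inter> X) - hv R (A \<inter> X)"
    proof (cases "B \<inter> X = {}")
      case True
      then have "(A \<union> B) \<inter> X = A \<inter> X" by blast
      then show ?thesis using True w0 by (simp add: p ores_Cons)
    qed (simp add: p ores_Cons AX wt_Cons w0)
    fix C v assume C: "(C, v) \<in> set H"
    have "C \<subseteq> S \<union> T - (A \<union> B)" 
    proof -
      have "C \<in> set (map fst H)" using image_eqI[of C fst "(C, v)"] C by simp
      then show ?thesis using part_Union[OF B(4)] by blast
    qed
    then have ne: "B \<inter> X \<noteq> C \<inter> X" if "B \<inter> X \<noteq> {}" using that by blast
    show "wt (wlist R (A \<inter> X) (ores X (map fst (p # H)))) (C \<inter> X) = wt ?F (C \<inter> X)"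
    proof (cases "B \<inter> X = {}")
      case True
      then have "(A \<union> B) \<inter> X = A \<inter> X" by blast
      then show ?thesis using True by (simp add: p ores_Cons)
    next
      case False
      then show ?thesis using ne by (simp add: p ores_Cons AX wt_Cons)
    qed
  qed
  have fg: "f A (p # H) = wlist P (A \<inter> S) (ores S (map fst (p # H)))"
    "f (A \<union> B) H = wlist P ((A \<union> B) \<inter> S) (ores S (map fst H))"
    "g A (p # H) = wlist Q (A \<inter> T) (ores T (map fst (p # H)))"
    "g (A \<union> B) H = wlist Q ((A \<union> B) \<inter> T) (ores T (map fst H))"
    by (simp_all only: f_def g_def)
  note f1 = one[OF Cons.prems(3), folded fg] wt1[OF Cons.prems(3), folded fg] wt2[OF Cons.prems(3), folded fg]
  note g1 = one[OF Cons.prems(4), folded fg] wt1[OF Cons.prems(4), folded fg] wt2[OF Cons.prems(4), folded fg]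
  have all: "(\<forall>(C, v)\<in>set (p # H). v = wt (f A (p # H)) (C \<inter> S) + wt (g A (p # H)) (C \<inter> T)) \<longleftrightarrow>
      w = hv P ((A \<union> B) \<inter> S) - hv P (A \<inter> S) + (hv Q ((A \<union> B) \<inter> T) - hv Q (A \<inter> T)) \<and>
      (\<forall>(C, v)\<in>set H. v = wt (f (A \<union> B) H) (C \<inter> S) + wt (g (A \<union> B) H) (C \<inter> T))"
  proof -
    have "(\<forall>(C, v)\<in>set H. v = wt (f A (p # H)) (C \<inter> S) + wt (g A (p # H)) (C \<inter> T)) \<longleftrightarrow>
        (\<forall>(C, v)\<in>set H. v = wt (f (A \<union> B) H) (C \<inter> S) + wt (g (A \<union> B) H) (C \<inter> T))"
      using f1(3) g1(3) by (intro ball_cong) auto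
    moreover have "set (p # H) = insert (B, w) (set H)" by (simp add: p)
    ultimately show ?thesis using f1(2) g1(2) by (simp only: ball_simps prod.case)
  qed
  show ?case
  proof (cases "ebounded ((A \<union> B) \<inter> S) P \<and> ebounded ((A \<union> B) \<inter> T) Q")
    case True
    have h: "hv (pprod S T P Q) (A \<union> B) = hv P ((A \<union> B) \<inter> S) + hv Q ((A \<union> B) \<inter> T)"
      "hv (pprod S T P Q) A = hv P (A \<inter> S) + hv Q (A \<inter> T)"
      using True Cons.prems AB by (auto intro!: hv_pprod[OF P Q disj])
    have "fits (pprod S T P Q) A (p # H) \<longleftrightarrow>
        w = hv P ((A \<union> B) \<inter> S) - hv P (A \<inter> S) + (hv Q ((A \<union> B) \<inter> T) - hv Q (A \<inter> T)) \<and>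
        fits (pprod S T P Q) (A \<union> B) H"
      using True ebounded_pprod[OF P Q disj AB] h by (auto simp: p)
    then show ?thesis
      unfolding all f1(1) g1(1) using Cons.IH[OF AB B(4)] True by blast
  next
    case False
    then show ?thesis
      unfolding f1(1) g1(1) using ebounded_pprod[OF P Q disj AB] by (simp add: p) blast
  qed
qed

text \<open>The double sum collapses to one term: the traces of \<open>H\<close> prescribe the
  blocks of the two factors, and fitting \<open>P\<close> and \<open>Q\<close> prescribes their
  weights.\<close>

lemma WSigma_hmu_phi:
  assumes P: "egp S P" and Q: "egp T Q" and disj: "S \<inter> T = {}"
  shows "hmu WSigma S T (phi S P) (phi T Q) = phi (S \<union> T) (pprod S T P Q)"
proof
  fix H :: "('a set \<times> real) list"
  define F0 where "F0 = wlist P {} (ores S (map fst H))"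
  define G0 where "G0 = wlist Q {} (ores T (map fst H))"
  have fin: "finite S" "finite T" using P Q egp_finite by auto
  have "hmu WSigma S T (phi S P) (phi T Q) H =
      fsum (phi S P) (\<lambda>F. fsum (phi T Q) (\<lambda>G. if qshuffle S T F G H then 1 else 0))"
    unfolding WSigma_def using sum_indicator2_eq_fsum[OF finite_phi finite_phi] by simp
  also have "\<dots> = fsum (phi S P) (\<lambda>F. phi T Q G0 * (if qshuffle S T F G0 H then 1 else 0))"
  proof (rule fsum_cong, rule fsum_single[OF finite_phi])
    fix F G assume "phi T Q G \<noteq> 0" "G \<noteq> G0"
    then show "(if qshuffle S T F G H then 1 else 0) = (0::real)"
      using fits_wlist[of Q "{}" G] by (auto simp: phi_nonzero qshuffle_def G0_def)
  qed
  also have "\<dots> = phi S P F0 * (phi T Q G0 * (if qshuffle S T F0 G0 H then 1 else 0))"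
  proof (rule fsum_single[OF finite_phi])
    fix F assume "phi S P F \<noteq> 0" "F \<noteq> F0"
    then show "phi T Q G0 * (if qshuffle S T F G0 H then 1 else 0) = (0::real)"
      using fits_wlist[of P "{}" F] by (auto simp: phi_nonzero qshuffle_def F0_def)
  qed
  also have "\<dots> = phi (S \<union> T) (pprod S T P Q) H"
  proof (cases "wosp (S \<union> T) H")
    case True
    then have pH: "part (S \<union> T) (map fst H)" by (simp add: wosp_iff_part)
    have "(S \<union> T) \<inter> S = S" "(S \<union> T) \<inter> T = T" by auto
    then have "wosp S F0" "wosp T G0"
      using part_ores[OF pH, of S] part_ores[OF pH, of T] fin by (simp_all add: wosp_iff_part F0_def G0_def)
    moreover have "fits (pprod S T P Q) {} H \<longleftrightarrow> fits P {} F0 \<and> fits Q {} G0 \<and>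
        (\<forall>(B, w)\<in>set H. w = wt F0 (B \<inter> S) + wt G0 (B \<inter> T))"
      using fits_pprod[OF P Q disj, of "{}" H] pH egp_hv(1)[OF P] egp_hv(1)[OF Q]
      by (simp add: F0_def G0_def)
    moreover have "qshuffle S T F0 G0 H \<longleftrightarrow> (\<forall>(B, w)\<in>set H. w = wt F0 (B \<inter> S) + wt G0 (B \<inter> T))"
      using True by (simp add: qshuffle_def F0_def G0_def)
    ultimately show ?thesis using True by (simp add: phi_def)
  qed (simp add: phi_def qshuffle_def)
  finally show "hmu WSigma S T (phi S P) (phi T Q) H = phi (S \<union> T) (pprod S T P Q) H" .
qed

section \<open>Prefixes and coproducts\<close>

lemma fits_pres:
  assumes P: "egp (S \<union> T) P" "S \<inter> T = {}" "ebounded S P" and "A \<union> UF F \<subseteq> S" "ebounded A P"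
  shows "fits (pres S P) A F \<longleftrightarrow> fits P A F"
  using assms(4,5)
proof (induction F arbitrary: A)
  case (Cons p F)
  obtain B w where p: "p = (B, w)" by fastforce
  have s: "A \<union> B \<subseteq> S" "A \<union> B \<union> UF F \<subseteq> S" "A \<subseteq> S" using Cons.prems(1) by (auto simp: p)
  show ?case
  proof (cases "ebounded (A \<union> B) P")
    case True
    then show ?thesis
      using Cons.IH[OF s(2) True] hv_pres[OF P s(1) True] hv_pres[OF P s(3) Cons.prems(2)]
        ebounded_pres[OF P s(1)] by (simp add: p)
  next
    case False
    then show ?thesis using ebounded_pres[OF P s(1)] by (simp add: p)
  qed
qed simp

lemma fits_pcon:
  assumes P: "egp (S \<union> T) P" "S \<inter> T = {}" "ebounded S P" and "A \<union> UF F \<subseteq> T" "ebounded (S \<union> A) P"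
  shows "fits (pcon S T P) A F \<longleftrightarrow> fits P (S \<union> A) F"
  using assms(4,5)
proof (induction F arbitrary: A)
  case (Cons p F)
  obtain B w where p: "p = (B, w)" by fastforce
  have s: "A \<union> B \<subseteq> T" "A \<union> B \<union> UF F \<subseteq> T" "A \<subseteq> T" using Cons.prems(1) by (auto simp: p)
  show ?case
  proof (cases "ebounded (S \<union> (A \<union> B)) P")
    case True
    then show ?thesis
      using Cons.IH[OF s(2) True] hv_pcon[OF P s(1) True] hv_pcon[OF P s(3) Cons.prems(2)]
        ebounded_pcon[OF P s(1)] by (simp add: p Un_assoc)
  next
    case False
    then show ?thesis using ebounded_pcon[OF P s(1)] by (simp add: p Un_assoc)
  qed
qed simp

text \<open>Cutting a fitting partition after the prefix \<open>S\<close> leaves a front part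
  measured by the restriction and a rear part whose increments are unchanged when the constant
  \<open>hv P S\<close> is subtracted, as in the contraction. If \<open>S\<close> is unbounded on
  \<open>P\<close>, no fitting partition has it as a prefix.\<close>

lemma WSigma_hdelta_phi:
  assumes P: "egp (S \<union> T) P" and disj: "S \<inter> T = {}"
  shows "hdelta WSigma S T (phi (S \<union> T) P) =
    (if ebounded S P then tens (phi S (pres S P)) (phi T (pcon S T P)) else (\<lambda>_. 0))"
proof (rule ext, clarify)
  fix F1 F2 :: "('a set \<times> real) list"
  have fin: "finite S" "finite T" using egp_finite[OF P] by auto
  have hd: "hdelta WSigma S T (phi (S \<union> T) P) (F1, F2) = (if UF F1 = S then phi (S \<union> T) P (F1 @ F2) else 0)"
    by (simp add: WSigma_def UF_def)
  show "hdelta WSigma S T (phi (S \<union> T) P) (F1, F2) =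
    (if ebounded S P then tens (phi S (pres S P)) (phi T (pcon S T P)) else (\<lambda>_. 0)) (F1, F2)"
  proof (cases "UF F1 = S")
    case False
    then have "\<not> wosp S F1" using wosp_UF by blast
    then show ?thesis using hd False by (simp add: tens_def phi_def)
  next
    case True
    have "S \<union> T - S = T" using disj by blast
    then have w: "wosp (S \<union> T) (F1 @ F2) \<longleftrightarrow> wosp S F1 \<and> wosp T F2"
      using part_append[of "S \<union> T" "map fst F1" "map fst F2"] True fin
      by (simp add: wosp_iff_part UF_def)
    have ft: "fits P {} (F1 @ F2) \<longleftrightarrow> fits P {} F1 \<and> fits P S F2" using fits_append[of P "{}" F1 F2] True by simp
    show ?thesis
    proof (cases "ebounded S P")
      case S: True
      have "fits (pres S P) {} F1 \<longleftrightarrow> fits P {} F1"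
        using fits_pres[OF P disj S, of "{}" F1] True egp_hv(1)[OF P] by simp
      moreover have "fits (pcon S T P) {} F2 \<longleftrightarrow> fits P S F2" if "wosp T F2"
        using fits_pcon[OF P disj S, of "{}" F2] wosp_UF[OF that] S by simp
      ultimately show ?thesis using hd True S w ft by (auto simp: tens_def phi_def)
    next
      case S: False
      then have "\<not> fits P {} F1" using fits_ebounded[of P "{}" F1] True egp_hv(1)[OF P] by auto
      then show ?thesis using hd True S ft by (simp add: phi_def)
    qed
  qed
qed

section \<open>Identities between faces, one for each coproduct axiom\<close>

lemma egp_empty: "egp {} P \<Longrightarrow> P = RI {}"
  using egp_RI[of "{}" P] by (force simp: egp_def RI_def)

lemma egp_RI_empty: "egp {} (RI {})"
proof -
  have "submod {} {{}} (\<lambda>_. 0)" by (simp add: submod_def)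
  then have "egp {} (bpoly {} {{}} (\<lambda>_. 0))" by (rule egp_bpoly)
  then show ?thesis using egp_empty by metis
qed

lemma face_ppush:
  assumes P: "egp (S \<union> T) P" and disj: "S \<inter> T = {}" and inj: "inj_on \<sigma> (S \<union> T)" and S: "ebounded S P"
  shows "pres (\<sigma> ` S) (ppush \<sigma> (S \<union> T) P) = ppush \<sigma> S (pres S P)"
    "pcon (\<sigma> ` S) (\<sigma> ` T) (ppush \<sigma> (S \<union> T) P) = ppush \<sigma> T (pcon S T P)"
proof -
  let ?Q = "ppush \<sigma> (S \<union> T) P"
  have Q: "egp (\<sigma> ` S \<union> \<sigma> ` T) ?Q" using egp_ppush[OF P inj] by (simp add: image_Un)
  have d: "\<sigma> ` S \<inter> \<sigma> ` T = {}" using inj disj by (metis inj_on_image_Int image_empty sup_ge1 sup_ge2)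
  have SQ: "ebounded (\<sigma> ` S) ?Q" using ebounded_ppush[OF P inj] S by simp
  have i: "inj_on \<sigma> S" "inj_on \<sigma> T" using inj inj_on_subset by blast+
  note eb = egp_pres[OF P disj S] egp_pcon[OF P disj S]
  note Qs = Q d SQ
  show "pres (\<sigma> ` S) ?Q = ppush \<sigma> S (pres S P)"
  proof (rule egp_eqI[OF egp_pres[OF Qs] egp_ppush[OF eb(1) i(1)]])
    fix A' assume "A' \<subseteq> \<sigma> ` S"
    then obtain A where A: "A \<subseteq> S" "A' = \<sigma> ` A" by (meson subset_imageE)
    then have A2: "A \<subseteq> S \<union> T" "\<sigma> ` A \<subseteq> \<sigma> ` S" by auto
    note r = ebounded_pres[OF Qs A2(2)] ebounded_ppush[OF eb(1) i(1) A(1)] ebounded_ppush[OF P inj A2(1)]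
      ebounded_pres[OF P disj S A(1)]
    show "ebounded A' (pres (\<sigma> ` S) ?Q) \<longleftrightarrow> ebounded A' (ppush \<sigma> S (pres S P))"
      using r by (simp add: A(2))
    assume "ebounded A' (pres (\<sigma> ` S) ?Q)"
    then have "ebounded A P" using r by (simp add: A(2))
    then show "hv (pres (\<sigma> ` S) ?Q) A' = hv (ppush \<sigma> S (pres S P)) A'"
      using r hv_pres[OF Qs A2(2)] hv_ppush[OF eb(1) i(1) A(1)] hv_ppush[OF P inj A2(1)] hv_pres[OF P disj S A(1)]
      by (simp add: A(2))
  qed
  show "pcon (\<sigma> ` S) (\<sigma> ` T) ?Q = ppush \<sigma> T (pcon S T P)"
  proof (rule egp_eqI[OF egp_pcon[OF Qs] egp_ppush[OF eb(2) i(2)]])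
    fix A' assume "A' \<subseteq> \<sigma> ` T"
    then obtain A where A: "A \<subseteq> T" "A' = \<sigma> ` A" by (meson subset_imageE)
    then have A2: "S \<union> A \<subseteq> S \<union> T" "\<sigma> ` A \<subseteq> \<sigma> ` T" "S \<subseteq> S \<union> T" by auto
    note r = ebounded_pcon[OF Qs A2(2)] ebounded_ppush[OF eb(2) i(2) A(1)] ebounded_ppush[OF P inj A2(1), unfolded image_Un]
      ebounded_pcon[OF P disj S A(1)]
    show "ebounded A' (pcon (\<sigma> ` S) (\<sigma> ` T) ?Q) \<longleftrightarrow> ebounded A' (ppush \<sigma> T (pcon S T P))"
      using r by (simp add: A(2))
    assume "ebounded A' (pcon (\<sigma> ` S) (\<sigma> ` T) ?Q)"
    then have "ebounded (S \<union> A) P" using r by (simp add: A(2))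
    then show "hv (pcon (\<sigma> ` S) (\<sigma> ` T) ?Q) A' = hv (ppush \<sigma> T (pcon S T P)) A'"
      using r hv_pcon[OF Qs A2(2)] hv_ppush[OF eb(2) i(2) A(1)] hv_ppush[OF P inj A2(1), unfolded image_Un]
        hv_ppush[OF P inj A2(3) S] hv_pcon[OF P disj S A(1)]
      by (simp add: A(2))
  qed
qed

text \<open>The polyhedral form of coassociativity. Contracting twice subtracts first
  \<open>hv P R\<close> and then \<open>hv P (R \<union> S) - hv P R\<close>, which telescopes to
  contracting by \<open>R \<union> S\<close>.\<close>

lemma face_face:
  assumes P: "egp (R \<union> S \<union> T) P" and disj: "R \<inter> S = {}" "R \<inter> T = {}" "S \<inter> T = {}"
    and R: "ebounded R P" and RS: "ebounded (R \<union> S) P"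
  shows "pres R (pres (R \<union> S) P) = pres R P"
    "pcon R S (pres (R \<union> S) P) = pres S (pcon R (S \<union> T) P)"
    "pcon (R \<union> S) T P = pcon S T (pcon R (S \<union> T) P)"
proof -
  have P': "egp (R \<union> (S \<union> T)) P" using P by (simp add: Un_assoc)
  have d1: "(R \<union> S) \<inter> T = {}" and d2: "R \<inter> (S \<union> T) = {}" using disj by auto
  note c1 = P d1 RS and c2 = P' d2 R
  let ?X = "pres (R \<union> S) P" and ?Y = "pcon R (S \<union> T) P"
  have X: "egp (R \<union> S) ?X" by (rule egp_pres[OF c1])
  have Y: "egp (S \<union> T) ?Y" by (rule egp_pcon[OF c2])
  have RX: "ebounded R ?X" using ebounded_pres[OF c1, of R] R by auto
  have SY: "ebounded S ?Y" using ebounded_pcon[OF c2, of S] RS by auto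
  note cX = X disj(1) RX and cY = Y disj(3) SY
  show "pres R ?X = pres R P"
  proof (rule egp_eqI[OF egp_pres[OF cX] egp_pres[OF c2]])
    fix A assume A: "A \<subseteq> R"
    then have A': "A \<subseteq> R \<union> S" by auto
    note r = ebounded_pres[OF cX A] ebounded_pres[OF c2 A] ebounded_pres[OF c1 A']
    show "ebounded A (pres R ?X) \<longleftrightarrow> ebounded A (pres R P)" using r by simp
    assume "ebounded A (pres R ?X)"
    then show "hv (pres R ?X) A = hv (pres R P) A"
      using r hv_pres[OF cX A] hv_pres[OF c2 A] hv_pres[OF c1 A'] by simp
  qed
  show "pcon R S ?X = pres S ?Y"
  proof (rule egp_eqI[OF egp_pcon[OF cX] egp_pres[OF cY]])
    fix A assume A: "A \<subseteq> S"
    then have A': "R \<union> A \<subseteq> R \<union> S" "A \<subseteq> S \<union> T" "R \<subseteq> R \<union> S" by auto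
    note r = ebounded_pcon[OF cX A] ebounded_pres[OF cY A] ebounded_pres[OF c1 A'(1)] ebounded_pcon[OF c2 A'(2)]
    show "ebounded A (pcon R S ?X) \<longleftrightarrow> ebounded A (pres S ?Y)" using r by simp
    assume "ebounded A (pcon R S ?X)"
    then show "hv (pcon R S ?X) A = hv (pres S ?Y) A"
      using r hv_pcon[OF cX A] hv_pres[OF cY A] hv_pres[OF c1 A'(1)] hv_pcon[OF c2 A'(2)] hv_pres[OF c1 A'(3) R] by simp
  qed
  show "pcon (R \<union> S) T P = pcon S T ?Y"
  proof (rule egp_eqI[OF egp_pcon[OF c1] egp_pcon[OF cY]])
    fix A assume A: "A \<subseteq> T"
    then have A': "S \<union> A \<subseteq> S \<union> T" "S \<subseteq> S \<union> T" by auto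
    note r = ebounded_pcon[OF c1 A] ebounded_pcon[OF cY A] ebounded_pcon[OF c2 A'(1)]
    show "ebounded A (pcon (R \<union> S) T P) \<longleftrightarrow> ebounded A (pcon S T ?Y)" using r by (simp add: Un_assoc)
    assume "ebounded A (pcon (R \<union> S) T P)"
    then show "hv (pcon (R \<union> S) T P) A = hv (pcon S T ?Y) A"
      using r hv_pcon[OF c1 A] hv_pcon[OF cY A] hv_pcon[OF c2 A'(1)] hv_pcon[OF c2 A'(2) RS] by (simp add: Un_assoc)
  qed
qed

text \<open>The polyhedral form of the compatibility axiom, with \<open>a\<close>, \<open>b\<close>,
  \<open>c\<close>, \<open>d\<close> the cells common to the two decompositions of the ground
  set.\<close>

lemma face_pprod:
  assumes P: "egp (a \<union> b) P" and Q: "egp (c \<union> d) Q"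
    and disj: "a \<inter> b = {}" "a \<inter> c = {}" "a \<inter> d = {}" "b \<inter> c = {}" "b \<inter> d = {}" "c \<inter> d = {}"
    and a: "ebounded a P" and c: "ebounded c Q"
  shows "pres (a \<union> c) (pprod (a \<union> b) (c \<union> d) P Q) = pprod a c (pres a P) (pres c Q)"
    "pcon (a \<union> c) (b \<union> d) (pprod (a \<union> b) (c \<union> d) P Q) = pprod b d (pcon a b P) (pcon c d Q)"
proof -
  let ?R = "pprod (a \<union> b) (c \<union> d) P Q"
  have ds: "(a \<union> b) \<inter> (c \<union> d) = {}" "(a \<union> c) \<inter> (b \<union> d) = {}" using disj by auto
  have R: "egp ((a \<union> c) \<union> (b \<union> d)) ?R"
    using egp_pprod[OF P Q ds(1)] by (simp add: Un_ac)
  note pq = P Q ds(1)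
  have ac: "(a \<union> c) \<inter> (a \<union> b) = a" "(a \<union> c) \<inter> (c \<union> d) = c" using disj by auto
  have acs: "a \<union> c \<subseteq> (a \<union> b) \<union> (c \<union> d)" by auto
  have eac: "ebounded (a \<union> c) ?R" using ebounded_pprod[OF pq acs] ac a c by simp
  have hac: "hv ?R (a \<union> c) = hv P a + hv Q c" using hv_pprod[OF pq acs] ac a c by simp
  note cR = R ds(2) eac and cP = P disj(1) a and cQ = Q disj(6) c
  note e1 = egp_pres[OF cP] egp_pres[OF cQ] disj(2) and e2 = egp_pcon[OF cP] egp_pcon[OF cQ] disj(5)
  show "pres (a \<union> c) ?R = pprod a c (pres a P) (pres c Q)"
  proof (rule egp_eqI[OF egp_pres[OF cR] egp_pprod[OF e1]])
    fix A assume A: "A \<subseteq> a \<union> c"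
    have A': "A \<subseteq> (a \<union> b) \<union> (c \<union> d)" "A \<inter> a \<subseteq> a" "A \<inter> c \<subseteq> c" using A by auto
    have i: "A \<inter> (a \<union> b) = A \<inter> a" "A \<inter> (c \<union> d) = A \<inter> c" using A disj by auto
    note r = ebounded_pres[OF cR A] ebounded_pprod[OF e1 A] ebounded_pprod[OF pq A'(1), unfolded i]
      ebounded_pres[OF cP A'(2)] ebounded_pres[OF cQ A'(3)]
    show "ebounded A (pres (a \<union> c) ?R) \<longleftrightarrow> ebounded A (pprod a c (pres a P) (pres c Q))" using r by simp
    assume "ebounded A (pres (a \<union> c) ?R)"
    then show "hv (pres (a \<union> c) ?R) A = hv (pprod a c (pres a P) (pres c Q)) A"
      using r hv_pres[OF cR A] hv_pprod[OF e1 A] hv_pprod[OF pq A'(1), unfolded i]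
        hv_pres[OF cP A'(2)] hv_pres[OF cQ A'(3)] by simp
  qed
  show "pcon (a \<union> c) (b \<union> d) ?R = pprod b d (pcon a b P) (pcon c d Q)"
  proof (rule egp_eqI[OF egp_pcon[OF cR] egp_pprod[OF e2]])
    fix A assume A: "A \<subseteq> b \<union> d"
    have A': "a \<union> c \<union> A \<subseteq> (a \<union> b) \<union> (c \<union> d)" "A \<inter> b \<subseteq> b" "A \<inter> d \<subseteq> d" using A by auto
    have i: "(a \<union> c \<union> A) \<inter> (a \<union> b) = a \<union> (A \<inter> b)" "(a \<union> c \<union> A) \<inter> (c \<union> d) = c \<union> (A \<inter> d)" using A disj by auto
    note r = ebounded_pcon[OF cR A] ebounded_pprod[OF e2 A] ebounded_pprod[OF pq A'(1), unfolded i]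
      ebounded_pcon[OF cP A'(2)] ebounded_pcon[OF cQ A'(3)]
    show "ebounded A (pcon (a \<union> c) (b \<union> d) ?R) \<longleftrightarrow> ebounded A (pprod b d (pcon a b P) (pcon c d Q))" using r by simp
    assume "ebounded A (pcon (a \<union> c) (b \<union> d) ?R)"
    then show "hv (pcon (a \<union> c) (b \<union> d) ?R) A = hv (pprod b d (pcon a b P) (pcon c d Q)) A"
      using r hv_pcon[OF cR A] hv_pprod[OF e2 A] hv_pprod[OF pq A'(1), unfolded i] hac
        hv_pcon[OF cP A'(2)] hv_pcon[OF cQ A'(3)] by simp
  qed
qed

lemma face_trivial:
  assumes P: "egp I P"
  shows "pres {} P = RI {}" "pcon {} I P = P" "pres I P = P" "pcon I {} P = RI {}"
proof -
  have c1: "egp ({} \<union> I) P" "{} \<inter> I = {}" "ebounded {} P" using P egp_hv(1)[OF P] by auto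
  have c2: "egp (I \<union> {}) P" "I \<inter> {} = {}" "ebounded I P" using P egp_hv(2)[OF P] by auto
  show "pres {} P = RI {}" by (rule egp_empty[OF egp_pres[OF c1]])
  show "pcon I {} P = RI {}" by (rule egp_empty[OF egp_pcon[OF c2]])
  show "pcon {} I P = P"
    by (rule egp_eqI[OF egp_pcon[OF c1] P]) (use ebounded_pcon[OF c1] hv_pcon[OF c1] egp_hv(3)[OF P] in auto)
  show "pres I P = P"
    by (rule egp_eqI[OF egp_pres[OF c2] P]) (use ebounded_pres[OF c2] hv_pres[OF c2] in auto)
qed

section \<open>The Hopf monoid of indicator functions\<close>

lemma linear_on_cong:
  assumes "linear_on V \<psi>" "fsubspace V" "\<And>f. f \<in> V \<Longrightarrow> \<phi> f = \<psi> f"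
  shows "linear_on V \<phi>"
  unfolding linear_on_def
  using assms(3) fsubspace_lincomb[OF assms(2)] linear_onD[OF assms(1)] by auto

lemma linear_on_reindex: "linear_on V \<phi> \<Longrightarrow> linear_on V (\<lambda>f y. \<phi> f (r y))"
  by (simp add: linear_on_def)

lemma linear_on_sum_list_maps:
  assumes "\<And>m. m \<in> set M \<Longrightarrow> linear_on V (\<phi> m)"
  shows "linear_on V (\<lambda>f y. \<Sum>m\<leftarrow>M. \<phi> m f y)"
  using assms
proof (induction M)
  case (Cons m M)
  then have "linear_on V (\<phi> m)" "linear_on V (\<lambda>f y. \<Sum>m\<leftarrow>M. \<phi> m f y)" by auto
  note lin = linear_onD[OF this(1)] linear_onD[OF this(2)]
  show ?case unfolding linear_on_def
  proof (intro ballI allI ext)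
    fix f g c d y assume fg: "f \<in> V" "g \<in> V"
    show "(\<Sum>m\<leftarrow>m # M. \<phi> m (\<lambda>x. c * f x + d * g x) y) = c * (\<Sum>m\<leftarrow>m # M. \<phi> m f y) + d * (\<Sum>m\<leftarrow>m # M. \<phi> m g y)"
      using fun_cong[OF lin(1)[OF fg, of c d], of y] fun_cong[OF lin(2)[OF fg, of c d], of y]
      by (simp add: distrib_left)
  qed
qed (simp add: linear_on_def)

lemma sum_list_swap:
  "(\<Sum>x\<leftarrow>L. \<Sum>y\<leftarrow>M. f x y) = (\<Sum>y\<leftarrow>M. \<Sum>x\<leftarrow>L. f x y :: 'c :: comm_monoid_add)"
  by (induction L) (simp_all add: sum_list_addf)

lemma bilinear_lspan_eq:
  assumes "\<And>g. g \<in> lspan B \<Longrightarrow> linear_on (lspan A) (\<lambda>f. \<beta> f g)"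
    "\<And>g. g \<in> lspan B \<Longrightarrow> linear_on (lspan A) (\<lambda>f. \<gamma> f g)"
    "\<And>f. f \<in> A \<Longrightarrow> linear_on (lspan B) (\<beta> f)" "\<And>f. f \<in> A \<Longrightarrow> linear_on (lspan B) (\<gamma> f)"
    "\<And>f g. f \<in> A \<Longrightarrow> g \<in> B \<Longrightarrow> \<beta> f g = \<gamma> f g" "f \<in> lspan A" "g \<in> lspan B"
  shows "\<beta> f g = \<gamma> f g"
proof -
  have "\<beta> f' g = \<gamma> f' g" if "f' \<in> A" for f'
    by (rule linear_on_lspan_eq[OF assms(3)[OF that] assms(4)[OF that]]) (use that assms(5,7) in auto)
  then show ?thesis
    using linear_on_lspan_eq[OF assms(1)[OF assms(7)] assms(2)[OF assms(7)]] assms(6) by blast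
qed

text \<open>The inverse of \<open>psi\<close>: coordinates of an indicator function in terms of
  weighted ordered set partitions.\<close>

definition iota :: "'a set \<Rightarrow> (('a \<Rightarrow> real) \<Rightarrow> real) \<Rightarrow> (('a set \<times> real) list \<Rightarrow> real)" where
  "iota I = inv_into (w_comp I) (psi I)"

text \<open>Relabelling and product are pointwise formulas on functions. The coproduct is
  transported from \<open>WSigma\<close>; this makes it depend on the function alone, not on a way
  of writing it as a combination of polyhedra.\<close>

definition Ind :: "('a, 'a \<Rightarrow> real) hstruct" where
  "Ind = \<lparr>
     hcomp = (\<lambda>I. lspan {indic P | P. egp I P}),
     hrel = (\<lambda>\<sigma> I f. (\<lambda>y. if y \<in> RI (\<sigma> ` I) then f (\<lambda>i. if i \<in> I then y (\<sigma> i) else 0) else 0)),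
     hmu = (\<lambda>S T f g. (\<lambda>x. if x \<in> RI (S \<union> T) then f (restr S x) * g (restr T x) else 0)),
     hdelta = (\<lambda>S T h. tmap (w_comp S) (w_comp T) (psi S) (psi T) (hdelta WSigma S T (iota (S \<union> T) h))),
     hone = indic (RI {}) \<rparr>"

lemma Ind_comp: "hcomp Ind I = lspan (indic ` {P. egp I P})"
  by (simp add: Ind_def setcompr_eq_image)

lemma fsubspace_Ind: "fsubspace (hcomp Ind I)"
  by (simp add: Ind_comp fsubspace_lspan)

lemma indic_in_Ind: "egp I P \<Longrightarrow> indic P \<in> hcomp Ind I"
  unfolding Ind_comp by (rule lspan_superset) simp

text \<open>The spanning indicator functions are linearly dependent in general, so they serve to
  compare linear maps but not to define them.\<close>

lemma Ind_eqI:
  assumes "linear_on (hcomp Ind I) \<phi>" "linear_on (hcomp Ind I) \<psi>"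
    "\<And>P. egp I P \<Longrightarrow> \<phi> (indic P) = \<psi> (indic P)" "f \<in> hcomp Ind I"
  shows "\<phi> f = \<psi> f"
  using linear_on_lspan_eq[OF assms(1,2)[unfolded Ind_comp]] assms(3,4) unfolding Ind_comp by blast

lemma Ind_imageI:
  assumes "linear_on (hcomp Ind I) \<phi>" "fsubspace W" "\<And>P. egp I P \<Longrightarrow> \<phi> (indic P) \<in> W" "f \<in> hcomp Ind I"
  shows "\<phi> f \<in> W"
  using linear_on_image_subset[OF assms(1)[unfolded Ind_comp] assms(2)] assms(3,4) unfolding Ind_comp by blast

lemma indf_image_gp_comp: "indf I ` gp_comp I = hcomp Ind I"
  using linear_on_image_lspan[OF linear_on_indf[of I, unfolded gp_comp_lspan]]
  by (simp add: gp_comp_lspan Ind_comp image_image)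

lemma psi_image_w_comp: "psi I ` w_comp I = hcomp Ind I"
proof -
  have "psi I ` w_comp I = (\<lambda>f. psi I (Phi I f)) ` gp_comp I"
    using Phi_surj[of I] by (metis image_image)
  also have "\<dots> = indf I ` gp_comp I" using indf_eq_psi_Phi by (metis (no_types, lifting) image_cong)
  finally show ?thesis by (simp add: indf_image_gp_comp)
qed

lemma psi_in_Ind: "a \<in> w_comp I \<Longrightarrow> psi I a \<in> hcomp Ind I"
  using psi_image_w_comp by blast

lemma iota_psi: "a \<in> w_comp I \<Longrightarrow> iota I (psi I a) = a"
  unfolding iota_def using psi_inj by (rule inv_into_f_f)

lemma psi_iota: "h \<in> hcomp Ind I \<Longrightarrow> psi I (iota I h) = h"
  using f_inv_into_f[of h "psi I" "w_comp I"] psi_image_w_comp[of I] by (simp add: iota_def)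

lemma iota_in_w_comp: "h \<in> hcomp Ind I \<Longrightarrow> iota I h \<in> w_comp I"
  unfolding iota_def psi_image_w_comp[symmetric] by (rule inv_into_into)

lemma iota_indf: "f \<in> gp_comp I \<Longrightarrow> iota I (indf I f) = Phi I f"
  by (simp add: indf_eq_psi_Phi iota_psi Phi_in_w_comp)

lemma iota_indic: "egp I P \<Longrightarrow> iota I (indic P) = phi I P"
  using iota_indf[OF basisv_in_gp_comp] by simp

lemma linear_on_iota: "linear_on (hcomp Ind I) (iota I)"
  unfolding linear_on_def
proof (intro ballI allI)
  fix f g c d assume fg: "f \<in> hcomp Ind I" "g \<in> hcomp Ind I"
  let ?a = "\<lambda>y. c * iota I f y + d * iota I g y"
  have a: "?a \<in> w_comp I"
    by (rule fsubspace_lincomb[OF fsubspace_w_comp iota_in_w_comp[OF fg(1)] iota_in_w_comp[OF fg(2)]])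
  have "psi I ?a = (\<lambda>x. c * psi I (iota I f) x + d * psi I (iota I g) x)"
    by (rule linear_onD[OF linear_on_psi iota_in_w_comp[OF fg(1)] iota_in_w_comp[OF fg(2)]])
  then have "psi I ?a = (\<lambda>x. c * f x + d * g x)" using fg by (simp add: psi_iota)
  then show "iota I (\<lambda>x. c * f x + d * g x) = ?a" using iota_psi[OF a] by simp
qed

section \<open>Linearity of the structure maps and the coproduct on generators\<close>

lemma linear_on_WSigma_hdelta: "linear_on V (hdelta WSigma S T)"
  by (auto simp: linear_on_def WSigma_def fun_eq_iff)

lemma linear_on_WSigma_hrel: "linear_on (w_comp I) (hrel WSigma \<sigma> I)"
proof (rule linear_on_cong[OF _ fsubspace_w_comp])
  show "linear_on (w_comp I) (\<lambda>f G. fsum f (\<lambda>F. if map (\<lambda>(B, w). (\<sigma> ` B, w)) F = G then 1 else 0))"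
    unfolding w_comp_eq by (rule linear_on_fsum)
qed (auto simp: WSigma_def w_comp_def sum_indicator_eq_fsum)

lemma linear_on_double_fsum:
  assumes "finite {Q. g Q \<noteq> 0}"
  shows "linear_on (fsupp X) (\<lambda>f y. fsum f (\<lambda>P. fsum g (\<lambda>Q. k P Q y)))"
    "linear_on (fsupp X) (\<lambda>f y. fsum g (\<lambda>P. fsum f (\<lambda>Q. k P Q y)))"
  using assms unfolding linear_on_def fsupp_def
  by (auto simp: fsum_lincomb fsum_lincomb_right)

lemma WSigma_hmu_eq:
  assumes "f \<in> w_comp S" "g \<in> w_comp T"
  shows "hmu WSigma S T f g = (\<lambda>H. fsum f (\<lambda>F. fsum g (\<lambda>G. if qshuffle S T F G H then 1 else 0)))"
  using assms by (auto simp: WSigma_def w_comp_def sum_indicator2_eq_fsum)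

lemma bilinear_on_WSigma_hmu: "bilinear_on (w_comp S) (w_comp T) (hmu WSigma S T)"
  unfolding bilinear_on_def
proof (intro conjI ballI)
  fix g assume g: "g \<in> w_comp T"
  then have fin: "finite {G. g G \<noteq> 0}" by (simp add: w_comp_def)
  show "linear_on (w_comp S) (\<lambda>f. hmu WSigma S T f g)"
    by (rule linear_on_cong[OF _ fsubspace_w_comp WSigma_hmu_eq[OF _ g]])
      (auto simp: w_comp_eq intro!: linear_on_double_fsum(1)[OF fin])
next
  fix f assume f: "f \<in> w_comp S"
  then have fin: "finite {F. f F \<noteq> 0}" by (simp add: w_comp_def)
  show "linear_on (w_comp T) (\<lambda>g. hmu WSigma S T f g)"
    by (rule linear_on_cong[OF _ fsubspace_w_comp WSigma_hmu_eq[OF f]])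
      (auto simp: w_comp_eq intro!: linear_on_double_fsum(2)[OF fin])
qed

text \<open>The argument is lifted along the surjection \<open>Phi\<close>; on a single polyhedron
  the coproduct is a pure tensor or zero.\<close>

lemma WSigma_hdelta_in_tspace:
  assumes "S \<inter> T = {}" "a \<in> w_comp (S \<union> T)"
  shows "hdelta WSigma S T a \<in> tspace (w_comp S) (w_comp T)"
proof -
  obtain f where f: "f \<in> gp_comp (S \<union> T)" "a = Phi (S \<union> T) f" using Phi_surj assms(2) by (metis imageE)
  have "(\<lambda>f. hdelta WSigma S T (Phi (S \<union> T) f)) ` lspan (basisv ` {P. egp (S \<union> T) P}) \<subseteq> tspace (w_comp S) (w_comp T)"
  proof (rule linear_on_image_subset[OF _ fsubspace_tspace])
    show "linear_on (lspan (basisv ` {P. egp (S \<union> T) P})) (\<lambda>f. hdelta WSigma S T (Phi (S \<union> T) f))"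
      using linear_on_comp[OF linear_on_Phi linear_on_WSigma_hdelta[of UNIV], of "S \<union> T" S T]
      by (simp add: gp_comp_lspan)
    fix v assume "v \<in> basisv ` {P. egp (S \<union> T) P}"
    then obtain P where "egp (S \<union> T) P" "v = basisv P" by blast
    then show "hdelta WSigma S T (Phi (S \<union> T) v) \<in> tspace (w_comp S) (w_comp T)"
      using WSigma_hdelta_phi[OF _ assms(1)]
      by (simp add: tens_in_tspace phi_in_w_comp fsubspace_zero[OF fsubspace_tspace])
  qed
  then show ?thesis using f by (auto simp: gp_comp_lspan)
qed

lemma tensor_psi: "tensor_maps (w_comp S) (w_comp T) (psi S) (psi T)"
  by (intro tensor_maps.intro linear_on_psi fsubspace_w_comp)

lemma linear_on_Ind_hdelta:
  assumes "S \<inter> T = {}" shows "linear_on (hcomp Ind (S \<union> T)) (hdelta Ind S T)"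
proof -
  have "linear_on (hcomp Ind (S \<union> T)) (\<lambda>h. hdelta WSigma S T (iota (S \<union> T) h))"
    by (rule linear_on_comp[OF linear_on_iota linear_on_WSigma_hdelta[of UNIV]]) simp
  then have "linear_on (hcomp Ind (S \<union> T)) (\<lambda>h. tmap (w_comp S) (w_comp T) (psi S) (psi T) (hdelta WSigma S T (iota (S \<union> T) h)))"
    by (rule linear_on_comp[OF _ tensor_maps.linear_on_tmap[OF tensor_psi]])
      (use WSigma_hdelta_in_tspace[OF assms] iota_in_w_comp in blast)
  then show ?thesis by (simp add: Ind_def)
qed

lemma Ind_hdelta_in_tspace:
  assumes "S \<inter> T = {}" "h \<in> hcomp Ind (S \<union> T)"
  shows "hdelta Ind S T h \<in> tspace (hcomp Ind S) (hcomp Ind T)"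
proof -
  have "tmap (w_comp S) (w_comp T) (psi S) (psi T) (hdelta WSigma S T (iota (S \<union> T) h))
      \<in> tspace (hcomp Ind S) (hcomp Ind T)"
    by (rule tensor_maps.tmap_in_tspace[OF tensor_psi WSigma_hdelta_in_tspace[OF assms(1) iota_in_w_comp[OF assms(2)]]])
      (auto intro: psi_in_Ind)
  then show ?thesis by (simp add: Ind_def)
qed

text \<open>On generators the transported coproduct is the polyhedral one. With this formula the
  coproduct axioms reduce to the identities between faces.\<close>

lemma Ind_hdelta_indic:
  assumes P: "egp (S \<union> T) P" and disj: "S \<inter> T = {}"
  shows "hdelta Ind S T (indic P) =
    (if ebounded S P then tens (indic (pres S P)) (indic (pcon S T P)) else (\<lambda>_. 0))"
proof -
  have "hdelta Ind S T (indic P) = tmap (w_comp S) (w_comp T) (psi S) (psi T) (hdelta WSigma S T (phi (S \<union> T) P))"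
    by (simp add: Ind_def iota_indic[OF P])
  then show ?thesis
    using WSigma_hdelta_phi[OF P disj] psi_phi[OF egp_pres[OF P disj]] psi_phi[OF egp_pcon[OF P disj]]
    by (cases "ebounded S P")
      (simp_all add: tensor_maps.tmap_tens[OF tensor_psi phi_in_w_comp phi_in_w_comp]
        linear_on_zero[OF tensor_maps.linear_on_tmap[OF tensor_psi] fsubspace_tspace])
qed

lemma Ind_hrel_indic: "hrel Ind \<sigma> I (indic P) = indic (ppush \<sigma> I P)"
  by (auto simp: Ind_def indic_def ppush_def fun_eq_iff)

lemma Ind_hmu_indic: "hmu Ind S T (indic P) (indic Q) = indic (pprod S T P Q)"
  by (auto simp: Ind_def indic_def pprod_def fun_eq_iff)

lemma linear_on_Ind_hrel: "linear_on V (hrel Ind \<sigma> I)"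
  by (auto simp: linear_on_def Ind_def fun_eq_iff)

lemma linear_on_Ind_hmu: "linear_on V (\<lambda>f. hmu Ind S T f g)" "linear_on V (hmu Ind S T f)"
  by (auto simp: linear_on_def Ind_def fun_eq_iff algebra_simps)

lemma Ind_hrel_closed:
  assumes "inj_on \<sigma> I" "f \<in> hcomp Ind I" shows "hrel Ind \<sigma> I f \<in> hcomp Ind (\<sigma> ` I)"
  by (rule Ind_imageI[OF linear_on_Ind_hrel fsubspace_Ind _ assms(2)])
    (use assms(1) in \<open>simp add: Ind_hrel_indic indic_in_Ind egp_ppush\<close>)

lemma Ind_hmu_closed:
  assumes "S \<inter> T = {}" "f \<in> hcomp Ind S" "g \<in> hcomp Ind T"
  shows "hmu Ind S T f g \<in> hcomp Ind (S \<union> T)"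
proof (rule Ind_imageI[OF linear_on_Ind_hmu(1) fsubspace_Ind _ assms(2)])
  fix P assume P: "egp S P"
  show "hmu Ind S T (indic P) g \<in> hcomp Ind (S \<union> T)"
    by (rule Ind_imageI[OF linear_on_Ind_hmu(2) fsubspace_Ind _ assms(3)])
      (use P assms(1) in \<open>simp add: Ind_hmu_indic indic_in_Ind egp_pprod\<close>)
qed

text \<open>The relabelling and product of \<open>Ind\<close> are cut off to 0 outside
  \<open>RI\<close>, so the identity and unit laws need the members of a component to vanish
  there.\<close>

lemma Ind_outside_RI:
  assumes "f \<in> hcomp Ind I" "x \<notin> RI I" shows "f x = 0"
proof -
  have "lspan (indic ` {P. egp I P}) \<subseteq> {f. \<forall>x. x \<notin> RI I \<longrightarrow> f x = 0}"
    by (rule lspan_minimal) (auto simp: fsubspace_def indic_def dest: subsetD[OF egp_RI])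
  then show ?thesis using assms unfolding Ind_comp by blast
qed

lemma tensor_Ind:
  assumes "linear_on (hcomp Ind S) \<phi>" "linear_on (hcomp Ind T) \<psi>"
  shows "tensor_maps (hcomp Ind S) (hcomp Ind T) \<phi> \<psi>"
  by (intro tensor_maps.intro assms fsubspace_Ind)

text \<open>The arbitrary representation \<open>L\<close> is absorbed into \<open>tmap\<close>. Then
  both sides are linear in \<open>h\<close> and are compared on indicator functions. The other
  axioms involving coproducts are treated in the same way.\<close>

lemma Ind_hdelta_natural:
  assumes disj: "S \<inter> T = {}" and inj: "inj_on \<sigma> (S \<union> T)" and h: "h \<in> hcomp Ind (S \<union> T)"
    and L: "trep (hcomp Ind S) (hcomp Ind T) (hdelta Ind S T h) L"
  shows "hdelta Ind (\<sigma> ` S) (\<sigma> ` T) (hrel Ind \<sigma> (S \<union> T) h)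
     = (\<lambda>p. sum_list (map (\<lambda>(a, b). tens (hrel Ind \<sigma> S a) (hrel Ind \<sigma> T b) p) L))"
proof -
  have d: "\<sigma> ` S \<inter> \<sigma> ` T = {}" using inj disj by (metis inj_on_image_Int image_empty sup_ge1 sup_ge2)
  have im: "\<sigma> ` S \<union> \<sigma> ` T = \<sigma> ` (S \<union> T)" by (simp add: image_Un)
  note tm = tensor_Ind[OF linear_on_Ind_hrel[of "hcomp Ind S" \<sigma> S] linear_on_Ind_hrel[of "hcomp Ind T" \<sigma> T]]
  let ?t = "tmap (hcomp Ind S) (hcomp Ind T) (hrel Ind \<sigma> S) (hrel Ind \<sigma> T)"
  have "hdelta Ind (\<sigma> ` S) (\<sigma> ` T) (hrel Ind \<sigma> (S \<union> T) h) = ?t (hdelta Ind S T h)"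
  proof (rule Ind_eqI[OF _ _ _ h])
    show "linear_on (hcomp Ind (S \<union> T)) (\<lambda>h. hdelta Ind (\<sigma> ` S) (\<sigma> ` T) (hrel Ind \<sigma> (S \<union> T) h))"
      by (rule linear_on_comp[OF linear_on_Ind_hrel linear_on_Ind_hdelta[OF d]])
        (use Ind_hrel_closed[OF inj] im in simp)
    show "linear_on (hcomp Ind (S \<union> T)) (\<lambda>h. ?t (hdelta Ind S T h))"
      by (rule linear_on_comp[OF linear_on_Ind_hdelta[OF disj] tensor_maps.linear_on_tmap[OF tm] Ind_hdelta_in_tspace[OF disj]])
    fix P assume P: "egp (S \<union> T) P"
    have Q: "egp (\<sigma> ` S \<union> \<sigma> ` T) (ppush \<sigma> (S \<union> T) P)" using egp_ppush[OF P inj] im by simp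
    have eb: "ebounded (\<sigma> ` S) (ppush \<sigma> (S \<union> T) P) \<longleftrightarrow> ebounded S P" by (rule ebounded_ppush[OF P inj]) simp
    show "hdelta Ind (\<sigma> ` S) (\<sigma> ` T) (hrel Ind \<sigma> (S \<union> T) (indic P)) = ?t (hdelta Ind S T (indic P))"
    proof (cases "ebounded S P")
      case True
      show ?thesis
        using Ind_hdelta_indic[OF Q d] Ind_hdelta_indic[OF P disj] face_ppush[OF P disj inj True] True eb
          tensor_maps.tmap_tens[OF tm indic_in_Ind[OF egp_pres[OF P disj True]] indic_in_Ind[OF egp_pcon[OF P disj True]]]
        by (simp add: Ind_hrel_indic)
    next
      case False
      then show ?thesis
        using Ind_hdelta_indic[OF Q d] Ind_hdelta_indic[OF P disj] eb
          linear_on_zero[OF tensor_maps.linear_on_tmap[OF tm] fsubspace_tspace]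
        by (simp add: Ind_hrel_indic)
    qed
  qed
  then show ?thesis using tensor_maps.tmap_trep'[OF tm L] by simp
qed

lemma Ind_coassoc:
  assumes disj: "R \<inter> S = {}" "R \<inter> T = {}" "S \<inter> T = {}" and h: "h \<in> hcomp Ind (R \<union> S \<union> T)"
    and L: "trep (hcomp Ind (R \<union> S)) (hcomp Ind T) (hdelta Ind (R \<union> S) T h) L"
    and M: "trep (hcomp Ind R) (hcomp Ind (S \<union> T)) (hdelta Ind R (S \<union> T) h) M"
  shows "sum_list (map (\<lambda>(a, b). hdelta Ind R S a (x, y) * b z) L)
       = sum_list (map (\<lambda>(a, b). a x * hdelta Ind S T b (y, z)) M)"
proof -
  have d1: "(R \<union> S) \<inter> T = {}" and d2: "R \<inter> (S \<union> T) = {}" using disj by auto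
  have un: "R \<union> S \<union> T = R \<union> (S \<union> T)" by (rule Un_assoc)
  note tL = tensor_Ind[OF linear_on_Ind_hdelta[OF disj(1)] linear_on_id[of "hcomp Ind T"]]
  note tM = tensor_Ind[OF linear_on_id[of "hcomp Ind R"] linear_on_Ind_hdelta[OF disj(3)]]
  let ?l = "tmap (hcomp Ind (R \<union> S)) (hcomp Ind T) (hdelta Ind R S) (\<lambda>b. b)"
  let ?m = "tmap (hcomp Ind R) (hcomp Ind (S \<union> T)) (\<lambda>a. a) (hdelta Ind S T)"
  \<comment> \<open>The two iterated coproducts live on differently bracketed triples;
    \<open>?r\<close> rebrackets.\<close>
  let ?r = "\<lambda>((x, y), z). (x, (y, z))"
  have "?l (hdelta Ind (R \<union> S) T h) = (\<lambda>q. ?m (hdelta Ind R (S \<union> T) h) (?r q))"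
  proof (rule Ind_eqI[OF _ _ _ h])
    show "linear_on (hcomp Ind (R \<union> S \<union> T)) (\<lambda>h. ?l (hdelta Ind (R \<union> S) T h))"
      by (rule linear_on_comp[OF linear_on_Ind_hdelta[OF d1] tensor_maps.linear_on_tmap[OF tL] Ind_hdelta_in_tspace[OF d1]])
    have "linear_on (hcomp Ind (R \<union> (S \<union> T))) (\<lambda>h. ?m (hdelta Ind R (S \<union> T) h))"
      by (rule linear_on_comp[OF linear_on_Ind_hdelta[OF d2] tensor_maps.linear_on_tmap[OF tM] Ind_hdelta_in_tspace[OF d2]])
    then show "linear_on (hcomp Ind (R \<union> S \<union> T)) (\<lambda>h q. ?m (hdelta Ind R (S \<union> T) h) (?r q))"
      unfolding un by (rule linear_on_reindex)
    fix P assume P: "egp (R \<union> S \<union> T) P"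
    then have P': "egp (R \<union> (S \<union> T)) P" by (simp add: un)
    note l0 = linear_on_zero[OF tensor_maps.linear_on_tmap[OF tL] fsubspace_tspace]
    note m0 = linear_on_zero[OF tensor_maps.linear_on_tmap[OF tM] fsubspace_tspace]
    note dl = Ind_hdelta_indic[OF P d1] and dm = Ind_hdelta_indic[OF P' d2]
    \<comment> \<open>Both orders of splitting give a nonzero result exactly when both
      \<open>R\<close> and \<open>R \<union> S\<close> are bounded on \<open>P\<close>, though each
      meets the two conditions in the opposite order.\<close>
    have l: "?l (hdelta Ind (R \<union> S) T (indic P)) = (if ebounded (R \<union> S) P \<and> ebounded R P then
        tens (tens (indic (pres R (pres (R \<union> S) P))) (indic (pcon R S (pres (R \<union> S) P)))) (indic (pcon (R \<union> S) T P)) else (\<lambda>_. 0))"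
    proof (cases "ebounded (R \<union> S) P")
      case True
      note c = P d1 True
      have "ebounded R (pres (R \<union> S) P) \<longleftrightarrow> ebounded R P" by (rule ebounded_pres[OF c]) simp
      then show ?thesis
        using dl True tensor_maps.tmap_tens[OF tL indic_in_Ind[OF egp_pres[OF c]] indic_in_Ind[OF egp_pcon[OF c]]]
          Ind_hdelta_indic[OF egp_pres[OF c] disj(1)] by (auto simp: tens_def)
    qed (use dl l0 in simp)
    have m: "?m (hdelta Ind R (S \<union> T) (indic P)) = (if ebounded (R \<union> S) P \<and> ebounded R P then
        tens (indic (pres R P)) (tens (indic (pres S (pcon R (S \<union> T) P))) (indic (pcon S T (pcon R (S \<union> T) P)))) else (\<lambda>_. 0))"
    proof (cases "ebounded R P")
      case True
      note c = P' d2 True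
      have "ebounded S (pcon R (S \<union> T) P) \<longleftrightarrow> ebounded (R \<union> S) P" by (rule ebounded_pcon[OF c]) simp
      then show ?thesis
        using dm True tensor_maps.tmap_tens[OF tM indic_in_Ind[OF egp_pres[OF c]] indic_in_Ind[OF egp_pcon[OF c]]]
          Ind_hdelta_indic[OF egp_pcon[OF c] disj(3)] by (auto simp: tens_def)
    qed (use dm m0 in simp)
    show "?l (hdelta Ind (R \<union> S) T (indic P)) = (\<lambda>q. ?m (hdelta Ind R (S \<union> T) (indic P)) (?r q))"
      unfolding l m using face_face[OF P disj] by (auto simp: tens_def fun_eq_iff)
  qed
  then have "?l (hdelta Ind (R \<union> S) T h) ((x, y), z) = ?m (hdelta Ind R (S \<union> T) h) (x, (y, z))" by simp
  then show ?thesis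
    using tensor_maps.tmap_trep[OF tL L, of "(x, y)" z] tensor_maps.tmap_trep[OF tM M, of x "(y, z)"] by simp
qed

lemma Ind_counit:
  assumes "h \<in> hcomp Ind I"
  shows "hdelta Ind {} I h = tens (hone Ind) h" "hdelta Ind I {} h = tens h (hone Ind)"
proof -
  have one: "hone Ind = indic (RI {})" by (simp add: Ind_def)
  have t: "linear_on V (\<lambda>h. tens f h)" "linear_on V (\<lambda>h. tens h f)"
    for V :: "(('a \<Rightarrow> real) \<Rightarrow> real) set" and f :: "('a \<Rightarrow> real) \<Rightarrow> real"
    by (auto simp: linear_on_def tens_def fun_eq_iff algebra_simps)
  show "hdelta Ind {} I h = tens (hone Ind) h"
  proof (rule Ind_eqI[OF _ t(1) _ assms])
    show "linear_on (hcomp Ind I) (hdelta Ind {} I)" using linear_on_Ind_hdelta[of "{}" I] by simp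
    show "hdelta Ind {} I (indic P) = tens (hone Ind) (indic P)" if "egp I P" for P
      using Ind_hdelta_indic[of "{}" I P] that egp_hv(1)[OF that] face_trivial[OF that] by (simp add: one)
  qed
  show "hdelta Ind I {} h = tens h (hone Ind)"
  proof (rule Ind_eqI[OF _ t(2) _ assms])
    show "linear_on (hcomp Ind I) (hdelta Ind I {})" using linear_on_Ind_hdelta[of I "{}"] by simp
    show "hdelta Ind I {} (indic P) = tens (indic P) (hone Ind)" if "egp I P" for P
      using Ind_hdelta_indic[of I "{}" P] that egp_hv(2)[OF that] face_trivial[OF that] by (simp add: one)
  qed
qed

text \<open>The axiom is stated by the four cells of the two decompositions, so that
  \<open>face_pprod\<close> applies directly on generators.\<close>

lemma Ind_compatible:
  assumes disj: "a \<inter> b = {}" "a \<inter> c = {}" "a \<inter> d = {}" "b \<inter> c = {}" "b \<inter> d = {}" "c \<inter> d = {}"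
    and f: "f \<in> hcomp Ind (a \<union> b)" and g: "g \<in> hcomp Ind (c \<union> d)"
    and L: "trep (hcomp Ind a) (hcomp Ind b) (hdelta Ind a b f) L"
    and M: "trep (hcomp Ind c) (hcomp Ind d) (hdelta Ind c d g) M"
  shows "hdelta Ind (a \<union> c) (b \<union> d) (hmu Ind (a \<union> b) (c \<union> d) f g) =
     (\<lambda>(p, q). sum_list (map (\<lambda>(u, v). sum_list (map (\<lambda>(s, t). hmu Ind a c u s p * hmu Ind b d v t q) M)) L))"
proof -
  have ds: "(a \<union> b) \<inter> (c \<union> d) = {}" "(a \<union> c) \<inter> (b \<union> d) = {}" using disj by auto
  have un: "(a \<union> c) \<union> (b \<union> d) = (a \<union> b) \<union> (c \<union> d)" by auto
  let ?D = "\<lambda>f g. hdelta Ind (a \<union> c) (b \<union> d) (hmu Ind (a \<union> b) (c \<union> d) f g)"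
  have linD: "linear_on (hcomp Ind (a \<union> b)) (\<lambda>f. ?D f g)" if "g \<in> hcomp Ind (c \<union> d)" for g
    by (rule linear_on_comp[OF linear_on_Ind_hmu(1) linear_on_Ind_hdelta[OF ds(2)]])
      (use Ind_hmu_closed[OF ds(1) _ that] un in simp)
  have linD': "linear_on (hcomp Ind (c \<union> d)) (\<lambda>g. ?D f g)" if "f \<in> hcomp Ind (a \<union> b)" for f
    by (rule linear_on_comp[OF linear_on_Ind_hmu(2) linear_on_Ind_hdelta[OF ds(2)]])
      (use Ind_hmu_closed[OF ds(1) that] un in simp)
  note tf = tensor_Ind[OF linear_on_Ind_hmu(1)[of "hcomp Ind a" a c] linear_on_Ind_hmu(1)[of "hcomp Ind b" b d]]
  note tg = tensor_Ind[OF linear_on_Ind_hmu(2)[of "hcomp Ind c" a c] linear_on_Ind_hmu(2)[of "hcomp Ind d" b d]]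
  \<comment> \<open>\<open>?F\<close> evaluates the product on the coproduct of \<open>f\<close>
    with a tensor of \<open>g\<close> held fixed, \<open>?G\<close> the other way round. They absorb
    the representations \<open>L\<close> and \<open>M\<close> one at a time.\<close>
  let ?F = "\<lambda>s t. tmap (hcomp Ind a) (hcomp Ind b) (\<lambda>u. hmu Ind a c u s) (\<lambda>v. hmu Ind b d v t)"
  let ?G = "\<lambda>u v. tmap (hcomp Ind c) (hcomp Ind d) (hmu Ind a c u) (hmu Ind b d v)"
  have gen: "?D (indic P) (indic Q) = (if ebounded a P \<and> ebounded c Q then
      ?G (indic (pres a P)) (indic (pcon a b P)) (hdelta Ind c d (indic Q)) else (\<lambda>_. 0))"
    if P: "egp (a \<union> b) P" and Q: "egp (c \<union> d) Q" for P Q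
  proof -
    let ?R = "pprod (a \<union> b) (c \<union> d) P Q"
    have R: "egp ((a \<union> c) \<union> (b \<union> d)) ?R" using egp_pprod[OF P Q ds(1)] un by simp
    have ac: "(a \<union> c) \<inter> (a \<union> b) = a" "(a \<union> c) \<inter> (c \<union> d) = c" using disj by auto
    have "a \<union> c \<subseteq> (a \<union> b) \<union> (c \<union> d)" by auto
    from ebounded_pprod[OF P Q ds(1) this] have eb: "ebounded (a \<union> c) ?R \<longleftrightarrow> ebounded a P \<and> ebounded c Q"
      by (simp add: ac)
    show ?thesis
    proof (cases "ebounded a P \<and> ebounded c Q")
      case True
      then have cP: "egp (a \<union> b) P" "a \<inter> b = {}" "ebounded a P" and cQ: "egp (c \<union> d) Q" "c \<inter> d = {}" "ebounded c Q"
        using P Q disj by auto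
      show ?thesis
        using Ind_hdelta_indic[OF R ds(2)] Ind_hdelta_indic[OF Q disj(6)] face_pprod[OF P Q disj cP(3) cQ(3)] True eb
          tensor_maps.tmap_tens[OF tg indic_in_Ind[OF egp_pres[OF cQ]] indic_in_Ind[OF egp_pcon[OF cQ]]]
        by (simp add: Ind_hmu_indic)
    next
      case False
      then show ?thesis using Ind_hdelta_indic[OF R ds(2)] eb by (auto simp: Ind_hmu_indic)
    qed
  qed
  \<comment> \<open>Both sides are linear in \<open>f\<close>, and for a generator \<open>f\<close> both sides are linear in \<open>g\<close>.\<close>
  have step: "?D (indic P) g = (\<lambda>pq. \<Sum>(s, t)\<leftarrow>M. ?F s t (hdelta Ind a b (indic P)) pq)"
    if P: "egp (a \<union> b) P" for P
  proof (cases "ebounded a P")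
    case True
    note c = P disj(1) True
    let ?u = "indic (pres a P)" and ?v = "indic (pcon a b P)"
    have "?D (indic P) g = ?G ?u ?v (hdelta Ind c d g)"
    proof (rule Ind_eqI[OF linD'[OF indic_in_Ind[OF P]] _ _ g])
      show "linear_on (hcomp Ind (c \<union> d)) (\<lambda>g. ?G ?u ?v (hdelta Ind c d g))"
        by (rule linear_on_comp[OF linear_on_Ind_hdelta[OF disj(6)] tensor_maps.linear_on_tmap[OF tg] Ind_hdelta_in_tspace[OF disj(6)]])
      fix Q assume Q: "egp (c \<union> d) Q"
      show "?D (indic P) (indic Q) = ?G ?u ?v (hdelta Ind c d (indic Q))"
        using gen[OF P Q] True Ind_hdelta_indic[OF Q disj(6)]
          linear_on_zero[OF tensor_maps.linear_on_tmap[OF tg] fsubspace_tspace] by auto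
    qed
    also have "\<dots> = (\<lambda>pq. \<Sum>(s, t)\<leftarrow>M. tens (hmu Ind a c ?u s) (hmu Ind b d ?v t) pq)"
      by (rule tensor_maps.tmap_trep'[OF tg M])
    also have "\<dots> = (\<lambda>pq. \<Sum>(s, t)\<leftarrow>M. ?F s t (hdelta Ind a b (indic P)) pq)"
      using Ind_hdelta_indic[OF P disj(1)] True
        tensor_maps.tmap_tens[OF tf indic_in_Ind[OF egp_pres[OF c]] indic_in_Ind[OF egp_pcon[OF c]]] by simp
    finally show ?thesis .
  next
    case False
    have "?D (indic P) g = (\<lambda>_. 0)"
    proof (rule Ind_eqI[OF linD'[OF indic_in_Ind[OF P]] _ _ g])
      show "linear_on (hcomp Ind (c \<union> d)) (\<lambda>g _. 0)" by (simp add: linear_on_def)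
    qed (use gen[OF P] False in auto)
    then show ?thesis
      using Ind_hdelta_indic[OF P disj(1)] False
        linear_on_zero[OF tensor_maps.linear_on_tmap[OF tf] fsubspace_tspace] by (simp add: case_prod_unfold)
  qed
  have "?D f g = (\<lambda>pq. \<Sum>(s, t)\<leftarrow>M. ?F s t (hdelta Ind a b f) pq)"
  proof (rule Ind_eqI[OF linD[OF g] _ step f])
    have "linear_on (hcomp Ind (a \<union> b)) (\<lambda>f pq. \<Sum>st\<leftarrow>M. ?F (fst st) (snd st) (hdelta Ind a b f) pq)"
      by (intro linear_on_sum_list_maps linear_on_comp[OF linear_on_Ind_hdelta[OF disj(1)]
            tensor_maps.linear_on_tmap[OF tf] Ind_hdelta_in_tspace[OF disj(1)]])
    then show "linear_on (hcomp Ind (a \<union> b)) (\<lambda>f pq. \<Sum>(s, t)\<leftarrow>M. ?F s t (hdelta Ind a b f) pq)"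
      by (simp add: case_prod_unfold)
  qed
  also have "\<dots> = (\<lambda>(p, q). \<Sum>(s, t)\<leftarrow>M. \<Sum>(u, v)\<leftarrow>L. hmu Ind a c u s p * hmu Ind b d v t q)"
    using tensor_maps.tmap_trep[OF tf L] by (auto simp: fun_eq_iff)
  also have "\<dots> = (\<lambda>(p, q). \<Sum>(u, v)\<leftarrow>L. \<Sum>(s, t)\<leftarrow>M. hmu Ind a c u s p * hmu Ind b d v t q)"
    by (simp add: case_prod_unfold sum_list_swap[of _ M L])
  finally show ?thesis .
qed

theorem hopf_monoid_Ind: "hopf_monoid (Ind :: ('a, 'a \<Rightarrow> real) hstruct)"
proof -
  have one: "hone Ind = indic (RI {} :: ('a \<Rightarrow> real) set)" by (simp add: Ind_def)
  have rel: "hrel Ind \<sigma> I f y = (if y \<in> RI (\<sigma> ` I) then f (\<lambda>i. if i \<in> I then y (\<sigma> i) else 0) else 0)"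
    for \<sigma> :: "'a \<Rightarrow> 'a" and I f y by (simp add: Ind_def)
  have mu: "hmu Ind S T f g x = (if x \<in> RI (S \<union> T) then f (restr S x) * g (restr T x) else 0)"
    for S T :: "'a set" and f g x by (simp add: Ind_def)
  have rel_cong: "hrel Ind \<sigma> I f = hrel Ind \<tau> I f" if "\<forall>i\<in>I. \<sigma> i = \<tau> i" for I :: "'a set" and \<sigma> \<tau> f
  proof
    fix y :: "'a \<Rightarrow> real"
    have "\<sigma> ` I = \<tau> ` I" "(\<lambda>i. if i \<in> I then y (\<sigma> i) else 0) = (\<lambda>i. if i \<in> I then y (\<tau> i) else 0)"
      using that by auto
    then show "hrel Ind \<sigma> I f y = hrel Ind \<tau> I f y" by (simp only: rel)
  qed
  have rel_id: "hrel Ind id I f = f" if "f \<in> hcomp Ind I" for I :: "'a set" and f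
  proof
    fix y :: "'a \<Rightarrow> real"
    have "(\<lambda>i. if i \<in> I then y (id i) else 0) = restr I y" by (auto simp: restr_def)
    then show "hrel Ind id I f y = f y"
      using Ind_outside_RI[OF that, of y] restr_id[of y I] by (simp add: rel)
  qed
  have rel_comp: "hrel Ind (\<tau> \<circ> \<sigma>) I f = hrel Ind \<tau> (\<sigma> ` I) (hrel Ind \<sigma> I f)" for I :: "'a set" and \<sigma> \<tau> f
  proof
    fix y :: "'a \<Rightarrow> real"
    let ?x = "\<lambda>i. if i \<in> \<sigma> ` I then y (\<tau> i) else 0"
    have "?x \<in> RI (\<sigma> ` I)" by (simp add: RI_def)
    moreover have "(\<lambda>i. if i \<in> I then ?x (\<sigma> i) else 0) = (\<lambda>i. if i \<in> I then y ((\<tau> \<circ> \<sigma>) i) else 0)" by auto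
    moreover have "(\<tau> \<circ> \<sigma>) ` I = \<tau> ` \<sigma> ` I" by auto
    ultimately show "hrel Ind (\<tau> \<circ> \<sigma>) I f y = hrel Ind \<tau> (\<sigma> ` I) (hrel Ind \<sigma> I f) y" by (simp only: rel if_True)
  qed
  have one_ne: "hone Ind \<noteq> (\<lambda>_::'a \<Rightarrow> real. 0)"
  proof
    assume "hone Ind = (\<lambda>_::'a \<Rightarrow> real. 0)"
    from fun_cong[OF this, of "\<lambda>_. 0"] show False by (simp add: one indic_def RI_def)
  qed
  have conn: "\<exists>c. v = (\<lambda>x. c * hone Ind x)" if "v \<in> hcomp Ind {}" for v :: "('a \<Rightarrow> real) \<Rightarrow> real"
  proof -
    have "fsubspace {v :: ('a \<Rightarrow> real) \<Rightarrow> real. \<exists>c. v = (\<lambda>x. c * hone Ind x)}"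
      unfolding fsubspace_def
    proof safe
      show "\<exists>c. (\<lambda>_. 0) = (\<lambda>x. c * hone Ind x)" by (rule exI[of _ 0]) simp
      show "\<exists>e. (\<lambda>x. c * hone Ind x + d * hone Ind x) = (\<lambda>x. e * hone Ind x)" for c d
        by (rule exI[of _ "c + d"]) (simp add: distrib_right)
      show "\<exists>e. (\<lambda>x. c * (d * hone Ind x)) = (\<lambda>x. e * hone Ind x)" for c d
        by (rule exI[of _ "c * d"]) (simp add: mult.assoc)
    qed
    then have "lspan (indic ` {P. egp {} P}) \<subseteq> {v :: ('a \<Rightarrow> real) \<Rightarrow> real. \<exists>c. v = (\<lambda>x. c * hone Ind x)}"
      by (rule lspan_minimal) (auto simp: one[symmetric] dest!: egp_empty intro!: exI[of _ 1])
    then show ?thesis using that unfolding Ind_comp by blast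
  qed
  have mu_nat: "hrel Ind \<sigma> (S \<union> T) (hmu Ind S T f g) = hmu Ind (\<sigma> ` S) (\<sigma> ` T) (hrel Ind \<sigma> S f) (hrel Ind \<sigma> T g)"
    if "inj_on \<sigma> (S \<union> T)" for S T :: "'a set" and \<sigma> f g
  proof
    fix y :: "'a \<Rightarrow> real"
    let ?x = "\<lambda>i. if i \<in> S \<union> T then y (\<sigma> i) else 0"
    have "?x \<in> RI (S \<union> T)" by (simp add: RI_def)
    moreover have "restr S ?x = (\<lambda>i. if i \<in> S then restr (\<sigma> ` S) y (\<sigma> i) else 0)"
      "restr T ?x = (\<lambda>i. if i \<in> T then restr (\<sigma> ` T) y (\<sigma> i) else 0)"
      by (auto simp: restr_def fun_eq_iff)
    ultimately show "hrel Ind \<sigma> (S \<union> T) (hmu Ind S T f g) y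
        = hmu Ind (\<sigma> ` S) (\<sigma> ` T) (hrel Ind \<sigma> S f) (hrel Ind \<sigma> T g) y"
      by (simp only: rel mu restr_RI image_Un if_True)
  qed
  have mu_assoc: "hmu Ind (R \<union> S) T (hmu Ind R S f g) h = hmu Ind R (S \<union> T) f (hmu Ind S T g h)"
    for R S T :: "'a set" and f g h
  proof
    fix x :: "'a \<Rightarrow> real"
    have "restr R (restr (R \<union> S) x) = restr R x" "restr S (restr (R \<union> S) x) = restr S x"
      "restr S (restr (S \<union> T) x) = restr S x" "restr T (restr (S \<union> T) x) = restr T x"
      by (auto simp: restr_def)
    then show "hmu Ind (R \<union> S) T (hmu Ind R S f g) h x = hmu Ind R (S \<union> T) f (hmu Ind S T g h) x"
      by (simp add: mu restr_RI Un_assoc mult.assoc)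
  qed
  have mu_unit: "hmu Ind {} I (hone Ind) f = f" "hmu Ind I {} f (hone Ind) = f"
    if "f \<in> hcomp Ind I" for I :: "'a set" and f
  proof -
    have "x \<in> RI I \<Longrightarrow> f (restr I x) = f x" "x \<notin> RI I \<Longrightarrow> f x = 0" for x
      using Ind_outside_RI[OF that, of x] restr_id[of x I] by auto
    then show "hmu Ind {} I (hone Ind) f = f" "hmu Ind I {} f (hone Ind) = f"
      using restr_RI[of "{}"] by (auto simp: fun_eq_iff mu one indic_def)
  qed
  have compat: "hdelta Ind T1 T2 (hmu Ind S1 S2 f g)
      = (\<lambda>(p, q). sum_list (map (\<lambda>(a, b). sum_list (map (\<lambda>(c, d).
          hmu Ind (S1 \<inter> T1) (S2 \<inter> T1) a c p * hmu Ind (S1 \<inter> T2) (S2 \<inter> T2) b d q) M)) L))"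
    if st: "S1 \<inter> S2 = {}" "T1 \<inter> T2 = {}" "S1 \<union> S2 = T1 \<union> T2"
      and f: "f \<in> hcomp Ind S1" and g: "g \<in> hcomp Ind S2"
      and L: "trep (hcomp Ind (S1 \<inter> T1)) (hcomp Ind (S1 \<inter> T2)) (hdelta Ind (S1 \<inter> T1) (S1 \<inter> T2) f) L"
      and M: "trep (hcomp Ind (S2 \<inter> T1)) (hcomp Ind (S2 \<inter> T2)) (hdelta Ind (S2 \<inter> T1) (S2 \<inter> T2) g) M"
    for S1 S2 T1 T2 :: "'a set" and f g L M
  proof -
    have eqs: "S1 \<inter> T1 \<union> S1 \<inter> T2 = S1" "S2 \<inter> T1 \<union> S2 \<inter> T2 = S2" "S1 \<inter> T1 \<union> S2 \<inter> T1 = T1" "S1 \<inter> T2 \<union> S2 \<inter> T2 = T2"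
      using st by blast+
    have "S1 \<inter> T1 \<inter> (S1 \<inter> T2) = {}" "S1 \<inter> T1 \<inter> (S2 \<inter> T1) = {}" "S1 \<inter> T1 \<inter> (S2 \<inter> T2) = {}"
      "S1 \<inter> T2 \<inter> (S2 \<inter> T1) = {}" "S1 \<inter> T2 \<inter> (S2 \<inter> T2) = {}" "S2 \<inter> T1 \<inter> (S2 \<inter> T2) = {}"
      using st by blast+
    from Ind_compatible[OF this, unfolded eqs, OF f g L M] show ?thesis .
  qed
  show ?thesis
    unfolding hopf_monoid_def bilinear_on_def
    apply (intro conjI)
    subgoal using fsubspace_Ind by blast
    subgoal using linear_on_Ind_hrel Ind_hrel_closed by blast
    subgoal using rel_cong by blast
    subgoal using rel_id by blast
    subgoal using rel_comp by blast
    subgoal unfolding one by (rule indic_in_Ind[OF egp_RI_empty])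
    subgoal by (rule one_ne)
    subgoal using conn by blast
    subgoal using linear_on_Ind_hmu Ind_hmu_closed by blast
    subgoal using mu_nat by blast
    subgoal using mu_assoc by blast
    subgoal using mu_unit by blast
    subgoal using linear_on_Ind_hdelta Ind_hdelta_in_tspace by blast
    subgoal using Ind_hdelta_natural by blast
    subgoal using Ind_coassoc by blast
    subgoal using Ind_counit by blast
    subgoal using compat by blast
    done
qed

text \<open>\<open>iota\<close> sends \<open>indic P\<close> to \<open>phi I P\<close>, so on
  generators all clauses are the compatibility formulas for \<open>phi\<close>.\<close>

theorem hopf_iso_iota: "hopf_iso iota Ind (WSigma :: ('a, ('a set \<times> real) list) hstruct)"
proof -
  have comp: "hcomp (WSigma :: ('a, ('a set \<times> real) list) hstruct) = w_comp" by (simp add: WSigma_def)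
  have rel: "iota (\<sigma> ` I) (hrel Ind \<sigma> I f) = hrel WSigma \<sigma> I (iota I f)"
    if inj: "inj_on \<sigma> I" and f: "f \<in> hcomp Ind I" for I :: "'a set" and \<sigma> f
  proof (rule Ind_eqI[OF _ _ _ f])
    show "linear_on (hcomp Ind I) (\<lambda>f. iota (\<sigma> ` I) (hrel Ind \<sigma> I f))"
      by (rule linear_on_comp[OF linear_on_Ind_hrel linear_on_iota Ind_hrel_closed[OF inj]])
    show "linear_on (hcomp Ind I) (\<lambda>f. hrel WSigma \<sigma> I (iota I f))"
      by (rule linear_on_comp[OF linear_on_iota linear_on_WSigma_hrel iota_in_w_comp])
    show "iota (\<sigma> ` I) (hrel Ind \<sigma> I (indic P)) = hrel WSigma \<sigma> I (iota I (indic P))" if "egp I P" for P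
      using that inj by (simp add: Ind_hrel_indic iota_indic egp_ppush WSigma_hrel_phi)
  qed
  have mu: "iota (S \<union> T) (hmu Ind S T f g) = hmu WSigma S T (iota S f) (iota T g)"
    if disj: "S \<inter> T = {}" and fg: "f \<in> hcomp Ind S" "g \<in> hcomp Ind T" for S T :: "'a set" and f g
  proof (rule bilinear_lspan_eq[where A = "indic ` {P. egp S P}" and B = "indic ` {P. egp T P}" and f = f and g = g
        and \<beta> = "\<lambda>f g. iota (S \<union> T) (hmu Ind S T f g)" and \<gamma> = "\<lambda>f g. hmu WSigma S T (iota S f) (iota T g)",
        folded Ind_comp])
    note b = bilinear_on_WSigma_hmu[of S T, unfolded bilinear_on_def]
    show "linear_on (hcomp Ind S) (\<lambda>f. iota (S \<union> T) (hmu Ind S T f g))" if "g \<in> hcomp Ind T" for g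
      by (rule linear_on_comp[OF linear_on_Ind_hmu(1) linear_on_iota Ind_hmu_closed[OF disj _ that]])
    show "linear_on (hcomp Ind S) (\<lambda>f. hmu WSigma S T (iota S f) (iota T g))" if "g \<in> hcomp Ind T" for g
      using b iota_in_w_comp[OF that] by (intro linear_on_comp[OF linear_on_iota _ iota_in_w_comp]) blast
    show "linear_on (hcomp Ind T) (\<lambda>g. iota (S \<union> T) (hmu Ind S T f g))" if f: "f \<in> indic ` {P. egp S P}" for f
      using f indic_in_Ind
      by (intro linear_on_comp[OF linear_on_Ind_hmu(2) linear_on_iota Ind_hmu_closed[OF disj]]) auto
    show "linear_on (hcomp Ind T) (\<lambda>g. hmu WSigma S T (iota S f) (iota T g))" if f: "f \<in> indic ` {P. egp S P}" for f
    proof -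
      have "iota S f \<in> w_comp S" using f indic_in_Ind iota_in_w_comp by auto
      then show ?thesis using b by (intro linear_on_comp[OF linear_on_iota _ iota_in_w_comp]) blast
    qed
    show "iota (S \<union> T) (hmu Ind S T f g) = hmu WSigma S T (iota S f) (iota T g)"
      if "f \<in> indic ` {P. egp S P}" "g \<in> indic ` {P. egp T P}" for f g
      using that disj by (auto simp: Ind_hmu_indic iota_indic egp_pprod WSigma_hmu_phi)
  qed (use fg in auto)
  have delta: "hdelta WSigma S T (iota (S \<union> T) h) = (\<lambda>p. sum_list (map (\<lambda>(a, b). tens (iota S a) (iota T b) p) L))"
    if disj: "S \<inter> T = {}" and h: "h \<in> hcomp Ind (S \<union> T)"
      and L: "trep (hcomp Ind S) (hcomp Ind T) (hdelta Ind S T h) L" for S T :: "'a set" and h L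
  proof -
    note tm = tensor_Ind[OF linear_on_iota[of S] linear_on_iota[of T]]
    let ?t = "tmap (hcomp Ind S) (hcomp Ind T) (iota S) (iota T)"
    have "hdelta WSigma S T (iota (S \<union> T) h) = ?t (hdelta Ind S T h)"
    proof (rule Ind_eqI[OF _ _ _ h])
      show "linear_on (hcomp Ind (S \<union> T)) (\<lambda>h. hdelta WSigma S T (iota (S \<union> T) h))"
        by (rule linear_on_comp[OF linear_on_iota linear_on_WSigma_hdelta[of UNIV]]) simp
      show "linear_on (hcomp Ind (S \<union> T)) (\<lambda>h. ?t (hdelta Ind S T h))"
        by (rule linear_on_comp[OF linear_on_Ind_hdelta[OF disj] tensor_maps.linear_on_tmap[OF tm] Ind_hdelta_in_tspace[OF disj]])
      fix P assume P: "egp (S \<union> T) P"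
      show "hdelta WSigma S T (iota (S \<union> T) (indic P)) = ?t (hdelta Ind S T (indic P))"
      proof (cases "ebounded S P")
        case True
        note c = P disj True
        show ?thesis
          using Ind_hdelta_indic[OF P disj] WSigma_hdelta_phi[OF P disj] True
            tensor_maps.tmap_tens[OF tm indic_in_Ind[OF egp_pres[OF c]] indic_in_Ind[OF egp_pcon[OF c]]]
          by (simp add: iota_indic[OF P] iota_indic[OF egp_pres[OF c]] iota_indic[OF egp_pcon[OF c]])
      next
        case False
        then show ?thesis
          using Ind_hdelta_indic[OF P disj] WSigma_hdelta_phi[OF P disj]
            linear_on_zero[OF tensor_maps.linear_on_tmap[OF tm] fsubspace_tspace]
          by (simp add: iota_indic[OF P])
      qed
    qed
    then show ?thesis using tensor_maps.tmap_trep'[OF tm L] by simp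
  qed
  have one: "iota {} (hone Ind) = hone (WSigma :: ('a, ('a set \<times> real) list) hstruct)"
  proof -
    have "phi {} (RI {} :: ('a \<Rightarrow> real) set) F = basisv [] F" for F
      by (cases F) (auto simp: phi_def basisv_def wosp_iff_part)
    then show ?thesis
      using iota_indic[OF egp_RI_empty[where 'a = 'a]] by (simp add: Ind_def WSigma_def fun_eq_iff)
  qed
  have "bij_betw (iota I) (hcomp Ind I) (w_comp I)" for I :: "'a set"
    by (rule bij_betwI[where g = "psi I"]) (auto simp: iota_in_w_comp psi_in_Ind iota_psi psi_iota)
  moreover have "hopf_morphism iota Ind (WSigma :: ('a, ('a set \<times> real) list) hstruct)"
    unfolding hopf_morphism_def comp
    apply (intro conjI allI impI ballI)
    subgoal by (rule linear_on_iota)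
    subgoal using iota_in_w_comp by blast
    subgoal using rel by blast
    subgoal using mu by blast
    subgoal using delta by blast
    subgoal by (rule one)
    done
  ultimately show ?thesis by (simp add: hopf_iso_def comp)
qed

section \<open>The structure maps on formal combinations of polyhedra\<close>

lemma GPplus_comp: "hcomp GPplus = gp_comp"
  by (simp add: GPplus_def)

lemma GPplus_hrel_eq:
  "f \<in> gp_comp I \<Longrightarrow> hrel GPplus \<sigma> I f = (\<lambda>Q. fsum f (\<lambda>P. if ppush \<sigma> I P = Q then 1 else 0))"
  by (auto simp: GPplus_def gp_comp_def sum_indicator_eq_fsum)

lemma GPplus_hmu_eq:
  "f \<in> gp_comp S \<Longrightarrow> g \<in> gp_comp T \<Longrightarrow>
    hmu GPplus S T f g = (\<lambda>R. fsum f (\<lambda>P. fsum g (\<lambda>Q. if pprod S T P Q = R then 1 else 0)))"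
  by (auto simp: GPplus_def gp_comp_def sum_indicator2_eq_fsum)

lemma GPplus_hdelta_eq:
  "f \<in> gp_comp I \<Longrightarrow> hdelta GPplus S T f = (\<lambda>PQ. fsum f (\<lambda>R.
     if ebounded S R \<and> pres S R = fst PQ \<and> pcon S T R = snd PQ then 1 else 0))"
  by (auto simp: GPplus_def gp_comp_def sum_indicator_eq_fsum fun_eq_iff)

lemma linear_on_GPplus_hrel: "linear_on (gp_comp I) (hrel GPplus \<sigma> I)"
  by (rule linear_on_cong[OF _ fsubspace_gp_comp GPplus_hrel_eq]) (simp_all add: gp_comp_eq linear_on_fsum)

lemma linear_on_GPplus_hdelta: "linear_on (gp_comp I) (hdelta GPplus S T)"
  by (rule linear_on_cong[OF _ fsubspace_gp_comp GPplus_hdelta_eq]) (simp_all add: gp_comp_eq linear_on_fsum)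

lemma linear_on_GPplus_hmu:
  shows "g \<in> gp_comp T \<Longrightarrow> linear_on (gp_comp S) (\<lambda>f. hmu GPplus S T f g)"
    and "f \<in> gp_comp S \<Longrightarrow> linear_on (gp_comp T) (hmu GPplus S T f)"
proof -
  assume g: "g \<in> gp_comp T"
  then have fin: "finite {G. g G \<noteq> 0}" by (simp add: gp_comp_def)
  show "linear_on (gp_comp S) (\<lambda>f. hmu GPplus S T f g)"
    by (rule linear_on_cong[OF _ fsubspace_gp_comp GPplus_hmu_eq[OF _ g]])
      (auto simp: gp_comp_eq intro!: linear_on_double_fsum(1)[OF fin])
next
  assume f: "f \<in> gp_comp S"
  then have fin: "finite {G. f G \<noteq> 0}" by (simp add: gp_comp_def)
  show "linear_on (gp_comp T) (hmu GPplus S T f)"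
    by (rule linear_on_cong[OF _ fsubspace_gp_comp GPplus_hmu_eq[OF f]])
      (auto simp: gp_comp_eq intro!: linear_on_double_fsum(2)[OF fin])
qed

lemma GPplus_hrel_basisv: "egp I P \<Longrightarrow> hrel GPplus \<sigma> I (basisv P) = basisv (ppush \<sigma> I P)"
  unfolding GPplus_hrel_eq[OF basisv_in_gp_comp] fsum_basisv by (auto simp: basisv_def)

lemma GPplus_hmu_basisv:
  "egp S P \<Longrightarrow> egp T Q \<Longrightarrow> hmu GPplus S T (basisv P) (basisv Q) = basisv (pprod S T P Q)"
  unfolding GPplus_hmu_eq[OF basisv_in_gp_comp basisv_in_gp_comp] fsum_basisv by (auto simp: basisv_def)

lemma GPplus_hdelta_basisv:
  assumes "egp I P"
  shows "hdelta GPplus S T (basisv P) =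
    (if ebounded S P then tens (basisv (pres S P)) (basisv (pcon S T P)) else (\<lambda>_. 0))"
  unfolding GPplus_hdelta_eq[OF basisv_in_gp_comp[OF assms]] fsum_basisv
  by (auto simp: basisv_def tens_def fun_eq_iff)

lemma gp_comp_eqI:
  assumes "linear_on (gp_comp I) \<phi>" "linear_on (gp_comp I) \<psi>"
    "\<And>P. egp I P \<Longrightarrow> \<phi> (basisv P) = \<psi> (basisv P)" "f \<in> gp_comp I"
  shows "\<phi> f = \<psi> f"
  using linear_on_lspan_eq[OF assms(1,2)[unfolded gp_comp_lspan]] assms(3,4) unfolding gp_comp_lspan by blast

lemma gp_comp_imageI:
  assumes "linear_on (gp_comp I) \<phi>" "fsubspace W" "\<And>P. egp I P \<Longrightarrow> \<phi> (basisv P) \<in> W" "f \<in> gp_comp I"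
  shows "\<phi> f \<in> W"
  using linear_on_image_subset[OF assms(1)[unfolded gp_comp_lspan] assms(2)] assms(3,4) unfolding gp_comp_lspan by blast

lemma GPplus_hrel_closed:
  assumes "inj_on \<sigma> I" "f \<in> gp_comp I" shows "hrel GPplus \<sigma> I f \<in> gp_comp (\<sigma> ` I)"
  by (rule gp_comp_imageI[OF linear_on_GPplus_hrel fsubspace_gp_comp _ assms(2)])
    (use assms(1) in \<open>simp add: GPplus_hrel_basisv basisv_in_gp_comp egp_ppush\<close>)

lemma GPplus_hmu_closed:
  assumes "S \<inter> T = {}" "f \<in> gp_comp S" "g \<in> gp_comp T"
  shows "hmu GPplus S T f g \<in> gp_comp (S \<union> T)"
proof (rule gp_comp_imageI[OF linear_on_GPplus_hmu(1)[OF assms(3)] fsubspace_gp_comp _ assms(2)])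
  fix P assume P: "egp S P"
  show "hmu GPplus S T (basisv P) g \<in> gp_comp (S \<union> T)"
    by (rule gp_comp_imageI[OF linear_on_GPplus_hmu(2)[OF basisv_in_gp_comp[OF P]] fsubspace_gp_comp _ assms(3)])
      (use P assms(1) in \<open>simp add: GPplus_hmu_basisv basisv_in_gp_comp egp_pprod\<close>)
qed

lemma GPplus_hdelta_in_tspace:
  assumes "S \<inter> T = {}" "f \<in> gp_comp (S \<union> T)"
  shows "hdelta GPplus S T f \<in> tspace (gp_comp S) (gp_comp T)"
proof (rule gp_comp_imageI[OF linear_on_GPplus_hdelta fsubspace_tspace _ assms(2)])
  fix P assume P: "egp (S \<union> T) P"
  show "hdelta GPplus S T (basisv P) \<in> tspace (gp_comp S) (gp_comp T)"
    unfolding GPplus_hdelta_basisv[OF P]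
    using egp_pres[OF P assms(1)] egp_pcon[OF P assms(1)]
    by (auto intro!: tens_in_tspace basisv_in_gp_comp fsubspace_zero[OF fsubspace_tspace])
qed

lemma tensor_gp:
  assumes "linear_on (gp_comp S) \<phi>" "linear_on (gp_comp T) \<psi>"
  shows "tensor_maps (gp_comp S) (gp_comp T) \<phi> \<psi>"
  by (intro tensor_maps.intro assms fsubspace_gp_comp)

text \<open>Common argument for two targets: with \<open>indf\<close> it gives the coproduct clause
  of the morphism to \<open>Ind\<close>, with \<open>Phi\<close> it compares the coproducts of
  \<open>GPplus\<close> and \<open>WSigma\<close> in the proof that \<open>ie\<close> is a
  coideal.\<close>

lemma GPplus_hdelta_tmap:
  assumes disj: "S \<inter> T = {}" and f: "f \<in> gp_comp (S \<union> T)"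
    and lin: "linear_on (gp_comp (S \<union> T)) \<phi>" "linear_on (gp_comp S) \<phi>1" "linear_on (gp_comp T) \<phi>2"
    and gen: "\<And>P. egp (S \<union> T) P \<Longrightarrow> \<phi> (basisv P) =
      (if ebounded S P then tens (\<phi>1 (basisv (pres S P))) (\<phi>2 (basisv (pcon S T P))) else (\<lambda>_. 0))"
  shows "tmap (gp_comp S) (gp_comp T) \<phi>1 \<phi>2 (hdelta GPplus S T f) = \<phi> f"
proof (rule gp_comp_eqI[OF _ lin(1) _ f])
  note tm = tensor_gp[OF lin(2,3)]
  show "linear_on (gp_comp (S \<union> T)) (\<lambda>f. tmap (gp_comp S) (gp_comp T) \<phi>1 \<phi>2 (hdelta GPplus S T f))"
    by (rule linear_on_comp[OF linear_on_GPplus_hdelta tensor_maps.linear_on_tmap[OF tm] GPplus_hdelta_in_tspace[OF disj]])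
  fix P assume P: "egp (S \<union> T) P"
  show "tmap (gp_comp S) (gp_comp T) \<phi>1 \<phi>2 (hdelta GPplus S T (basisv P)) = \<phi> (basisv P)"
  proof (cases "ebounded S P")
    case True
    note c = P disj True
    show ?thesis
      using gen[OF P] True GPplus_hdelta_basisv[OF P, of S T]
        tensor_maps.tmap_tens[OF tm basisv_in_gp_comp[OF egp_pres[OF c]] basisv_in_gp_comp[OF egp_pcon[OF c]]] by simp
  next
    case False
    then show ?thesis
      using gen[OF P] GPplus_hdelta_basisv[OF P, of S T]
        linear_on_zero[OF tensor_maps.linear_on_tmap[OF tm] fsubspace_tspace] by simp
  qed
qed

theorem hopf_morphism_indf: "hopf_morphism indf (GPplus :: ('a, ('a \<Rightarrow> real) set) hstruct) Ind"
proof -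
  have rel: "indf (\<sigma> ` I) (hrel GPplus \<sigma> I f) = hrel Ind \<sigma> I (indf I f)"
    if inj: "inj_on \<sigma> I" and f: "f \<in> gp_comp I" for I :: "'a set" and \<sigma> f
  proof (rule gp_comp_eqI[OF _ _ _ f])
    show "linear_on (gp_comp I) (\<lambda>f. indf (\<sigma> ` I) (hrel GPplus \<sigma> I f))"
      by (rule linear_on_comp[OF linear_on_GPplus_hrel linear_on_indf GPplus_hrel_closed[OF inj]])
    show "linear_on (gp_comp I) (\<lambda>f. hrel Ind \<sigma> I (indf I f))"
      by (rule linear_on_comp[OF linear_on_indf linear_on_Ind_hrel[of UNIV]]) simp
  qed (simp add: GPplus_hrel_basisv Ind_hrel_indic)
  have mu: "indf (S \<union> T) (hmu GPplus S T f g) = hmu Ind S T (indf S f) (indf T g)"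
    if disj: "S \<inter> T = {}" and fg: "f \<in> gp_comp S" "g \<in> gp_comp T" for S T :: "'a set" and f g
  proof (rule bilinear_lspan_eq[where A = "basisv ` {P. egp S P}" and B = "basisv ` {P. egp T P}" and f = f and g = g
        and \<beta> = "\<lambda>f g. indf (S \<union> T) (hmu GPplus S T f g)" and \<gamma> = "\<lambda>f g. hmu Ind S T (indf S f) (indf T g)",
        folded gp_comp_lspan])
    show "linear_on (gp_comp S) (\<lambda>f. indf (S \<union> T) (hmu GPplus S T f g))" if "g \<in> gp_comp T" for g
      by (rule linear_on_comp[OF linear_on_GPplus_hmu(1)[OF that] linear_on_indf GPplus_hmu_closed[OF disj _ that]])
    show "linear_on (gp_comp S) (\<lambda>f. hmu Ind S T (indf S f) (indf T g))" for g
      by (rule linear_on_comp[OF linear_on_indf linear_on_Ind_hmu(1)[of UNIV]]) simp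
    show "linear_on (gp_comp T) (\<lambda>g. indf (S \<union> T) (hmu GPplus S T f g))" if "f \<in> basisv ` {P. egp S P}" for f
    proof -
      have f: "f \<in> gp_comp S" using that basisv_in_gp_comp by auto
      show ?thesis by (rule linear_on_comp[OF linear_on_GPplus_hmu(2)[OF f] linear_on_indf GPplus_hmu_closed[OF disj f]])
    qed
    show "linear_on (gp_comp T) (\<lambda>g. hmu Ind S T (indf S f) (indf T g))" for f
      by (rule linear_on_comp[OF linear_on_indf linear_on_Ind_hmu(2)[of UNIV]]) simp
    show "indf (S \<union> T) (hmu GPplus S T f g) = hmu Ind S T (indf S f) (indf T g)"
      if "f \<in> basisv ` {P. egp S P}" "g \<in> basisv ` {P. egp T P}" for f g
      using that by (auto simp: GPplus_hmu_basisv Ind_hmu_indic)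
  qed (use fg in auto)
  have delta: "hdelta Ind S T (indf (S \<union> T) h) = (\<lambda>p. sum_list (map (\<lambda>(a, b). tens (indf S a) (indf T b) p) L))"
    if disj: "S \<inter> T = {}" and h: "h \<in> gp_comp (S \<union> T)"
      and L: "trep (gp_comp S) (gp_comp T) (hdelta GPplus S T h) L" for S T :: "'a set" and h L
  proof -
    have "tmap (gp_comp S) (gp_comp T) (indf S) (indf T) (hdelta GPplus S T h) = hdelta Ind S T (indf (S \<union> T) h)"
    proof (rule GPplus_hdelta_tmap[OF disj h _ linear_on_indf linear_on_indf])
      show "linear_on (gp_comp (S \<union> T)) (\<lambda>h. hdelta Ind S T (indf (S \<union> T) h))"
        by (rule linear_on_comp[OF linear_on_indf linear_on_Ind_hdelta[OF disj]])
          (use indf_image_gp_comp in blast)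
    qed (simp add: Ind_hdelta_indic[OF _ disj])
    then show ?thesis
      using tensor_maps.tmap_trep'[OF tensor_gp[OF linear_on_indf linear_on_indf] L] by simp
  qed
  show ?thesis
    unfolding hopf_morphism_def GPplus_comp
    apply (intro conjI allI impI ballI)
    subgoal by (rule linear_on_indf)
    subgoal by (simp add: indf_image_gp_comp)
    subgoal using rel by blast
    subgoal using mu by blast
    subgoal using delta by blast
    subgoal by (simp add: GPplus_def Ind_def)
    done
qed

text \<open>Preimages of the basis vectors are chosen and extended linearly. Following
  \<open>Phi\<close> by the section gives a projection along \<open>ie\<close>, which the coideal
  argument needs.\<close>

lemma Phi_section:
  obtains s where "linear_on (w_comp I) s" "\<And>a. a \<in> w_comp I \<Longrightarrow> s a \<in> gp_comp I"
    "\<And>a. a \<in> w_comp I \<Longrightarrow> Phi I (s a) = a"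
proof -
  have "\<exists>f. f \<in> gp_comp I \<and> Phi I f = basisv F" if "wosp I F" for F
  proof -
    have "basisv F \<in> Phi I ` gp_comp I"
      unfolding Phi_surj using that by (simp add: w_comp_eq basisv_in_fsupp)
    then show ?thesis by (metis imageE)
  qed
  then obtain G where G: "\<And>F. wosp I F \<Longrightarrow> G F \<in> gp_comp I \<and> Phi I (G F) = basisv F" by metis
  define s where "s a = (\<lambda>P. fsum a (\<lambda>F. G F P))" for a
  have wl: "w_comp I = lspan (basisv ` {F. wosp I F})" by (simp add: w_comp_eq fsupp_eq_lspan)
  have lin: "linear_on (w_comp I) s" unfolding s_def w_comp_eq by (rule linear_on_fsum)
  have sb: "s (basisv F) = G F" for F by (simp add: s_def)
  have cl: "s a \<in> gp_comp I" if "a \<in> w_comp I" for a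
  proof -
    have "s ` lspan (basisv ` {F. wosp I F}) \<subseteq> gp_comp I"
      by (rule linear_on_image_subset[OF lin[unfolded wl] fsubspace_gp_comp]) (use G sb in auto)
    then show ?thesis using that unfolding wl by blast
  qed
  have "Phi I (s a) = a" if "a \<in> w_comp I" for a
    by (rule linear_on_lspan_eq[OF linear_on_comp[OF lin linear_on_Phi cl, unfolded wl] linear_on_id])
      (use that G in \<open>auto simp: wl sb\<close>)
  then show thesis using that lin cl by blast
qed

text \<open>Closure under relabelling and product follows from the morphism to \<open>Ind\<close>.
  For the coproduct let \<open>p\<close> and \<open>q\<close> be \<open>Phi\<close> followed by its
  sections. Then \<open>a \<otimes> b\<close> is the sum of \<open>p a \<otimes> q b\<close>,
  \<open>p a \<otimes> (b - q b)\<close> and \<open>(a - p a) \<otimes> b\<close>. The first terms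
  cancel over a representation of the coproduct, and the others lie in the two required
  spaces.\<close>

theorem hopf_ideal_ie: "hopf_ideal (GPplus :: ('a, ('a \<Rightarrow> real) set) hstruct) ie"
proof -
  note mor = hopf_morphism_indf[where 'a = 'a, unfolded hopf_morphism_def GPplus_comp]
  note mor_rel = conjunct1[OF conjunct2[OF mor], rule_format, OF conjI]
    and mor_mu = conjunct1[OF conjunct1[OF conjunct2[OF conjunct2[OF mor]], rule_format, OF conjI[OF _ conjI]], rule_format]
  have sub: "fsubspace (ie I)" for I :: "'a set"
    unfolding fsubspace_def
  proof (intro conjI ballI allI)
    show "(\<lambda>_. 0) \<in> ie I"
      using linear_on_zero[OF linear_on_indf fsubspace_gp_comp, of I] fsubspace_zero[OF fsubspace_gp_comp[of I]]
      by (simp add: ie_def)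
    show "(\<lambda>x. f x + g x) \<in> ie I" if "f \<in> ie I" "g \<in> ie I" for f g
      using that linear_onD[OF linear_on_indf, of f I g 1 1] fsubspace_add[OF fsubspace_gp_comp, of f I g]
      by (simp add: ie_def)
    show "(\<lambda>x. c * f x) \<in> ie I" if "f \<in> ie I" for c f
      using that linear_on_scale[OF linear_on_indf, of f I c] fsubspace_scale[OF fsubspace_gp_comp, of f I c]
      by (simp add: ie_def)
  qed
  have rel: "hrel GPplus \<sigma> I f \<in> ie (\<sigma> ` I)" if "finite I" "inj_on \<sigma> I" "f \<in> ie I" for I :: "'a set" and \<sigma> f
  proof -
    have f: "f \<in> gp_comp I" "indf I f = (\<lambda>_. 0)" using that by (auto simp: ie_def)
    have "indf (\<sigma> ` I) (hrel GPplus \<sigma> I f) = hrel Ind \<sigma> I (\<lambda>_. 0)" using mor_rel[OF that(1,2) f(1)] f(2) by simp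
    then show ?thesis
      using GPplus_hrel_closed[OF that(2) f(1)] by (simp add: ie_def Ind_def)
  qed
  have mu: "hmu GPplus S T f g \<in> ie (S \<union> T)"
    if ST: "finite S" "finite T" "S \<inter> T = {}" and f: "f \<in> gp_comp S" and g: "g \<in> gp_comp T"
      and z: "indf S f = (\<lambda>_. 0) \<or> indf T g = (\<lambda>_. 0)" for S T :: "'a set" and f g
  proof -
    have "indf (S \<union> T) (hmu GPplus S T f g) = hmu Ind S T (indf S f) (indf T g)" by (rule mor_mu[OF ST f g])
    then show ?thesis using GPplus_hmu_closed[OF ST(3) f g] z by (auto simp: ie_def Ind_def)
  qed
  have delta: "hdelta GPplus S T h \<in> ssum (tspace (gp_comp S) (ie T)) (tspace (ie S) (gp_comp T))"
    if disj: "S \<inter> T = {}" and hie: "h \<in> ie (S \<union> T)" for S T :: "'a set" and h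
  proof -
    have h: "h \<in> gp_comp (S \<union> T)" "indf (S \<union> T) h = (\<lambda>_. 0)" using hie by (auto simp: ie_def)
    obtain L where L: "trep (gp_comp S) (gp_comp T) (hdelta GPplus S T h) L"
      using trep_exists[OF GPplus_hdelta_in_tspace[OF disj h(1)] fsubspace_gp_comp] by blast
    obtain s where s: "linear_on (w_comp S) s" "\<And>a. a \<in> w_comp S \<Longrightarrow> s a \<in> gp_comp S"
      "\<And>a. a \<in> w_comp S \<Longrightarrow> Phi S (s a) = a" using Phi_section[of S] by blast
    obtain t where t: "linear_on (w_comp T) t" "\<And>a. a \<in> w_comp T \<Longrightarrow> t a \<in> gp_comp T"
      "\<And>a. a \<in> w_comp T \<Longrightarrow> Phi T (t a) = a" using Phi_section[of T] by blast
    have "tmap (gp_comp S) (gp_comp T) (Phi S) (Phi T) (hdelta GPplus S T h) = hdelta WSigma S T (Phi (S \<union> T) h)"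
    proof (rule GPplus_hdelta_tmap[OF disj h(1) _ linear_on_Phi linear_on_Phi])
      show "linear_on (gp_comp (S \<union> T)) (\<lambda>h. hdelta WSigma S T (Phi (S \<union> T) h))"
        by (rule linear_on_comp[OF linear_on_Phi linear_on_WSigma_hdelta[of UNIV]]) simp
    qed (simp add: WSigma_hdelta_phi[OF _ disj])
    also have "\<dots> = (\<lambda>_. 0)"
      unfolding Phi_eq_0[OF h] using linear_on_zero[OF linear_on_WSigma_hdelta fsubspace_w_comp] .
    finally have Phi0: "(\<Sum>(a, b)\<leftarrow>L. Phi S a F * Phi T b G) = 0" for F G
      using tensor_maps.tmap_trep[OF tensor_gp[OF linear_on_Phi linear_on_Phi] L, of F G] by simp
    let ?p = "\<lambda>a. s (Phi S a)" and ?q = "\<lambda>b. t (Phi T b)"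
    have LV: "a \<in> gp_comp S \<and> b \<in> gp_comp T" if "(a, b) \<in> set L" for a b using trep_subset[OF L] that by blast
    \<comment> \<open>\<open>Phi\<close> tensor \<open>Phi\<close> kills the coproduct of
      \<open>h\<close>, because \<open>Phi\<close> respects coproducts and vanishes on
      \<open>ie\<close>; the tensor product of the two sections keeps it zero.\<close>
    have pq0: "(\<Sum>(a, b)\<leftarrow>L. ?p a x * ?q b y) = 0" for x y
    proof -
      have "(\<Sum>(a, b)\<leftarrow>map (\<lambda>(a, b). (Phi S a, Phi T b)) L. s a x * t b y) = 0"
      proof (rule trep_zero_map[OF s(1) t(1) fsubspace_w_comp fsubspace_w_comp])
        show "set (map (\<lambda>(a, b). (Phi S a, Phi T b)) L) \<subseteq> w_comp S \<times> w_comp T"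
          using LV by (auto simp: Phi_in_w_comp)
        show "(\<Sum>(a, b)\<leftarrow>map (\<lambda>(a, b). (Phi S a, Phi T b)) L. a F * b G) = 0" for F G
          using Phi0[of F G] by (simp add: comp_def case_prod_unfold)
      qed
      then show ?thesis by (simp add: comp_def case_prod_unfold)
    qed
    \<comment> \<open>\<open>indf\<close> factors through \<open>Phi\<close>, and both terms of the
      difference have the same image under \<open>Phi\<close>.\<close>
    have ker: "(\<lambda>P. a P - r (Phi I a) P) \<in> ie I"
      if "\<And>c. c \<in> w_comp I \<Longrightarrow> r c \<in> gp_comp I" "\<And>c. c \<in> w_comp I \<Longrightarrow> Phi I (r c) = c" "a \<in> gp_comp I"
      for I :: "'a set" and r a
    proof -
      have ra: "r (Phi I a) \<in> gp_comp I" "Phi I (r (Phi I a)) = Phi I a" using that Phi_in_w_comp by auto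
      have "indf I (\<lambda>P. 1 * a P + (-1) * r (Phi I a) P) = (\<lambda>x. 1 * indf I a x + (-1) * indf I (r (Phi I a)) x)"
        by (rule linear_onD[OF linear_on_indf that(3) ra(1)])
      also have "\<dots> = (\<lambda>_. 0)" using indf_eq_psi_Phi[OF that(3)] indf_eq_psi_Phi[OF ra(1)] ra(2) by simp
      finally show ?thesis using fsubspace_lincomb[OF fsubspace_gp_comp that(3) ra(1), of 1 "-1"] by (simp add: ie_def)
    qed
    define v where "v = (\<lambda>xy. \<Sum>(a, b)\<leftarrow>map (\<lambda>(a, b). (?p a, \<lambda>P. b P - ?q b P)) L. tens a b xy)"
    define u where "u = (\<lambda>xy. \<Sum>(a, b)\<leftarrow>map (\<lambda>(a, b). (\<lambda>P. a P - ?p a P, b)) L. tens a b xy)"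
    have "trep (gp_comp S) (ie T) v (map (\<lambda>(a, b). (?p a, \<lambda>P. b P - ?q b P)) L)"
      unfolding trep_def v_def
    proof (intro conjI refl subsetI)
      fix cd assume "cd \<in> set (map (\<lambda>(a, b). (?p a, \<lambda>P. b P - ?q b P)) L)"
      then obtain a b where "(a, b) \<in> set L" and cd: "cd = (?p a, \<lambda>P. b P - ?q b P)" by auto
      then have "?p a \<in> gp_comp S" "(\<lambda>P. b P - ?q b P) \<in> ie T"
        using LV[of a b] s(2)[OF Phi_in_w_comp] ker[of T t b, OF t(2,3)] by auto
      then show "cd \<in> gp_comp S \<times> ie T" by (simp add: cd)
    qed
    then have "v \<in> tspace (gp_comp S) (ie T)" by (rule trep_in_tspace)
    have "trep (ie S) (gp_comp T) u (map (\<lambda>(a, b). (\<lambda>P. a P - ?p a P, b)) L)"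
      unfolding trep_def u_def
    proof (intro conjI refl subsetI)
      fix cd assume "cd \<in> set (map (\<lambda>(a, b). (\<lambda>P. a P - ?p a P, b)) L)"
      then obtain a b where "(a, b) \<in> set L" and cd: "cd = (\<lambda>P. a P - ?p a P, b)" by auto
      then have "(\<lambda>P. a P - ?p a P) \<in> ie S" "b \<in> gp_comp T"
        using LV[of a b] ker[of S s a, OF s(2,3)] by auto
      then show "cd \<in> ie S \<times> gp_comp T" by (simp add: cd)
    qed
    then have "u \<in> tspace (ie S) (gp_comp T)" by (rule trep_in_tspace)
    have "hdelta GPplus S T h = (\<lambda>xy. v xy + u xy)"
    proof
      fix xy :: "('a \<Rightarrow> real) set \<times> ('a \<Rightarrow> real) set"
      obtain x y where xy: "xy = (x, y)" by fastforce
      have "hdelta GPplus S T h xy = (\<Sum>(a, b)\<leftarrow>L. a x * b y) - (\<Sum>(a, b)\<leftarrow>L. ?p a x * ?q b y)"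
        using trep_eval[OF L, of x y] pq0[of x y] by (simp add: xy)
      also have "\<dots> = v xy + u xy"
        by (simp add: xy v_def u_def tens_def comp_def case_prod_unfold algebra_simps
            sum_list_addf sum_list_subtractf)
      finally show "hdelta GPplus S T h xy = v xy + u xy" .
    qed
    then show ?thesis unfolding ssum_def
      using \<open>v \<in> tspace (gp_comp S) (ie T)\<close> \<open>u \<in> tspace (ie S) (gp_comp T)\<close> by blast
  qed
  have gp: "ie I \<subseteq> gp_comp I" for I :: "'a set" by (auto simp: ie_def)
  show ?thesis
    unfolding hopf_ideal_def GPplus_comp
  proof (intro conjI allI impI ballI)
    show "hrel GPplus \<sigma> I ` ie I \<subseteq> ie (\<sigma> ` I)" if "finite I \<and> inj_on \<sigma> I" for I :: "'a set" and \<sigma>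
      using rel that by blast
    show "hmu GPplus S T f h \<in> ie (S \<union> T)"
      if "finite S \<and> finite T \<and> S \<inter> T = {}" "f \<in> ie S" "h \<in> gp_comp T" for S T :: "'a set" and f h
      using that by (intro mu) (auto simp: ie_def)
    show "hmu GPplus S T f h \<in> ie (S \<union> T)"
      if "finite S \<and> finite T \<and> S \<inter> T = {}" "f \<in> gp_comp S" "h \<in> ie T" for S T :: "'a set" and f h
      using that by (intro mu) (auto simp: ie_def)
    show "hdelta GPplus S T h \<in> ssum (tspace (gp_comp S) (ie T)) (tspace (ie S) (gp_comp T))"
      if "finite S \<and> finite T \<and> S \<inter> T = {}" "h \<in> ie (S \<union> T)" for S T :: "'a set" and h
      using that by (intro delta) auto
  qed (rule sub gp)+
qed

section \<open>Hopf submonoids spanned by polyhedra\<close>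

lemma hcomp_update_select:
  "hcomp (K\<lparr>hcomp := C\<rparr>) = C" "hrel (K\<lparr>hcomp := C\<rparr>) = hrel K" "hmu (K\<lparr>hcomp := C\<rparr>) = hmu K"
  "hdelta (K\<lparr>hcomp := C\<rparr>) = hdelta K" "hone (K\<lparr>hcomp := C\<rparr>) = hone K"
  by simp_all

text \<open>The span of the indicator functions is the image of the given submonoid under
  \<open>indf\<close>. Each closure property is therefore the image of the corresponding one under a
  Hopf morphism, and a representation of a coproduct inside the submonoid is also one inside
  \<open>GPplus\<close>.\<close>

theorem Ind_submonoid:
  fixes \<F> :: "'a set \<Rightarrow> ('a \<Rightarrow> real) set set"
  assumes \<F>: "\<And>I. finite I \<Longrightarrow> \<F> I \<subseteq> {P. egp I P}"
    and H: "hopf_submonoid GPplus (\<lambda>I. lspan (basisv ` \<F> I))"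
  shows "hopf_submonoid Ind (\<lambda>I. lspan (indic ` \<F> I))"
    and "hopf_morphism indf (GPplus\<lparr>hcomp := (\<lambda>I. lspan (basisv ` \<F> I))\<rparr>)
                            (Ind\<lparr>hcomp := (\<lambda>I. lspan (indic ` \<F> I))\<rparr>)"
    and "hopf_surj indf (GPplus\<lparr>hcomp := (\<lambda>I. lspan (basisv ` \<F> I))\<rparr>)
                        (Ind\<lparr>hcomp := (\<lambda>I. lspan (indic ` \<F> I))\<rparr>)"
proof -
  let ?C = "\<lambda>I. lspan (basisv ` \<F> I)" and ?D = "\<lambda>I. lspan (indic ` \<F> I)"
  note mor = hopf_morphism_indf[where 'a = 'a, unfolded hopf_morphism_def GPplus_comp]
  note sm = H[unfolded hopf_submonoid_def GPplus_comp]
  note mor_rel = conjunct1[OF conjunct2[OF mor], rule_format, OF conjI]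
    and mor_mu = conjunct1[OF conjunct1[OF conjunct2[OF conjunct2[OF mor]], rule_format, OF conjI[OF _ conjI]], rule_format]
    and mor_delta = conjunct2[OF conjunct1[OF conjunct2[OF conjunct2[OF mor]], rule_format, OF conjI[OF _ conjI]], rule_format]
    and mor_one = conjunct2[OF conjunct2[OF conjunct2[OF mor]]]
  note sm_sub = conjunct1[OF sm, rule_format]
    and sm_rel = subsetD[OF conjunct1[OF conjunct2[OF sm], rule_format, OF conjI] imageI]
    and sm_one = conjunct1[OF conjunct2[OF conjunct2[OF sm]]]
    and sm_mu = conjunct1[OF conjunct2[OF conjunct2[OF conjunct2[OF sm]], rule_format, OF conjI[OF _ conjI]], rule_format]
    and sm_delta = conjunct2[OF conjunct2[OF conjunct2[OF conjunct2[OF sm]], rule_format, OF conjI[OF _ conjI]], rule_format]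
  have CG: "?C I \<subseteq> gp_comp I" if "finite I" for I by (rule conjunct2[OF sm_sub[OF that]])
  have im: "indf I ` ?C I = ?D I" if "finite I" for I
    using linear_on_image_lspan[OF linear_on_subset[OF linear_on_indf CG[OF that]]]
    by (simp add: image_image)
  have Dex: "\<exists>f\<in>?C I. g = indf I f" if "finite I" "g \<in> ?D I" for I g using im[OF that(1)] that(2) by blast
  have CD: "indf I f \<in> ?D I" if "finite I" "f \<in> ?C I" for I f using im[OF that(1)] that(2) by blast
  have delta: "hdelta Ind S T (indf (S \<union> T) h) = (\<lambda>p. sum_list (map (\<lambda>(a, b). tens (indf S a) (indf T b) p) L))"
    if "finite S" "finite T" "S \<inter> T = {}" "h \<in> ?C (S \<union> T)" "trep (?C S) (?C T) (hdelta GPplus S T h) L" for S T h L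
  proof -
    have "trep (gp_comp S) (gp_comp T) (hdelta GPplus S T h) L"
      using trep_mono[OF that(5) CG[OF that(1)] CG[OF that(2)]] .
    moreover have "h \<in> gp_comp (S \<union> T)" using CG[of "S \<union> T"] that by blast
    ultimately show ?thesis using mor_delta[OF that(1-3)] by simp
  qed
  have Ddelta: "hdelta Ind S T h \<in> tspace (?D S) (?D T)"
    if ST: "finite S" "finite T" "S \<inter> T = {}" and h: "h \<in> ?D (S \<union> T)" for S T h
  proof -
    obtain f where f: "f \<in> ?C (S \<union> T)" "h = indf (S \<union> T) f" using Dex[of "S \<union> T" h] ST h by blast
    have "hdelta GPplus S T f \<in> tspace (?C S) (?C T)" by (rule sm_delta[OF ST f(1)])
    then obtain L where L: "trep (?C S) (?C T) (hdelta GPplus S T f) L"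
      using trep_exists[OF _ fsubspace_lspan] by blast
    have "set (map (\<lambda>(a, b). (indf S a, indf T b)) L) \<subseteq> ?D S \<times> ?D T"
    proof
      fix cd assume "cd \<in> set (map (\<lambda>(a, b). (indf S a, indf T b)) L)"
      then obtain a b where ab: "(a, b) \<in> set L" "cd = (indf S a, indf T b)" by auto
      then have "a \<in> ?C S" "b \<in> ?C T" using trep_subset[OF L] by blast+
      then show "cd \<in> ?D S \<times> ?D T"
        unfolding ab(2) by (intro SigmaI CD[OF ST(1)] CD[OF ST(2)])
    qed
    moreover have "hdelta Ind S T h = (\<lambda>p. \<Sum>(a, b)\<leftarrow>L. tens (indf S a) (indf T b) p)"
      using delta[OF ST f(1) L] f(2) by (simp only:)
    then have "hdelta Ind S T h = (\<lambda>p. \<Sum>(a, b)\<leftarrow>map (\<lambda>(a, b). (indf S a, indf T b)) L. tens a b p)"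
      by (simp add: comp_def case_prod_unfold)
    ultimately show ?thesis
      using trep_in_tspace[OF iffD2[OF trep_def conjI]] by blast
  qed
  have Drel: "hrel Ind \<sigma> I g \<in> ?D (\<sigma> ` I)" if I: "finite I" "inj_on \<sigma> I" and g: "g \<in> ?D I" for I \<sigma> g
  proof -
    obtain f where f: "f \<in> ?C I" "g = indf I f" using Dex[OF I(1) g] by blast
    have "hrel GPplus \<sigma> I f \<in> ?C (\<sigma> ` I)" by (rule sm_rel[OF I f(1)])
    then have "indf (\<sigma> ` I) (hrel GPplus \<sigma> I f) \<in> ?D (\<sigma> ` I)" by (rule CD[OF finite_imageI[OF I(1)]])
    moreover have "f \<in> gp_comp I" using CG[OF I(1)] f(1) by blast
    then have "indf (\<sigma> ` I) (hrel GPplus \<sigma> I f) = hrel Ind \<sigma> I g" unfolding f(2) by (rule mor_rel[OF I])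
    ultimately show ?thesis by (simp only:)
  qed
  have Dmu: "hmu Ind S T g g' \<in> ?D (S \<union> T)"
    if ST: "finite S" "finite T" "S \<inter> T = {}" and g: "g \<in> ?D S" "g' \<in> ?D T" for S T g g'
  proof -
    obtain f f' where f: "f \<in> ?C S" "g = indf S f" "f' \<in> ?C T" "g' = indf T f'"
      using Dex[OF ST(1) g(1)] Dex[OF ST(2) g(2)] by blast
    have "hmu GPplus S T f f' \<in> ?C (S \<union> T)" by (rule sm_mu[OF ST f(1,3)])
    then have "indf (S \<union> T) (hmu GPplus S T f f') \<in> ?D (S \<union> T)"
      by (rule CD[OF finite_UnI[OF ST(1,2)]])
    moreover have "f \<in> gp_comp S" "f' \<in> gp_comp T" using CG[OF ST(1)] CG[OF ST(2)] f by blast+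
    then have "indf (S \<union> T) (hmu GPplus S T f f') = hmu Ind S T g g'"
      unfolding f(2,4) by (rule mor_mu[OF ST])
    ultimately show ?thesis by (simp only:)
  qed
  have one: "hone Ind \<in> ?D {}"
  proof -
    have "indf {} (hone GPplus) \<in> ?D {}" by (rule CD[OF finite.emptyI sm_one])
    then show ?thesis using mor_one by simp
  qed
  have DK: "?D I \<subseteq> hcomp Ind I" if "finite I" for I
    unfolding Ind_comp using \<F>[OF that] by (intro lspan_mono image_mono)
  show "hopf_submonoid Ind ?D"
    unfolding hopf_submonoid_def
  proof (intro conjI allI impI ballI)
    show "hrel Ind \<sigma> I ` ?D I \<subseteq> ?D (\<sigma> ` I)" if "finite I \<and> inj_on \<sigma> I" for I \<sigma>
      using Drel[of I \<sigma>] that by blast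
    show "hmu Ind S T f h \<in> ?D (S \<union> T)"
      if "finite S \<and> finite T \<and> S \<inter> T = {}" "f \<in> ?D S" "h \<in> ?D T" for S T f h
      using Dmu[of S T f h] that by blast
    show "hdelta Ind S T h \<in> tspace (?D S) (?D T)"
      if "finite S \<and> finite T \<and> S \<inter> T = {}" "h \<in> ?D (S \<union> T)" for S T h
      using Ddelta[of S T h] that by blast
  qed (rule DK one fsubspace_lspan, assumption?)+
  show "hopf_surj indf (GPplus\<lparr>hcomp := ?C\<rparr>) (Ind\<lparr>hcomp := ?D\<rparr>)"
    unfolding hopf_surj_def using im by simp
  show "hopf_morphism indf (GPplus\<lparr>hcomp := ?C\<rparr>) (Ind\<lparr>hcomp := ?D\<rparr>)"
    unfolding hopf_morphism_def hcomp_update_select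
  proof (intro conjI allI impI ballI)
    show "linear_on (?C I) (indf I)" if "finite I" for I
      by (rule linear_on_subset[OF linear_on_indf CG[OF that]])
    show "indf I ` ?C I \<subseteq> ?D I" if "finite I" for I using im[OF that] by simp
    show "indf (\<sigma> ` I) (hrel GPplus \<sigma> I f) = hrel Ind \<sigma> I (indf I f)"
      if "finite I \<and> inj_on \<sigma> I" "f \<in> ?C I" for I \<sigma> f
      using mor_rel[of I \<sigma> f] CG[of I] that by blast
    show "indf (S \<union> T) (hmu GPplus S T f g) = hmu Ind S T (indf S f) (indf T g)"
      if "finite S \<and> finite T \<and> S \<inter> T = {}" "f \<in> ?C S" "g \<in> ?C T" for S T f g
      using mor_mu[of S T f g] CG[of S] CG[of T] that by blast
    show "hdelta Ind S T (indf (S \<union> T) h) = (\<lambda>p. \<Sum>(a, b)\<leftarrow>L. tens (indf S a) (indf T b) p)"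
      if "finite S \<and> finite T \<and> S \<inter> T = {}" "h \<in> ?C (S \<union> T)" "trep (?C S) (?C T) (hdelta GPplus S T h) L" for S T h L
      using delta[of S T h L] that by blast
    show "indf {} (hone GPplus) = hone (Ind :: ('a, 'a \<Rightarrow> real) hstruct)" by (rule mor_one)
  qed
qed

theorem theoremA:
  shows "hopf_ideal (GPplus :: ('a, ('a \<Rightarrow> real) set) hstruct) ie \<and>
    (\<exists>K :: ('a, 'a \<Rightarrow> real) hstruct.
       (\<forall>I. finite I \<longrightarrow> hcomp K I = lspan {indic P | P. egp I P}) \<and>
       hopf_monoid K \<and> hopf_morphism indf GPplus K \<and> hopf_surj indf GPplus K \<and>
       (\<exists>\<phi>. hopf_iso \<phi> K (WSigma :: ('a, ('a set \<times> real) list) hstruct)) \<and>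
       (\<forall>\<F> :: 'a set \<Rightarrow> ('a \<Rightarrow> real) set set.
          (\<forall>I. finite I \<longrightarrow> \<F> I \<subseteq> {P. egp I P}) \<and>
          hopf_submonoid GPplus (\<lambda>I. lspan (basisv ` \<F> I)) \<longrightarrow>
            hopf_submonoid K (\<lambda>I. lspan (indic ` \<F> I)) \<and>
            hopf_morphism indf (GPplus\<lparr>hcomp := (\<lambda>I. lspan (basisv ` \<F> I))\<rparr>)
                               (K\<lparr>hcomp := (\<lambda>I. lspan (indic ` \<F> I))\<rparr>) \<and>
            hopf_surj indf (GPplus\<lparr>hcomp := (\<lambda>I. lspan (basisv ` \<F> I))\<rparr>)
                           (K\<lparr>hcomp := (\<lambda>I. lspan (indic ` \<F> I))\<rparr>)))"
proof (intro conjI exI[of _ Ind] allI impI)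
  show "hopf_ideal GPplus ie" by (rule hopf_ideal_ie)
  show "hcomp Ind I = lspan {indic P | P. egp I P}" for I :: "'a set" by (simp add: Ind_def)
  show "hopf_monoid Ind" by (rule hopf_monoid_Ind)
  show "hopf_morphism indf GPplus Ind" by (rule hopf_morphism_indf)
  show "hopf_surj indf GPplus Ind" by (simp add: hopf_surj_def GPplus_comp indf_image_gp_comp)
  show "\<exists>\<phi>. hopf_iso \<phi> Ind WSigma" using hopf_iso_iota by blast
qed (use Ind_submonoid in blast)+

end
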